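(* Let $T>0$, let $\omega$ be a control function on $\{(s,t)\mid 0\le s\le t\le T\}$, and let $x_0\colon[0,T]\to\mathbb{R}$ and $\mathbf{x}=(x_n)_{n\ge1}$, $x_n\colon[0,T]\to\mathbb{C}$, be driving functions that are controlled by $\omega$. Let $\alpha$ be the smallest real solution to the quartic equation $2x^{4}-8x^{3}+11x^{2}-10x+2=0$ (then $\alpha$ is positive), and suppose that $\omega(0,T)<\alpha/2$. Then a holomorphic solution $(f_t)_{0\le t\le T}$ to the controlled Loewner--Kufarev equation driven by $(x_0,\mathbf{x})$ exists uniquely. Moreover, for each $t\in[0,T]$, the function $f_t$ is univalent and starlike on $\mathbb{D}$ and extends to a holomorphic function on an open neighbourhood of $\overline{\mathbb{D}}$.
   Context: $\mathbb{D}=\{z\in\mathbb{C}:|z|<1\}$ and $\mathbb{R}_+=[0,\infty)$. For a continuous function $F\colon[0,T]\to\mathbb{C}$ of bounded variation, $dF$ is the atomless complex measure on $[0,T]$ with $dF((a,b])=F(b)-F(a)$, and $|dF|$ is its total variation measure. Driving functions: $x_0\colon[0,T]\to\mathbb{R}$ and $x_n\colon[0,T]\to\mathbb{C}$, $n\ge1$, are continuous functions of bounded variation such that, with $\mathbf{x}=(x_1,x_2,\ldots)$ and $\xi(\mathbf{x},z)_t:=\sum_{n=1}^\infty x_n(t)z^n$, (1) $x_0(0)=0$; (2) the power series $\xi(\mathbf{x},z)_0$ has convergence radius at least one; (3) $\sum_{n=1}^\infty |dx_n|([0,T])\,r^n$ converges for all $r\in(0,1)$. Under these assumptions, for each $z\in\mathbb{D}$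 the function $t\mapsto\xi(\mathbf{x},z)_t$ is continuous and of bounded variation, and $d\xi(\mathbf{x},z)_t=\sum_{n=1}^\infty dx_n(t)\,z^n$ (convergence in total variation norm). Solution: a family $(f_t)_{0\le t\le T}$ of holomorphic functions on $\mathbb{D}$ is a (holomorphic) solution to the controlled Loewner--Kufarev equation driven by $(x_0,\mathbf{x})$ if $t\mapsto f_t$ is continuous in the topology of locally uniform convergence on $\mathbb{D}$ and $$f_t(z)-z=\int_0^t z f_s'(z)\,\{dx_0(s)+d\xi(\mathbf{x},z)_s\},\quad t\in[0,T],\ z\in\mathbb{D},$$ where $'$ denotes the derivative in $z$. Control function: a continuous function $\omega\colon\{(s,t)\mid 0\le s\le t\le T\}\to\mathbb{R}_+$ with $\omega(t,t)=0$ for all $t$ and $\omega(s,t)+\omega(t,u)\le\omega(s,u)$ whenever $0\le s\le t\le u\le T$. Controlled by $\omega$: for $n\ge1$, $1\le p\le n$ and integers $i_1,\ldots,i_p\ge1$ with $i_1+\cdots+i_p=n$, put $$I_{i_1,\ldots,i_p}(t):=e^{nx_0(t)}\int_{0\le u_1<\cdots<u_p\le t}e^{-i_1x_0(u_1)}\,dx_{i_1}(u_1)\cdots e^{-i_px_0(u_p)}\,dx_{i_p}(u_p).$$ The driving functions are controlled by $\omega$ if, for all such $n,p,i_1,\ldots,i_p$ and all $0\le s\le t\le T$, $$|I_{i_1,\ldots,i_p}(t)|\le\frac{\omega(0,t)^n}{n!}\quad\text{and}\quad |I_{i_1,\ldots,i_p}(t)-I_{i_1,\ldots,i_p}(s)|\le\omega(s,t)\frac{\omega(0,T)^{n-1}}{(n-1)!}.$$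 The equation is then called the $\omega$-controlled Loewner--Kufarev equation. Univalent means holomorphic and injective. A univalent function $f$ on $\mathbb{D}$ with $f(0)=0$ is starlike if $f(\mathbb{D})$ is starlike with respect to the origin, i.e. $\lambda w\in f(\mathbb{D})$ for all $w\in f(\mathbb{D})$ and $\lambda\in[0,1]$. *)

theory Defs
  imports "HOL-Complex_Analysis.Complex_Analysis"
begin

section \<open>Functions of bounded variation\<close>

definition partition_sums :: "(real \<Rightarrow> 'a::real_normed_vector) \<Rightarrow> real \<Rightarrow> real \<Rightarrow> real set" where
  "partition_sums F a b =
     {(\<Sum>k<n. norm (F (p (Suc k)) - F (p k))) | p n.
        p 0 = a \<and> p n = b \<and> (\<forall>k<n. p k \<le> p (Suc k))}"

definition bounded_variation :: "(real \<Rightarrow> 'a::real_normed_vector) \<Rightarrow> real \<Rightarrow> real \<Rightarrow> bool" where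
  "bounded_variation F a b \<longleftrightarrow> bdd_above (partition_sums F a b)"

definition variation :: "(real \<Rightarrow> 'a::real_normed_vector) \<Rightarrow> real \<Rightarrow> real \<Rightarrow> real" where
  "variation F a b = Sup (partition_sums F a b)"

section \<open>The complex measure \<open>dF\<close>\<close>

text \<open>
  The libraries have no signed or complex measures, so \<open>dF\<close> is represented by its Jordan
  decomposition.  For a real function \<open>G\<close> on \<open>[0,T]\<close> with variation function \<open>V t = variation G 0 t\<close>
  one has \<open>dG = d((V + G)/2) - d((V - G)/2)\<close>, a difference of two Lebesgue--Stieltjes measures of
  nondecreasing functions; for complex \<open>F\<close> this is applied to the real and the imaginary part.
  Since \<^const>\<open>interval_measure\<close> lives on the whole line, functions are extended from \<open>[0,T]\<close> by
  their boundary values, which puts no mass outside \<open>[0,T]\<close>.  The lemmas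
  \<open>cmeasure_Ioc\<close>, \<open>cmeasure_sums\<close> and \<open>cmeasure_singleton\<close> below show that the resulting set function
  is the atomless complex measure with \<open>dF((a,b]) = F(b) - F(a)\<close>.
\<close>

definition clip :: "real \<Rightarrow> real \<Rightarrow> real" where
  "clip T t = max 0 (min T t)"

definition pos_meas :: "real \<Rightarrow> (real \<Rightarrow> real) \<Rightarrow> real measure" where
  "pos_meas T G = interval_measure (\<lambda>t. (variation G 0 (clip T t) + G (clip T t)) / 2)"

definition neg_meas :: "real \<Rightarrow> (real \<Rightarrow> real) \<Rightarrow> real measure" where
  "neg_meas T G = interval_measure (\<lambda>t. (variation G 0 (clip T t) - G (clip T t)) / 2)"

definition cmeasure :: "real \<Rightarrow> (real \<Rightarrow> complex) \<Rightarrow> real set \<Rightarrow> complex" where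
  "cmeasure T F A =
     Complex (measure (pos_meas T (Re \<circ> F)) A - measure (neg_meas T (Re \<circ> F)) A)
             (measure (pos_meas T (Im \<circ> F)) A - measure (neg_meas T (Im \<circ> F)) A)"

text \<open>\<open>cintegral T F A g\<close> is the integral of \<open>g\<close> over \<open>A\<close> with respect to \<open>dF\<close>.\<close>

definition cintegral :: "real \<Rightarrow> (real \<Rightarrow> complex) \<Rightarrow> real set \<Rightarrow> (real \<Rightarrow> complex) \<Rightarrow> complex" where
  "cintegral T F A g =
     ((LINT u:A|pos_meas T (Re \<circ> F). g u) - (LINT u:A|neg_meas T (Re \<circ> F). g u))
     + \<i> * ((LINT u:A|pos_meas T (Im \<circ> F). g u) - (LINT u:A|neg_meas T (Im \<circ> F). g u))"

text \<open>The total variation measure \<open>|\<mu>|\<close> of a complex Borel measure \<open>\<mu>\<close> on the line.\<close>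

definition total_variation :: "(real set \<Rightarrow> complex) \<Rightarrow> real set \<Rightarrow> real" where
  "total_variation \<mu> A =
     Sup {(\<Sum>E\<in>P. norm (\<mu> E)) | P. finite P \<and> partition_on A P \<and> P \<subseteq> sets borel}"

subsection \<open>Adequacy of \<open>cmeasure\<close>\<close>

lemma norm_diff_in_partition_sums: "a \<le> b \<Longrightarrow> norm (F b - F a) \<in> partition_sums F a b"
  unfolding partition_sums_def
  by (intro CollectI exI[of _ "\<lambda>k::nat. if k = 0 then a else b"] exI[of _ "1::nat"]) auto

lemma partition_sums_nonempty: "a \<le> b \<Longrightarrow> partition_sums F a b \<noteq> {}"
  using norm_diff_in_partition_sums by blast

lemma partition_sums_concat:
  assumes "u \<in> partition_sums F a b" "v \<in> partition_sums F b c"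
  shows "u + v \<in> partition_sums F a c"
proof -
  obtain p n where p: "u = (\<Sum>k<n. norm (F (p (Suc k)) - F (p k)))" "p 0 = a" "p n = b"
    "\<forall>k<n. p k \<le> p (Suc k)"
    using assms(1) unfolding partition_sums_def by blast
  obtain q m where q: "v = (\<Sum>k<m. norm (F (q (Suc k)) - F (q k)))" "q 0 = b" "q m = c"
    "\<forall>k<m. q k \<le> q (Suc k)"
    using assms(2) unfolding partition_sums_def by blast
  define r where "r k = (if k \<le> n then p k else q (k - n))" for k
  have rq: "r (n + k) = q k" for k
    using p(3) q(2) by (auto simp: r_def)
  have rq': "r (Suc (n + k)) = q (Suc k)" for k
    using rq[of "Suc k"] by simp
  have "(\<Sum>k<n + m. norm (F (r (Suc k)) - F (r k)))
      = (\<Sum>k<n. norm (F (r (Suc k)) - F (r k))) + (\<Sum>k<m. norm (F (r (Suc (n + k))) - F (r (n + k))))"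
    by (induction m) auto
  also have "(\<Sum>k<n. norm (F (r (Suc k)) - F (r k))) = u"
    unfolding p(1) by (intro sum.cong) (auto simp: r_def)
  also have "(\<Sum>k<m. norm (F (r (Suc (n + k))) - F (r (n + k)))) = v"
    unfolding q(1) rq rq' ..
  finally have s: "u + v = (\<Sum>k<n + m. norm (F (r (Suc k)) - F (r k)))" by simp
  have "r k \<le> r (Suc k)" if "k < n + m" for k
  proof (cases "k < n")
    case True then show ?thesis using p(4) by (simp add: r_def)
  next
    case False
    then obtain j where "k = n + j" by (metis le_Suc_ex not_less)
    then show ?thesis using that q(4) by (simp add: rq rq')
  qed
  moreover have "r 0 = a" "r (n + m) = c" using p q rq[of m] by (auto simp: r_def)
  ultimately show ?thesis unfolding partition_sums_def using s by blast
qed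

lemma partition_mono:
  fixes p :: "nat \<Rightarrow> real"
  assumes "\<forall>k<n. p k \<le> p (Suc k)" "i \<le> j" "j \<le> n"
  shows "p i \<le> p j"
  using assms(2,3)
proof (induction j rule: dec_induct)
  case (step m)
  then show ?case using assms(1) by (metis Suc_le_lessD less_or_eq_imp_le order_trans)
qed simp

lemma partition_sums_max:
  assumes "p 0 = a" "p n = b" "\<forall>k<n. p k \<le> p (Suc k)" "a \<le> t" "t \<le> b"
  shows "(\<Sum>k<n. norm (F (max t (p (Suc k))) - F (max t (p k)))) \<in> partition_sums F t b"
  unfolding partition_sums_def
  using assms
  by (intro CollectI exI[of _ "\<lambda>k. max t (p k)"] exI[of _ n] conjI refl allI impI max.mono) auto

lemma partition_sums_min:
  assumes "p 0 = a" "p n = b" "\<forall>k<n. p k \<le> p (Suc k)" "a \<le> t" "t \<le> b"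
  shows "(\<Sum>k<n. norm (F (min t (p (Suc k))) - F (min t (p k)))) \<in> partition_sums F a t"
  unfolding partition_sums_def
  using assms
  by (intro CollectI exI[of _ "\<lambda>k. min t (p k)"] exI[of _ n] conjI refl allI impI min.mono) auto

lemma bounded_variation_subinterval:
  assumes "bounded_variation F a b" "a \<le> c" "c \<le> d" "d \<le> b"
  shows "bounded_variation F c d"
proof -
  obtain M where M: "\<And>x. x \<in> partition_sums F a b \<Longrightarrow> x \<le> M"
    using assms(1) unfolding bounded_variation_def bdd_above_def by blast
  have "x \<le> M" if "x \<in> partition_sums F c d" for x
  proof -
    have "norm (F c - F a) + x \<in> partition_sums F a d"
      by (rule partition_sums_concat[OF norm_diff_in_partition_sums that]) fact
    from partition_sums_concat[OF this norm_diff_in_partition_sums[OF assms(4)]] M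
    have "norm (F c - F a) + x + norm (F b - F d) \<le> M" by blast
    then show ?thesis using norm_ge_zero[of "F c - F a"] norm_ge_zero[of "F b - F d"] by linarith
  qed
  then show ?thesis unfolding bounded_variation_def bdd_above_def by blast
qed

lemma variation_upper:
  "bounded_variation F a b \<Longrightarrow> x \<in> partition_sums F a b \<Longrightarrow> x \<le> variation F a b"
  unfolding bounded_variation_def variation_def by (rule cSup_upper)

lemma variation_add:
  assumes bv: "bounded_variation F a b" and "a \<le> c" "c \<le> b"
  shows "variation F a b = variation F a c + variation F c b"
proof (rule antisym)
  have bv1: "bounded_variation F a c" and bv2: "bounded_variation F c b"
    using assms bounded_variation_subinterval by force+
  show "variation F a b \<le> variation F a c + variation F c b"
    unfolding variation_def[of F a b]
  proof (rule cSup_least)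
    show "partition_sums F a b \<noteq> {}" using assms by (intro partition_sums_nonempty) auto
    fix x assume "x \<in> partition_sums F a b"
    then obtain p n where p: "x = (\<Sum>k<n. norm (F (p (Suc k)) - F (p k)))" "p 0 = a" "p n = b"
      "\<forall>k<n. p k \<le> p (Suc k)"
      unfolding partition_sums_def by blast
    have "norm (F (p (Suc k)) - F (p k)) \<le> norm (F (min c (p (Suc k))) - F (min c (p k)))
          + norm (F (max c (p (Suc k))) - F (max c (p k)))" if "k < n" for k
    proof -
      have "p k \<le> p (Suc k)" using p(4) that by blast
      moreover have "norm (F (p (Suc k)) - F (p k)) \<le> norm (F c - F (p k)) + norm (F (p (Suc k)) - F c)"
        using norm_triangle_ineq[of "F c - F (p k)" "F (p (Suc k)) - F c"] by simp
      ultimately show ?thesis by (auto simp: min_def max_def)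
    qed
    then have "x \<le> (\<Sum>k<n. norm (F (min c (p (Suc k))) - F (min c (p k))))
          + (\<Sum>k<n. norm (F (max c (p (Suc k))) - F (max c (p k))))"
      unfolding p(1) sum.distrib[symmetric] by (intro sum_mono) auto
    also have "\<dots> \<le> variation F a c + variation F c b"
      by (intro add_mono variation_upper[OF bv1] variation_upper[OF bv2]
          partition_sums_min[OF p(2-4)] partition_sums_max[OF p(2-4)] assms)
    finally show "x \<le> variation F a c + variation F c b" .
  qed
  have "u + v \<le> variation F a b" if "u \<in> partition_sums F a c" "v \<in> partition_sums F c b" for u v
    by (rule variation_upper[OF bv partition_sums_concat[OF that]])
  then have *: "u \<le> variation F a b - v" if "u \<in> partition_sums F a c" "v \<in> partition_sums F c b" for u v
    using that by (simp add: le_diff_eq)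
  have "variation F a c \<le> variation F a b - v" if "v \<in> partition_sums F c b" for v
    unfolding variation_def[of F a c]
    by (rule cSup_least[OF partition_sums_nonempty[OF \<open>a \<le> c\<close>]]) (rule *[OF _ that])
  then have **: "v \<le> variation F a b - variation F a c" if "v \<in> partition_sums F c b" for v
    using that by (simp add: le_diff_eq add.commute)
  have "variation F c b \<le> variation F a b - variation F a c"
    unfolding variation_def[of F c b]
    by (rule cSup_least[OF partition_sums_nonempty[OF \<open>c \<le> b\<close>]]) (rule **)
  then show "variation F a c + variation F c b \<le> variation F a b" by simp
qed

lemma norm_diff_le_variation:
  assumes "bounded_variation F a b" "a \<le> s" "s \<le> t" "t \<le> b"
  shows "norm (F t - F s) \<le> variation F a t - variation F a s"
proof -
  have "variation F a t = variation F a s + variation F s t"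
    using assms by (intro variation_add bounded_variation_subinterval[OF assms(1)]) auto
  moreover have "norm (F t - F s) \<le> variation F s t"
    using assms by (intro variation_upper norm_diff_in_partition_sums
        bounded_variation_subinterval[OF assms(1)]) auto
  ultimately show ?thesis by simp
qed

text \<open>
  \<open>variation F a t\<close> and \<open>variation F t b\<close> are both lower semicontinuous in \<open>t\<close>, and their sum is
  constant.
\<close>

lemma continuous_on_variation:
  assumes bv: "bounded_variation F a b" and "a \<le> b" and F: "continuous_on {a..b} F"
  shows "continuous_on {a..b} (variation F a)"
  unfolding continuous_on_iff
proof (intro ballI allI impI)
  fix s e :: real assume s: "s \<in> {a..b}" and e: "0 < e"
  define V where "V = variation F a b"
  have add: "variation F a t + variation F t b = V" if "t \<in> {a..b}" for t
    unfolding V_def using variation_add[OF bv, of t] that by simp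
  have bvt: "bounded_variation F a t" "bounded_variation F t b" if "t \<in> {a..b}" for t
    using that by (auto intro: bounded_variation_subinterval[OF bv])
  have in_range: "p k \<in> {p 0..p n}" if "\<forall>k<n. p k \<le> p (Suc k)" "k \<le> n" for p :: "nat \<Rightarrow> real" and k n
    using partition_mono[OF that(1), of 0 k] partition_mono[OF that(1), of k n] that by auto
  have lower: "\<exists>d>0. \<forall>t\<in>{a..b}. dist t s < d \<longrightarrow> variation F a s - e < variation F a t"
  proof -
    have "variation F a s - e / 2 < Sup (partition_sums F a s)"
      using e by (simp add: variation_def)
    then obtain x where x: "x \<in> partition_sums F a s" "variation F a s - e / 2 < x"
      using s partition_sums_nonempty[of a s F] by (auto simp: less_cSup_iff bvt[OF s] bounded_variation_def[symmetric])
    from x(1) obtain p n where p: "x = (\<Sum>k<n. norm (F (p (Suc k)) - F (p k)))" "p 0 = a" "p n = s"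
      "\<forall>k<n. p k \<le> p (Suc k)"
      unfolding partition_sums_def by blast
    define q where "q k = (if k \<le> n then p k else b)" for k
    have q: "q 0 = a" "q (Suc n) = b" "\<forall>k<Suc n. q k \<le> q (Suc k)"
      using p s by (auto simp: q_def less_Suc_eq_le le_less)
    have qr: "q k \<in> {a..b}" if "k \<le> Suc n" for k using in_range[OF q(3) that] q by simp
    define h where "h t = (\<Sum>k<Suc n. norm (F (min t (q (Suc k))) - F (min t (q k))))" for t
    have "continuous_on {a..b} (\<lambda>t. F (min t (q k)))" if "k \<le> Suc n" for k
      by (rule continuous_on_compose2[OF F]) (use qr[OF that] in \<open>auto intro!: continuous_intros\<close>)
    then have "continuous_on {a..b} h"
      unfolding h_def by (intro continuous_intros) auto
    then obtain d where d: "d > 0" "\<And>t. t \<in> {a..b} \<Longrightarrow> dist t s < d \<Longrightarrow> dist (h t) (h s) < e / 2"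
      using s e unfolding continuous_on_iff by (metis half_gt_zero)
    have "min s (p k) = p k" if "k \<le> n" for k
      using in_range[OF p(4) that] p by simp
    then have "h s = x"
      using s p(3) unfolding h_def p(1) by (auto simp: q_def intro!: sum.cong)
    moreover have hv: "h t \<le> variation F a t" if "t \<in> {a..b}" for t
      unfolding h_def using that by (intro variation_upper bvt partition_sums_min[OF q]) auto
    ultimately have "variation F a s - e < variation F a t" if "t \<in> {a..b}" "dist t s < d" for t
      using d(2)[OF that] hv[OF that(1)] x(2) unfolding dist_real_def by linarith
    then show ?thesis using d(1) by blast
  qed
  have upper: "\<exists>d>0. \<forall>t\<in>{a..b}. dist t s < d \<longrightarrow> variation F s b - e < variation F t b"
  proof -
    have "variation F s b - e / 2 < Sup (partition_sums F s b)"
      using e by (simp add: variation_def)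
    then obtain x where x: "x \<in> partition_sums F s b" "variation F s b - e / 2 < x"
      using s partition_sums_nonempty[of s b F] by (auto simp: less_cSup_iff bvt[OF s] bounded_variation_def[symmetric])
    from x(1) obtain p n where p: "x = (\<Sum>k<n. norm (F (p (Suc k)) - F (p k)))" "p 0 = s" "p n = b"
      "\<forall>k<n. p k \<le> p (Suc k)"
      unfolding partition_sums_def by blast
    define q where "q k = (case k of 0 \<Rightarrow> a | Suc j \<Rightarrow> p j)" for k
    have q: "q 0 = a" "q (Suc n) = b" "\<forall>k<Suc n. q k \<le> q (Suc k)"
      using p s by (auto simp: q_def split: nat.splits)
    have qr: "q k \<in> {a..b}" if "k \<le> Suc n" for k using in_range[OF q(3) that] q by simp
    define h where "h t = (\<Sum>k<Suc n. norm (F (max t (q (Suc k))) - F (max t (q k))))" for t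
    have "continuous_on {a..b} (\<lambda>t. F (max t (q k)))" if "k \<le> Suc n" for k
      by (rule continuous_on_compose2[OF F]) (use qr[OF that] in \<open>auto intro!: continuous_intros\<close>)
    then have "continuous_on {a..b} h"
      unfolding h_def by (intro continuous_intros) auto
    then obtain d where d: "d > 0" "\<And>t. t \<in> {a..b} \<Longrightarrow> dist t s < d \<Longrightarrow> dist (h t) (h s) < e / 2"
      using s e unfolding continuous_on_iff by (metis half_gt_zero)
    have "max s (p k) = p k" if "k \<le> n" for k
      using in_range[OF p(4) that] p by simp
    then have "h s = x"
      using s p(2) unfolding h_def p(1) sum.lessThan_Suc_shift by (auto simp: q_def intro!: sum.cong)
    moreover have hv: "h t \<le> variation F t b" if "t \<in> {a..b}" for t
      unfolding h_def using that by (intro variation_upper bvt partition_sums_max[OF q]) auto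
    ultimately have "variation F s b - e < variation F t b" if "t \<in> {a..b}" "dist t s < d" for t
      using d(2)[OF that] hv[OF that(1)] x(2) unfolding dist_real_def by linarith
    then show ?thesis using d(1) by blast
  qed
  from lower upper obtain d1 d2 where d: "d1 > 0" "d2 > 0"
    "\<And>t. t \<in> {a..b} \<Longrightarrow> dist t s < d1 \<Longrightarrow> variation F a s - e < variation F a t"
    "\<And>t. t \<in> {a..b} \<Longrightarrow> dist t s < d2 \<Longrightarrow> variation F s b - e < variation F t b"
    by blast
  have "dist (variation F a t) (variation F a s) < e" if "t \<in> {a..b}" "dist t s < min d1 d2" for t
    using d(3)[of t] d(4)[of t] add[OF that(1)] add[OF s] that by (auto simp: dist_real_def)
  then show "\<exists>d>0. \<forall>t\<in>{a..b}. dist t s < d \<longrightarrow> dist (variation F a t) (variation F a s) < e"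
    using d(1,2) by (intro exI[of _ "min d1 d2"]) auto
qed

lemma clip_in: "0 \<le> T \<Longrightarrow> clip T t \<in> {0..T}"
  by (auto simp: clip_def)

lemma clip_id: "t \<in> {0..T} \<Longrightarrow> clip T t = t"
  by (auto simp: clip_def)

lemma clip_mono: "s \<le> t \<Longrightarrow> clip T s \<le> clip T t"
  by (auto simp: clip_def)

lemma continuous_clip: "0 \<le> T \<Longrightarrow> continuous_on {0..T} H \<Longrightarrow> continuous_on UNIV (\<lambda>t. H (clip T t))"
  unfolding clip_def by (erule continuous_on_compose2) (auto intro!: continuous_intros)

lemma emeasure_clip:
  fixes H :: "real \<Rightarrow> real"
  assumes T: "0 \<le> T" and H: "continuous_on {0..T} H" and mono: "\<And>s t. 0 \<le> s \<Longrightarrow> s \<le> t \<Longrightarrow> t \<le> T \<Longrightarrow> H s \<le> H t"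
  defines "M \<equiv> interval_measure (\<lambda>t. H (clip T t))"
  shows "a \<le> b \<Longrightarrow> emeasure M {a..b} = ennreal (H (clip T b) - H (clip T a))"
    and "a \<le> b \<Longrightarrow> emeasure M {a<..b} = ennreal (H (clip T b) - H (clip T a))"
    and "finite_measure M"
proof -
  have m: "H (clip T s) \<le> H (clip T t)" if "s \<le> t" for s t
    using clip_in[OF T] clip_mono[OF that] by (intro mono) auto
  have c: "isCont (\<lambda>t. H (clip T t)) t" for t
    using continuous_clip[OF T H] by (simp add: continuous_on_eq_continuous_at)
  show 1: "a \<le> b \<Longrightarrow> emeasure M {a..b} = ennreal (H (clip T b) - H (clip T a))" for a b
    unfolding M_def using m continuous_clip[OF T H]
    by (intro emeasure_interval_measure_Icc) (auto intro: continuous_on_subset)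
  show "a \<le> b \<Longrightarrow> emeasure M {a<..b} = ennreal (H (clip T b) - H (clip T a))" for a b
    unfolding M_def using m c
    by (intro emeasure_interval_measure_Ioc) (auto simp: continuous_at_imp_continuous_at_within)
  have "emeasure M (\<Union>n::nat. {- real n..real n}) = (SUP n::nat. emeasure M {- real n..real n})"
    by (intro SUP_emeasure_incseq[symmetric]) (auto simp: M_def incseq_def)
  also have "(\<Union>n::nat. {- real n..real n}) = UNIV"
  proof (intro equalityI subsetI UNIV_I)
    fix x :: real
    obtain n :: nat where "\<bar>x\<bar> \<le> real n" using real_arch_simple by blast
    then show "x \<in> (\<Union>n::nat. {- real n..real n})" by (auto intro!: exI[of _ n])
  qed
  also have "(SUP n::nat. emeasure M {- real n..real n}) \<le> ennreal (H T - H 0)"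
  proof (rule SUP_least)
    fix n :: nat
    have "H (clip T (real n)) \<le> H T" "H 0 \<le> H (clip T (- real n))"
      using clip_in[OF T] by (auto intro!: mono)
    then show "emeasure M {- real n..real n} \<le> ennreal (H T - H 0)"
      by (subst 1) (auto intro: ennreal_leI)
  qed
  finally have "emeasure M UNIV < \<infinity>"
    by (metis ennreal_less_top infinity_ennreal_def le_less_trans)
  then show "finite_measure M"
    by (intro finite_measureI) (auto simp: M_def)
qed

lemma jordan_parts:
  fixes G :: "real \<Rightarrow> real"
  assumes T: "0 \<le> T" and G: "continuous_on {0..T} G" and bv: "bounded_variation G 0 T"
  shows "continuous_on {0..T} (\<lambda>t. (variation G 0 t + G t) / 2)"
    and "continuous_on {0..T} (\<lambda>t. (variation G 0 t - G t) / 2)"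
    and "0 \<le> s \<Longrightarrow> s \<le> t \<Longrightarrow> t \<le> T \<Longrightarrow> (variation G 0 s + G s) / 2 \<le> (variation G 0 t + G t) / 2"
    and "0 \<le> s \<Longrightarrow> s \<le> t \<Longrightarrow> t \<le> T \<Longrightarrow> (variation G 0 s - G s) / 2 \<le> (variation G 0 t - G t) / 2"
  using norm_diff_le_variation[OF bv, of s t]
  by (auto intro!: continuous_intros continuous_on_variation[OF bv T G] G simp: abs_le_iff)

lemma jordan_measures:
  fixes G :: "real \<Rightarrow> real"
  assumes T: "0 \<le> T" and G: "continuous_on {0..T} G" and bv: "bounded_variation G 0 T"
  shows "finite_measure (pos_meas T G)" "finite_measure (neg_meas T G)"
    and "0 \<le> a \<Longrightarrow> a \<le> b \<Longrightarrow> b \<le> T \<Longrightarrow>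
           measure (pos_meas T G) {a<..b} - measure (neg_meas T G) {a<..b} = G b - G a"
    and "measure (pos_meas T G) {a} = 0" "measure (neg_meas T G) {a} = 0"
    and "measure (pos_meas T G) (- {0..T}) = 0" "measure (neg_meas T G) (- {0..T}) = 0"
proof -
  note J = jordan_parts[OF T G bv]
  note P = emeasure_clip[OF T J(1) J(3), simplified, folded pos_meas_def]
  note N = emeasure_clip[OF T J(2) J(4), simplified, folded neg_meas_def]
  show P3: "finite_measure (pos_meas T G)" and N3: "finite_measure (neg_meas T G)" by (rule P(3) N(3))+
  show "measure (pos_meas T G) {a<..b} - measure (neg_meas T G) {a<..b} = G b - G a"
    if "0 \<le> a" "a \<le> b" "b \<le> T"
    using that P(2)[of a b] N(2)[of a b] J(3)[of a b] J(4)[of a b]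
    by (simp add: measure_def clip_id field_simps)
  show "measure (pos_meas T G) {a} = 0" "measure (neg_meas T G) {a} = 0"
    using P(1)[of a a] N(1)[of a a] by (simp_all add: measure_def)
  have *: "emeasure M (- {0..T}) = 0"
    if M: "\<And>a b. a \<le> b \<Longrightarrow> emeasure M {a..b} = ennreal (H (clip T b) - H (clip T a))"
      and sets: "sets M = sets borel" and atoms: "\<And>a b. a \<le> b \<Longrightarrow> emeasure M {a<..b} = ennreal (H (clip T b) - H (clip T a))"
    for M and H :: "real \<Rightarrow> real"
  proof -
    have "- {0..T} \<subseteq> (\<Union>n::nat. {- real n..0} - {0}) \<union> (\<Union>n::nat. {T<..T + real n})"
    proof
      fix x assume x: "x \<in> - {0..T}"
      obtain n :: nat where "\<bar>x\<bar> + \<bar>T\<bar> \<le> real n" using real_arch_simple by blast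
      then show "x \<in> (\<Union>n::nat. {- real n..0} - {0}) \<union> (\<Union>n::nat. {T<..T + real n})"
        using x by (cases "x < 0") (auto intro!: exI[of _ n])
    qed
    moreover have "emeasure M ((\<Union>n::nat. {- real n..0} - {0}) \<union> (\<Union>n::nat. {T<..T + real n})) = 0"
    proof (rule emeasure_Un_null_set[THEN trans])
      have "emeasure M ({- real n..0} - {0}) \<le> emeasure M {- real n..0}" for n :: nat
        by (intro emeasure_mono) (auto simp: sets)
      also have "emeasure M {- real n..0} = 0" for n :: nat
        using T by (simp add: M clip_def)
      finally show "emeasure M (\<Union>n::nat. {- real n..0} - {0}) = 0"
        by (intro emeasure_UN_eq_0) (auto simp: sets)
      show "(\<Union>n::nat. {T<..T + real n}) \<in> null_sets M"
        using T by (intro null_setsI emeasure_UN_eq_0) (auto simp: sets atoms clip_def)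
    qed (auto simp: sets)
    moreover have "(\<Union>n::nat. {- real n..0} - {0}) \<union> (\<Union>n::nat. {T<..T + real n}) \<in> sets M"
      by (auto simp: sets)
    ultimately show ?thesis
      using emeasure_mono[of "- {0..T}" _ M] by (metis le_zero_eq)
  qed
  show "measure (pos_meas T G) (- {0..T}) = 0" "measure (neg_meas T G) (- {0..T}) = 0"
    using *[OF P(1) _ P(2)] *[OF N(1) _ N(2)] by (simp_all add: measure_def pos_meas_def neg_meas_def)
qed

lemma bounded_variation_Re_Im:
  assumes "bounded_variation F a b"
  shows "bounded_variation (Re \<circ> F) a b" "bounded_variation (Im \<circ> F) a b"
proof -
  obtain M where M: "\<And>x. x \<in> partition_sums F a b \<Longrightarrow> x \<le> M"
    using assms unfolding bounded_variation_def bdd_above_def by blast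
  have *: "bounded_variation (f \<circ> F) a b"
    if f: "\<And>u v. norm (f u - f v :: real) \<le> norm (u - v)" for f
  proof -
    have "x \<le> M" if "x \<in> partition_sums (f \<circ> F) a b" for x
    proof -
      from that have "\<exists>p n. x = (\<Sum>k<n. norm ((f \<circ> F) (p (Suc k)) - (f \<circ> F) (p k))) \<and>
          p 0 = a \<and> p n = b \<and> (\<forall>k<n. p k \<le> p (Suc k))"
        by (simp only: partition_sums_def mem_Collect_eq)
      then obtain p n where p: "x = (\<Sum>k<n. norm ((f \<circ> F) (p (Suc k)) - (f \<circ> F) (p k)))"
        "p 0 = a \<and> p n = b \<and> (\<forall>k<n. p k \<le> p (Suc k))"
        by (elim exE conjE) (rule that, auto)
      have "x \<le> (\<Sum>k<n. norm (F (p (Suc k)) - F (p k)))"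
        unfolding p(1) using f by (intro sum_mono) simp
      also have "\<dots> \<le> M" by (rule M) (use p(2) in \<open>auto simp: partition_sums_def\<close>)
      finally show ?thesis .
    qed
    then show ?thesis unfolding bounded_variation_def bdd_above_def by blast
  qed
  show "bounded_variation (Re \<circ> F) a b" "bounded_variation (Im \<circ> F) a b"
    by (rule *; metis abs_Re_le_cmod abs_Im_le_cmod minus_complex.sel real_norm_def)+
qed

context
  fixes T :: real and F :: "real \<Rightarrow> complex"
  assumes T: "0 \<le> T" and F: "continuous_on {0..T} F" and bv: "bounded_variation F 0 T"
begin

private lemma cont: "continuous_on {0..T} (Re \<circ> F)" "continuous_on {0..T} (Im \<circ> F)"
  by (auto intro!: continuous_intros F simp: comp_def)

private lemmas JR = jordan_measures[OF T cont(1) bounded_variation_Re_Im(1)[OF bv]]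
private lemmas JI = jordan_measures[OF T cont(2) bounded_variation_Re_Im(2)[OF bv]]

lemma cmeasure_Ioc: "0 \<le> a \<Longrightarrow> a \<le> b \<Longrightarrow> b \<le> T \<Longrightarrow> cmeasure T F {a<..b} = F b - F a"
  using JR(3)[of a b] JI(3)[of a b] by (simp add: cmeasure_def complex_eq_iff)

lemma cmeasure_singleton: "cmeasure T F {a} = 0"
  using JR(4,5)[of a] JI(4,5)[of a] by (simp add: cmeasure_def complex_eq_iff)

lemma cmeasure_outside: "cmeasure T F (- {0..T}) = 0"
  using JR(6,7) JI(6,7) by (simp add: cmeasure_def complex_eq_iff)

lemma cmeasure_sums:
  assumes A: "range A \<subseteq> sets borel" "disjoint_family A"
  shows "(\<lambda>n. cmeasure T F (A n)) sums cmeasure T F (\<Union>n. A n)"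
  unfolding sums_complex_iff cmeasure_def
  using A JR(1,2) JI(1,2)
  by (auto intro!: sums_diff finite_measure.finite_measure_UNION simp: pos_meas_def neg_meas_def)

end

section \<open>The controlled Loewner--Kufarev equation\<close>

definition \<xi> :: "(nat \<Rightarrow> real \<Rightarrow> complex) \<Rightarrow> complex \<Rightarrow> real \<Rightarrow> complex" where
  "\<xi> x z t = (\<Sum>n. x (Suc n) t * z ^ Suc n)"

text \<open>Only the components \<open>x n\<close> with \<open>n \<ge> 1\<close> are used; the value \<open>x 0\<close> is irrelevant.\<close>

definition driving_functions :: "real \<Rightarrow> (real \<Rightarrow> real) \<Rightarrow> (nat \<Rightarrow> real \<Rightarrow> complex) \<Rightarrow> bool" where
  "driving_functions T x0 x \<longleftrightarrow>
     continuous_on {0..T} x0 \<and> bounded_variation x0 0 T \<and>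
     (\<forall>n\<ge>1. continuous_on {0..T} (x n) \<and> bounded_variation (x n) 0 T) \<and>
     x0 0 = 0 \<and>
     conv_radius (\<lambda>n. if n = 0 then 0 else x n 0) \<ge> 1 \<and>
     (\<forall>r\<in>{0<..<1}. summable (\<lambda>n. total_variation (cmeasure T (x (Suc n))) {0..T} * r ^ Suc n))"

definition LK_solution ::
  "real \<Rightarrow> (real \<Rightarrow> real) \<Rightarrow> (nat \<Rightarrow> real \<Rightarrow> complex) \<Rightarrow> (real \<Rightarrow> complex \<Rightarrow> complex) \<Rightarrow> bool" where
  "LK_solution T x0 x f \<longleftrightarrow>
     (\<forall>t\<in>{0..T}. f t holomorphic_on ball 0 1) \<and>
     (\<forall>K. compact K \<and> K \<subseteq> ball 0 1 \<longrightarrow>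
        (\<forall>t\<in>{0..T}. uniform_limit K f (f t) (at t within {0..T}))) \<and>
     (\<forall>t\<in>{0..T}. \<forall>z\<in>ball 0 1.
        f t z - z = cintegral T (\<lambda>s. of_real (x0 s)) {0..t} (\<lambda>s. z * deriv (f s) z)
                  + cintegral T (\<xi> x z) {0..t} (\<lambda>s. z * deriv (f s) z))"

definition control_function :: "real \<Rightarrow> (real \<Rightarrow> real \<Rightarrow> real) \<Rightarrow> bool" where
  "control_function T \<omega> \<longleftrightarrow>
     continuous_on {(s, t). 0 \<le> s \<and> s \<le> t \<and> t \<le> T} (\<lambda>(s, t). \<omega> s t) \<and>
     (\<forall>s t. 0 \<le> s \<and> s \<le> t \<and> t \<le> T \<longrightarrow> 0 \<le> \<omega> s t) \<and>
     (\<forall>t\<in>{0..T}. \<omega> t t = 0) \<and>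
     (\<forall>s t u. 0 \<le> s \<and> s \<le> t \<and> t \<le> u \<and> u \<le> T \<longrightarrow> \<omega> s t + \<omega> t u \<le> \<omega> s u)"

text \<open>
  \<open>simplex_integral T x0 x [i\<^sub>p, \<dots>, i\<^sub>1] A\<close> is the iterated integral
  \<open>\<integral> exp(-i\<^sub>1 x0(u\<^sub>1)) dx\<^bsub>i\<^sub>1\<^esub>(u\<^sub>1) \<cdots> exp(-i\<^sub>p x0(u\<^sub>p)) dx\<^bsub>i\<^sub>p\<^esub>(u\<^sub>p)\<close>
  over \<open>0 \<le> u\<^sub>1 < \<cdots> < u\<^sub>p\<close>, \<open>u\<^sub>p \<in> A\<close>; the outermost index comes first in the list.
\<close>

primrec simplex_integral ::
  "real \<Rightarrow> (real \<Rightarrow> real) \<Rightarrow> (nat \<Rightarrow> real \<Rightarrow> complex) \<Rightarrow> nat list \<Rightarrow> real set \<Rightarrow> complex" where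
  "simplex_integral T x0 x [] A = 1"
| "simplex_integral T x0 x (i # is) A =
     cintegral T (x i) A
       (\<lambda>u. simplex_integral T x0 x is {0..<u} * of_real (exp (- real i * x0 u)))"

definition iterated_I ::
  "real \<Rightarrow> (real \<Rightarrow> real) \<Rightarrow> (nat \<Rightarrow> real \<Rightarrow> complex) \<Rightarrow> nat list \<Rightarrow> real \<Rightarrow> complex" where
  "iterated_I T x0 x is t =
     of_real (exp (real (sum_list is) * x0 t)) * simplex_integral T x0 x (rev is) {0..t}"

definition controlled_by ::
  "real \<Rightarrow> (real \<Rightarrow> real) \<Rightarrow> (nat \<Rightarrow> real \<Rightarrow> complex) \<Rightarrow> (real \<Rightarrow> real \<Rightarrow> real) \<Rightarrow> bool" where
  "controlled_by T x0 x \<omega> \<longleftrightarrow>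
     (\<forall>n is s t. is \<noteq> [] \<and> (\<forall>i\<in>set is. 1 \<le> i) \<and> sum_list is = n \<and> 0 \<le> s \<and> s \<le> t \<and> t \<le> T \<longrightarrow>
        norm (iterated_I T x0 x is t) \<le> \<omega> 0 t ^ n / fact n \<and>
        norm (iterated_I T x0 x is t - iterated_I T x0 x is s)
          \<le> \<omega> s t * (\<omega> 0 T ^ (n - 1) / fact (n - 1)))"

section \<open>Univalent and starlike functions on the unit disc\<close>

definition univalent_on_disc :: "(complex \<Rightarrow> complex) \<Rightarrow> bool" where
  "univalent_on_disc f \<longleftrightarrow> f holomorphic_on ball 0 1 \<and> inj_on f (ball 0 1)"

text \<open>The library's \<^const>\<open>starlike\<close> leaves the centre unspecified; here the centre is the origin.\<close>

definition starlike_on_disc :: "(complex \<Rightarrow> complex) \<Rightarrow> bool" where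
  "starlike_on_disc f \<longleftrightarrow>
     univalent_on_disc f \<and> f 0 = 0 \<and>
     (\<forall>w\<in>f ` ball 0 1. \<forall>l\<in>{0..1::real}. of_real l * w \<in> f ` ball 0 1)"

definition extends_past_closed_disc :: "(complex \<Rightarrow> complex) \<Rightarrow> bool" where
  "extends_past_closed_disc f \<longleftrightarrow>
     (\<exists>U g. open U \<and> cball 0 1 \<subseteq> U \<and> g holomorphic_on U \<and> (\<forall>z\<in>ball 0 1. g z = f z))"

end

theory Submission
  imports Defs
begin

text \<open>
  Write \<open>f\<^sub>t(z) = \<Sum>\<^sub>k c\<^sub>k(t) z\<^sup>k\<close> and compare the coefficients of \<open>z\<^sup>m\<close> in the equation.  With \<open>y\<^sub>0 = x\<^sub>0\<close> and
  \<open>y\<^sub>n = x\<^sub>n\<close> for \<open>n \<ge> 1\<close>, the family \<open>f\<close> is a solution exactly when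
  \<open>c\<^sub>m(t) = [m = 1] + \<Sum>\<^sub>k\<^sub>\<le>\<^sub>m k \<integral>\<^sub>0\<^sup>t c\<^sub>k dy\<^sub>m\<^sub>-\<^sub>k\<close> for all \<open>m\<close>
  (\<open>LK_equation_iff_coefficient_equation\<close>).  This system is triangular.  The diagonal term
  \<open>m c\<^sub>m dx\<^sub>0\<close> disappears after multiplication by \<open>exp(- m x\<^sub>0)\<close>, so the \<open>c\<^sub>m\<close> are determined one
  after the other (\<open>coefficient_equation_unique\<close>); this is uniqueness, because the Taylor
  coefficients of any solution form such a system (\<open>LK_solution_taylor\<close>).

  Solving the system yields \<open>c\<^sub>m\<^sub>+\<^sub>1 = exp((m+1) x\<^sub>0) \<Sum> w(l) S\<^sub>l\<close>, where \<open>l\<close> runs over the compositions of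
  \<open>m\<close>, \<open>S\<^sub>l\<close> is the iterated integral belonging to \<open>l\<close>, and the weights \<open>w(l)\<close>, products of the
  factors \<open>k\<close> picked up on the way, add up to \<open>(m+1)!/2\<close> for \<open>m \<ge> 1\<close>
  (\<open>LK_coefficient_equation\<close>, \<open>sum_weight\<close>).  The bound \<open>\<omega>(0,T)\<^sup>m / m!\<close> on the iterated integrals therefore gives
  \<open>|c\<^sub>m\<^sub>+\<^sub>1| \<le> exp(x\<^sub>0) (m+1)/2 \<omega>(0,T)\<^sup>m\<close>: the factorials cancel, the series converges beyond the
  closed disc, and only the size of \<open>q = \<omega>(0,T)\<close> matters for the shape of \<open>f\<^sub>t\<close>.

  The quartic is positive at \<open>0\<close> and negative at \<open>3/10\<close>, so \<open>q < \<alpha>/2 < 3/20\<close>, and for such \<open>q\<close> the normalised coefficients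
  satisfy \<open>\<Sum>\<^sub>n\<^sub>\<ge>\<^sub>2 (2n - 1) |a\<^sub>n| \<le> 1\<close>.  This condition makes \<open>f = z + g\<close> univalent and starlike by a
  contraction argument (\<open>starlike_perturbation\<close>): \<open>f(v) = \<lambda> f(z)\<close> is the fixed point
  equation \<open>v = \<lambda> f(z) - g(v)\<close>, whose right-hand side maps the disc of radius \<open>(1-\<lambda>)|z|\<close> around
  \<open>\<lambda> z\<close> to itself.

  All manipulations of integrals rest on one principle.  For continuous \<open>g\<close>, the function
  \<open>\<Phi>(t) = \<integral>\<^sub>0\<^sup>t g dF\<close> is characterised by \<open>\<Phi>(0) = 0\<close> and
  \<open>\<Phi>(t) - \<Phi>(s) = g(s) (F(t) - F(s)) + o(V(t) - V(s))\<close> for some nondecreasing \<open>V\<close>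
  (\<open>cintegral_primitive\<close>, \<open>cintegral_eqI\<close>).  Linearity, the product rule and the chain rule then
  become computations with increments modulo such error terms.
\<close>

section \<open>Negligible increments\<close>

text \<open>
  An error term \<open>A(s,t) = o(V(t) - V(s))\<close>, uniformly as \<open>t - s \<rightarrow> 0\<close>.  The control \<open>V\<close> is hidden behind
  an existential quantifier so that errors measured against different drivers can be added
  (add the controls).
\<close>

definition negligible :: "real \<Rightarrow> (real \<Rightarrow> real \<Rightarrow> complex) \<Rightarrow> bool" where
  "negligible T A \<longleftrightarrow> (\<exists>V. mono_on {0..T} V \<and>
     (\<forall>e>0. \<exists>d>0. \<forall>s t. 0 \<le> s \<longrightarrow> s \<le> t \<longrightarrow> t \<le> T \<longrightarrow> t - s < d \<longrightarrow>
        norm (A s t) \<le> e * (V t - V s)))"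

lemma negligibleI:
  assumes "mono_on {0..T} V"
    and "\<And>e. e > 0 \<Longrightarrow> \<exists>d>0. \<forall>s t. 0 \<le> s \<longrightarrow> s \<le> t \<longrightarrow> t \<le> T \<longrightarrow> t - s < d \<longrightarrow>
           norm (A s t) \<le> e * (V t - V s)"
  shows "negligible T A"
  using assms unfolding negligible_def by blast

lemma negligible_dominated:
  assumes "negligible T A" "\<And>s t. 0 \<le> s \<Longrightarrow> s \<le> t \<Longrightarrow> t \<le> T \<Longrightarrow> norm (B s t) \<le> norm (A s t)"
  shows "negligible T B"
proof -
  obtain V where "mono_on {0..T} V"
    and V: "\<And>e. e > 0 \<Longrightarrow> \<exists>d>0. \<forall>s t. 0 \<le> s \<longrightarrow> s \<le> t \<longrightarrow> t \<le> T \<longrightarrow> t - s < d \<longrightarrow>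
           norm (A s t) \<le> e * (V t - V s)"
    using assms(1) unfolding negligible_def by blast
  from this(1) show ?thesis
  proof (rule negligibleI)
    fix e :: real assume "e > 0"
    from V[OF this] obtain d where "d > 0" "\<And>s t. 0 \<le> s \<Longrightarrow> s \<le> t \<Longrightarrow> t \<le> T \<Longrightarrow> t - s < d \<Longrightarrow>
        norm (A s t) \<le> e * (V t - V s)" by blast
    then show "\<exists>d>0. \<forall>s t. 0 \<le> s \<longrightarrow> s \<le> t \<longrightarrow> t \<le> T \<longrightarrow> t - s < d \<longrightarrow>
        norm (B s t) \<le> e * (V t - V s)"
      by (intro exI[of _ d] conjI allI impI order_trans[OF assms(2)])
  qed
qed

lemma negligible_cong:
  assumes "negligible T A" "\<And>s t. 0 \<le> s \<Longrightarrow> s \<le> t \<Longrightarrow> t \<le> T \<Longrightarrow> A s t = B s t"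
  shows "negligible T B"
  by (rule negligible_dominated[OF assms(1)]) (simp add: assms(2))

lemma negligible_add:
  assumes "negligible T A" "negligible T B"
  shows "negligible T (\<lambda>s t. A s t + B s t)"
proof -
  obtain V where mV: "mono_on {0..T} V"
    and V: "\<And>e. e > 0 \<Longrightarrow> \<exists>d>0. \<forall>s t. 0 \<le> s \<longrightarrow> s \<le> t \<longrightarrow> t \<le> T \<longrightarrow> t - s < d \<longrightarrow>
           norm (A s t) \<le> e * (V t - V s)"
    using assms(1) unfolding negligible_def by blast
  obtain W where mW: "mono_on {0..T} W"
    and W: "\<And>e. e > 0 \<Longrightarrow> \<exists>d>0. \<forall>s t. 0 \<le> s \<longrightarrow> s \<le> t \<longrightarrow> t \<le> T \<longrightarrow> t - s < d \<longrightarrow>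
           norm (B s t) \<le> e * (W t - W s)"
    using assms(2) unfolding negligible_def by blast
  show ?thesis
  proof (rule negligibleI[of _ "\<lambda>t. V t + W t"])
    show "mono_on {0..T} (\<lambda>t. V t + W t)"
      using mV mW by (auto intro!: mono_onI add_mono dest: mono_onD)
    fix e :: real assume e: "e > 0"
    obtain d1 where d1: "d1 > 0" "\<And>s t. 0 \<le> s \<Longrightarrow> s \<le> t \<Longrightarrow> t \<le> T \<Longrightarrow> t - s < d1 \<Longrightarrow>
           norm (A s t) \<le> e * (V t - V s)"
      using V[OF e] by blast
    obtain d2 where d2: "d2 > 0" "\<And>s t. 0 \<le> s \<Longrightarrow> s \<le> t \<Longrightarrow> t \<le> T \<Longrightarrow> t - s < d2 \<Longrightarrow>
           norm (B s t) \<le> e * (W t - W s)"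
      using W[OF e] by blast
    have "norm (A s t + B s t) \<le> e * (V t + W t - (V s + W s))"
      if "0 \<le> s" "s \<le> t" "t \<le> T" "t - s < min d1 d2" for s t
    proof -
      have "norm (A s t + B s t) \<le> norm (A s t) + norm (B s t)" by (rule norm_triangle_ineq)
      also have "\<dots> \<le> e * (V t - V s) + e * (W t - W s)"
        using that by (intro add_mono d1(2) d2(2)) auto
      finally show ?thesis by (simp add: algebra_simps)
    qed
    then show "\<exists>d>0. \<forall>s t. 0 \<le> s \<longrightarrow> s \<le> t \<longrightarrow> t \<le> T \<longrightarrow> t - s < d \<longrightarrow>
        norm (A s t + B s t) \<le> e * (V t + W t - (V s + W s))"
      using d1(1) d2(1) by (intro exI[of _ "min d1 d2"]) auto
  qed
qed

lemma continuous_bounded_on_Icc: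
  fixes g :: "real \<Rightarrow> complex"
  assumes "continuous_on {0..T} g"
  obtains B where "B > 0" "\<And>u. u \<in> {0..T} \<Longrightarrow> norm (g u) \<le> B"
proof -
  have "bounded (g ` {0..T})"
    using assms by (intro compact_imp_bounded compact_continuous_image) auto
  then obtain B where "B > 0" "\<forall>v\<in>g ` {0..T}. norm v \<le> B" unfolding bounded_pos by blast
  then show ?thesis by (intro that[of B]) auto
qed

lemma negligible_mult:
  assumes "negligible T A" and b: "continuous_on {0..T} b"
  shows "negligible T (\<lambda>s t. b s * A s t)"
proof -
  obtain V where mV: "mono_on {0..T} V"
    and V: "\<And>e. e > 0 \<Longrightarrow> \<exists>d>0. \<forall>s t. 0 \<le> s \<longrightarrow> s \<le> t \<longrightarrow> t \<le> T \<longrightarrow> t - s < d \<longrightarrow>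
           norm (A s t) \<le> e * (V t - V s)"
    using assms(1) unfolding negligible_def by blast
  obtain B where B: "B > 0" "\<And>s. s \<in> {0..T} \<Longrightarrow> norm (b s) \<le> B"
    by (rule continuous_bounded_on_Icc[OF b]) blast
  show ?thesis
  proof (rule negligibleI[OF mV])
    fix e :: real assume e: "e > 0"
    then obtain d where d: "d > 0" "\<And>s t. 0 \<le> s \<Longrightarrow> s \<le> t \<Longrightarrow> t \<le> T \<Longrightarrow> t - s < d \<Longrightarrow>
           norm (A s t) \<le> e / B * (V t - V s)"
      using V[of "e / B"] B(1) by auto
    have "norm (b s * A s t) \<le> e * (V t - V s)"
      if "0 \<le> s" "s \<le> t" "t \<le> T" "t - s < d" for s t
    proof -
      have "norm (b s * A s t) \<le> B * (e / B * (V t - V s))"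
        unfolding norm_mult using that B by (intro mult_mono d B) auto
      then show ?thesis using B(1) by simp
    qed
    then show "\<exists>d>0. \<forall>s t. 0 \<le> s \<longrightarrow> s \<le> t \<longrightarrow> t \<le> T \<longrightarrow> t - s < d \<longrightarrow>
        norm (b s * A s t) \<le> e * (V t - V s)"
      using d(1) by blast
  qed
qed

lemma negligible_0: "negligible T (\<lambda>s t. 0)"
  by (rule negligibleI[of _ "\<lambda>_. 0"]) (auto intro!: mono_onI exI[of _ 1])

lemma negligible_cmult: "negligible T A \<Longrightarrow> negligible T (\<lambda>s t. c * A s t)"
  using negligible_mult[of T A "\<lambda>_. c"] by simp

lemma negligible_diff:
  assumes "negligible T A" "negligible T B"
  shows "negligible T (\<lambda>s t. A s t - B s t)"
  using negligible_add[OF assms(1) negligible_cmult[OF assms(2), of "-1"]] by simp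

lemma negligible_sum:
  "(\<And>i. i \<in> I \<Longrightarrow> negligible T (A i)) \<Longrightarrow> negligible T (\<lambda>s t. \<Sum>i\<in>I. A i s t)"
  by (induction I rule: infinite_finite_induct) (auto intro: negligible_add negligible_0)

lemma uniformly_small_increments:
  fixes h :: "real \<Rightarrow> complex"
  assumes h: "continuous_on {0..T} h" and "e > 0"
  shows "\<exists>d>0. \<forall>s t. 0 \<le> s \<longrightarrow> s \<le> t \<longrightarrow> t \<le> T \<longrightarrow> t - s < d \<longrightarrow> norm (h t - h s) \<le> e"
proof -
  have "uniformly_continuous_on {0..T} h"
    using h by (intro compact_uniformly_continuous) auto
  then obtain d where "d > 0" "\<And>s t. s \<in> {0..T} \<Longrightarrow> t \<in> {0..T} \<Longrightarrow> dist t s < d \<Longrightarrow> dist (h t) (h s) < e"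
    using \<open>e > 0\<close> unfolding uniformly_continuous_on_def by metis
  then show ?thesis
    by (intro exI[of _ d]) (auto simp: dist_norm less_imp_le)
qed

text \<open>
  Second-order terms vanish: an increment of bounded variation times an increment of a
  continuous function.
\<close>

lemma negligible_product:
  assumes V: "mono_on {0..T} V"
    and A: "\<And>s t. 0 \<le> s \<Longrightarrow> s \<le> t \<Longrightarrow> t \<le> T \<Longrightarrow> norm (A s t) \<le> V t - V s"
    and h: "continuous_on {0..T} h"
  shows "negligible T (\<lambda>s t. A s t * (h t - h s))"
proof (rule negligibleI[OF V])
  fix e :: real assume "e > 0"
  from uniformly_small_increments[OF h this]
  obtain d where d: "d > 0" "\<And>s t. 0 \<le> s \<Longrightarrow> s \<le> t \<Longrightarrow> t \<le> T \<Longrightarrow> t - s < d \<Longrightarrow> norm (h t - h s) \<le> e"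
    by blast
  have "norm (A s t * (h t - h s)) \<le> e * (V t - V s)"
    if "0 \<le> s" "s \<le> t" "t \<le> T" "t - s < d" for s t
  proof -
    have "norm (A s t * (h t - h s)) \<le> (V t - V s) * e"
      unfolding norm_mult using that A[OF that(1-3)] order_trans[OF norm_ge_zero A[OF that(1-3)]]
      by (intro mult_mono d A) auto
    then show ?thesis by (simp add: mult.commute)
  qed
  then show "\<exists>d>0. \<forall>s t. 0 \<le> s \<longrightarrow> s \<le> t \<longrightarrow> t \<le> T \<longrightarrow> t - s < d \<longrightarrow>
        norm (A s t * (h t - h s)) \<le> e * (V t - V s)"
    using d(1) by blast
qed

text \<open>
  The errors over a partition of \<open>[0,t]\<close> with mesh below \<open>d\<close> telescope to at most \<open>e (V(t) - V(0))\<close>.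
\<close>

lemma negligible_increments_imp_constant:
  assumes "negligible T (\<lambda>s t. D t - D s)" and t: "t \<in> {0..T}"
  shows "D t = D 0"
proof -
  obtain V where mV: "mono_on {0..T} V"
    and V: "\<And>e. e > 0 \<Longrightarrow> \<exists>d>0. \<forall>s t. 0 \<le> s \<longrightarrow> s \<le> t \<longrightarrow> t \<le> T \<longrightarrow> t - s < d \<longrightarrow>
           norm (D t - D s) \<le> e * (V t - V s)"
    using assms(1) unfolding negligible_def by blast
  have le: "norm (D t - D 0) \<le> e * (V t - V 0)" if e: "e > 0" for e
  proof -
    obtain d where d: "d > 0" "\<And>s t. 0 \<le> s \<Longrightarrow> s \<le> t \<Longrightarrow> t \<le> T \<Longrightarrow> t - s < d \<Longrightarrow>
           norm (D t - D s) \<le> e * (V t - V s)"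
      using V[OF e] by blast
    obtain n :: nat where n: "t / d < real n" using reals_Archimedean2 by blast
    then have n0: "n > 0" using t d(1) by (cases n) (auto simp: field_simps)
    define p where "p k = t * real k / real n" for k
    have p: "p 0 = 0" "p n = t" using n0 by (auto simp: p_def)
    have step: "p (Suc k) - p k = t / real n" for k
      by (simp add: p_def add_divide_distrib diff_divide_distrib distrib_left)
    have "D t - D 0 = (\<Sum>k<n. D (p (Suc k)) - D (p k))"
      using sum_lessThan_telescope[of "\<lambda>k. D (p k)" n] p by simp
    also have "norm \<dots> \<le> (\<Sum>k<n. e * (V (p (Suc k)) - V (p k)))"
    proof (rule sum_norm_le)
      fix k assume "k \<in> {..<n}"
      then have "p (Suc k) \<le> p n"
        unfolding p_def using t n0 by (intro divide_right_mono mult_left_mono) auto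
      then have "p (Suc k) \<le> T" using p t by simp
      moreover have "0 \<le> p k" "0 \<le> t / real n" "t / real n < d"
        using t n n0 d(1) by (auto simp: p_def field_simps)
      ultimately show "norm (D (p (Suc k)) - D (p k)) \<le> e * (V (p (Suc k)) - V (p k))"
        using step[of k] by (intro d(2)) linarith+
    qed
    also have "\<dots> = e * (V t - V 0)"
      unfolding sum_distrib_left[symmetric]
      using sum_lessThan_telescope[of "\<lambda>k. V (p k)" n] p by simp
    finally show ?thesis .
  qed
  have V0: "0 \<le> V t - V 0" using mono_onD[OF mV, of 0 t] t by auto
  have "norm (D t - D 0) \<le> e" if "e > 0" for e
  proof -
    have "norm (D t - D 0) \<le> e / (V t - V 0 + 1) * (V t - V 0)"
      using V0 that by (intro le) auto
    also have "\<dots> \<le> e" using V0 that by (auto simp: field_simps)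
    finally show ?thesis .
  qed
  then show ?thesis using field_le_epsilon[of "norm (D t - D 0)" 0] by auto
qed

section \<open>The integral against \<open>dF\<close> for continuous integrands\<close>

text \<open>
  The sum of the variations of real and imaginary part is the distribution function of the sum of
  the four Jordan measures that make up \<open>dF\<close>, hence the natural bound for \<^const>\<open>cintegral\<close>.
\<close>

definition cvar :: "(real \<Rightarrow> complex) \<Rightarrow> real \<Rightarrow> real" where
  "cvar F t = variation (Re \<circ> F) 0 t + variation (Im \<circ> F) 0 t"

lemma set_integral_increment:
  fixes M :: "real measure" and g :: "real \<Rightarrow> complex"
  assumes fin: "finite_measure M" and sets: "sets M = sets borel"
    and g: "continuous_on {0..T} g" and st: "0 \<le> s" "s \<le> t" "t \<le> T"
    and e: "\<And>u. u \<in> {s..t} \<Longrightarrow> norm (g u - \<gamma>) \<le> e"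
  shows "norm ((LINT u:{0..t}|M. g u) - (LINT u:{0..s}|M. g u) - \<gamma> * measure M {s<..t})
           \<le> e * measure M {s<..t}"
proof -
  interpret finite_measure M by fact
  have int: "set_integrable M A g" if "A \<in> sets borel" "A \<subseteq> {0..T}" for A
  proof -
    obtain B where B: "\<And>u. u \<in> {0..T} \<Longrightarrow> norm (g u) \<le> B"
      by (rule continuous_bounded_on_Icc[OF g]) blast
    have "set_integrable M {0..T} g"
      unfolding set_integrable_def
    proof (rule integrable_const_bound[of _ "\<bar>B\<bar>"])
      show "AE x in M. norm (indicat_real {0..T} x *\<^sub>R g x) \<le> \<bar>B\<bar>"
        using B by (intro AE_I2) (force simp: indicator_def)
      have "(\<lambda>x. indicat_real {0..T} x *\<^sub>R g x) \<in> borel_measurable borel"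
        by (rule borel_measurable_continuous_on_indicator) (use g in auto)
      then show "(\<lambda>x. indicat_real {0..T} x *\<^sub>R g x) \<in> borel_measurable M"
        by (simp add: measurable_cong_sets[OF sets refl])
    qed
    then show ?thesis by (rule set_integrable_subset) (use that sets in auto)
  qed
  have const: "set_integrable M {s<..t} (\<lambda>_. \<gamma>)"
    unfolding set_integrable_def by (intro integrable_mult_indicator) (auto simp: sets)
  have U: "{0..t} = {0..s} \<union> {s<..t}" using st by auto
  have "(LINT u:{0..t}|M. g u) = (LINT u:{0..s}|M. g u) + (LINT u:{s<..t}|M. g u)"
    unfolding U using st by (intro set_integral_Un int) auto
  moreover have "(LINT u:{s<..t}|M. \<gamma>) = \<gamma> * measure M {s<..t}"
    by (simp add: set_lebesgue_integral_def sets scaleR_conv_of_real)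
  moreover have "(LINT u:{s<..t}|M. g u - \<gamma>) = (LINT u:{s<..t}|M. g u) - (LINT u:{s<..t}|M. \<gamma>)"
    using st by (intro set_integral_diff int const) auto
  ultimately have "(LINT u:{0..t}|M. g u) - (LINT u:{0..s}|M. g u) - \<gamma> * measure M {s<..t}
     = (LINT u:{s<..t}|M. g u - \<gamma>)" by simp
  also have "norm \<dots> \<le> (LINT u:{s<..t}|M. e)"
    unfolding set_lebesgue_integral_def
  proof (rule Bochner_Integration.integral_norm_bound_integral)
    have "set_integrable M {s<..t} (\<lambda>u. g u - \<gamma>)"
      using st by (intro set_integral_diff int const) auto
    then show "integrable M (\<lambda>x. indicat_real {s<..t} x *\<^sub>R (g x - \<gamma>))"
      by (simp add: set_integrable_def)
    show "integrable M (\<lambda>x. indicat_real {s<..t} x *\<^sub>R e)"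
      by (intro integrable_mult_indicator) (auto simp: sets)
  qed (use e in \<open>auto simp: indicator_def\<close>)
  also have "\<dots> = e * measure M {s<..t}"
    by (simp add: set_lebesgue_integral_def sets)
  finally show ?thesis .
qed

lemma jordan_measures_Ioc:
  fixes G :: "real \<Rightarrow> real"
  assumes T: "0 \<le> T" and G: "continuous_on {0..T} G" and bv: "bounded_variation G 0 T"
    and st: "0 \<le> s" "s \<le> t" "t \<le> T"
  shows "measure (pos_meas T G) {s<..t} + measure (neg_meas T G) {s<..t} = variation G 0 t - variation G 0 s"
    and "measure (pos_meas T G) {s<..t} - measure (neg_meas T G) {s<..t} = G t - G s"
proof -
  note J = jordan_parts[OF T G bv]
  note P = emeasure_clip[OF T J(1) J(3), simplified, folded pos_meas_def]
  note N = emeasure_clip[OF T J(2) J(4), simplified, folded neg_meas_def]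
  show "measure (pos_meas T G) {s<..t} + measure (neg_meas T G) {s<..t} = variation G 0 t - variation G 0 s"
    using st P(2)[of s t] N(2)[of s t] J(3)[of s t] J(4)[of s t]
    by (simp add: measure_def clip_id field_simps)
  show "measure (pos_meas T G) {s<..t} - measure (neg_meas T G) {s<..t} = G t - G s"
    by (rule jordan_measures(3)[OF T G bv st])
qed

text \<open>
  The quantitative estimate behind everything: freezing the integrand over \<open>(s,t]\<close> costs at most its
  oscillation times the variation of \<open>F\<close>.  It follows by applying the corresponding bound to
  each of the four Jordan measures; their differences give \<open>F(t) - F(s)\<close>, their sums the increment
  of \<^const>\<open>cvar\<close>.
\<close>

lemma cintegral_increment:
  fixes g :: "real \<Rightarrow> complex"
  assumes T: "0 \<le> T" and F: "continuous_on {0..T} F" and bv: "bounded_variation F 0 T"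
    and g: "continuous_on {0..T} g" and st: "0 \<le> s" "s \<le> t" "t \<le> T"
    and e: "\<And>u. u \<in> {s..t} \<Longrightarrow> norm (g u - \<gamma>) \<le> e"
  shows "norm (cintegral T F {0..t} g - cintegral T F {0..s} g - \<gamma> * (F t - F s))
           \<le> e * (cvar F t - cvar F s)"
proof -
  have cont: "continuous_on {0..T} (Re \<circ> F)" "continuous_on {0..T} (Im \<circ> F)"
    by (auto intro!: continuous_intros F simp: comp_def)
  note R = cont(1) bounded_variation_Re_Im(1)[OF bv]
  note I = cont(2) bounded_variation_Re_Im(2)[OF bv]
  have sets: "sets (pos_meas T G) = sets borel" "sets (neg_meas T G) = sets borel" for G
    by (simp_all add: pos_meas_def neg_meas_def)
  define d where "d M = (LINT u:{0..t}|M. g u) - (LINT u:{0..s}|M. g u) - \<gamma> * measure M {s<..t}" for M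
  have d: "norm (d M) \<le> e * measure M {s<..t}"
    if "finite_measure M" "sets M = sets borel" for M :: "real measure"
    unfolding d_def by (rule set_integral_increment[OF that g st e])
  have dd: "norm (d (pos_meas T G) - d (neg_meas T G)) \<le> e * (variation G 0 t - variation G 0 s)"
    if "continuous_on {0..T} G" "bounded_variation G 0 T" for G
  proof -
    have "norm (d (pos_meas T G) - d (neg_meas T G))
        \<le> e * measure (pos_meas T G) {s<..t} + e * measure (neg_meas T G) {s<..t}"
      by (rule order_trans[OF norm_triangle_ineq4])
        (intro add_mono d jordan_measures[OF T that] sets)
    then show ?thesis
      by (simp add: jordan_measures_Ioc(1)[OF T that st, symmetric] distrib_left)
  qed
  have Fd: "F t - F s
      = complex_of_real (measure (pos_meas T (Re \<circ> F)) {s<..t} - measure (neg_meas T (Re \<circ> F)) {s<..t})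
      + \<i> * complex_of_real (measure (pos_meas T (Im \<circ> F)) {s<..t} - measure (neg_meas T (Im \<circ> F)) {s<..t})"
    unfolding jordan_measures_Ioc(2)[OF T R st] jordan_measures_Ioc(2)[OF T I st]
    by (simp add: complex_eq_iff)
  have "norm (cintegral T F {0..t} g - cintegral T F {0..s} g - \<gamma> * (F t - F s))
      = norm ((d (pos_meas T (Re \<circ> F)) - d (neg_meas T (Re \<circ> F)))
        + \<i> * (d (pos_meas T (Im \<circ> F)) - d (neg_meas T (Im \<circ> F))))"
    unfolding Fd cintegral_def d_def by (simp add: algebra_simps)
  also have "\<dots> \<le> e * (variation (Re \<circ> F) 0 t - variation (Re \<circ> F) 0 s)
      + e * (variation (Im \<circ> F) 0 t - variation (Im \<circ> F) 0 s)"
    using dd[OF R] dd[OF I]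
    by (intro order_trans[OF norm_triangle_ineq] add_mono) (auto simp: norm_mult)
  also have "\<dots> = e * (cvar F t - cvar F s)" unfolding cvar_def by algebra
  finally show ?thesis .
qed

lemma cintegral_cong:
  "(\<And>u. u \<in> A \<Longrightarrow> g u = h u) \<Longrightarrow> cintegral T F A g = cintegral T F A h"
proof -
  assume *: "\<And>u. u \<in> A \<Longrightarrow> g u = h u"
  have "(LINT u:A|M. g u) = (LINT u:A|M. h u)" for M :: "real measure"
    unfolding set_lebesgue_integral_def
    by (rule Bochner_Integration.integral_cong) (auto simp: * indicator_def)
  then show ?thesis by (simp add: cintegral_def)
qed

text \<open>
  The inner simplices of an iterated integral are half-open intervals \<open>[0,u)\<close>; adding the end point
  changes nothing because \<open>dF\<close> has no atoms.
\<close>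

lemma cintegral_atomless:
  fixes g :: "real \<Rightarrow> complex"
  assumes T: "0 \<le> T" and F: "continuous_on {0..T} F" and bv: "bounded_variation F 0 T"
    and AB: "A \<subseteq> B" "B \<subseteq> insert c A"
  shows "cintegral T F A g = cintegral T F B g"
proof -
  have cont: "continuous_on {0..T} (Re \<circ> F)" "continuous_on {0..T} (Im \<circ> F)"
    by (auto intro!: continuous_intros F simp: comp_def)
  have *: "(LINT u:A|M. g u) = (LINT u:B|M. g u)"
    if M: "finite_measure M" "sets M = sets borel" "measure M {c} = 0" for M :: "real measure"
    unfolding set_lebesgue_integral_def
  proof (rule integral_discrete_difference[of "{c}"])
    interpret finite_measure M by fact
    show "emeasure M {x} = 0" if "x \<in> {c}" for x using that M(3) by (simp add: emeasure_eq_measure)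
    show "{x} \<in> sets M" if "x \<in> {c}" for x by (simp add: M(2))
    show "indicat_real A x *\<^sub>R g x = indicat_real B x *\<^sub>R g x" if "x \<notin> {c}" for x
      using that AB by (auto simp: indicator_def)
  qed auto
  show ?thesis
    unfolding cintegral_def
    using jordan_measures[OF T cont(1) bounded_variation_Re_Im(1)[OF bv]]
      jordan_measures[OF T cont(2) bounded_variation_Re_Im(2)[OF bv]]
    by (simp add: * pos_meas_def neg_meas_def)
qed

lemma cintegral_at_0:
  assumes "0 \<le> T" "continuous_on {0..T} F" "bounded_variation F 0 T"
  shows "cintegral T F {0} g = 0"
  using cintegral_atomless[OF assms, of "{}" "{0}" 0 g]
  by (simp add: cintegral_def set_lebesgue_integral_def)

lemma cvar_0: "cvar F 0 = 0"
proof -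
  have "variation G 0 0 = 0" for G :: "real \<Rightarrow> real"
  proof -
    have "x = 0" if "x \<in> partition_sums G 0 0" for x
    proof -
      from that obtain p n where p: "x = (\<Sum>k<n. norm (G (p (Suc k)) - G (p k)))" "p 0 = 0" "p n = 0"
        "\<forall>k<n. p k \<le> p (Suc k)" unfolding partition_sums_def by blast
      have "p k = 0" if "k \<le> n" for k
        using partition_mono[OF p(4), of 0 k] partition_mono[OF p(4), of k n] p that by simp
      then show ?thesis by (simp add: p(1))
    qed
    moreover have "partition_sums G 0 0 \<noteq> {}" by (rule partition_sums_nonempty) simp
    ultimately have "partition_sums G 0 0 = {0}" by blast
    then show ?thesis by (simp add: variation_def)
  qed
  then show ?thesis by (simp add: cvar_def)
qed

lemma mono_on_variation:
  assumes bv: "bounded_variation F 0 T"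
  shows "mono_on {0..T} (variation F 0)"
proof (rule mono_onI)
  fix s t :: real assume "s \<in> {0..T}" "t \<in> {0..T}" "s \<le> t"
  then show "variation F 0 s \<le> variation F 0 t"
    using norm_diff_le_variation[OF bv, of s t] norm_ge_zero[of "F t - F s"]
    by (simp del: norm_ge_zero)
qed

lemma mono_on_cvar:
  assumes bv: "bounded_variation F 0 T"
  shows "mono_on {0..T} (cvar F)"
proof (rule mono_onI)
  fix s t :: real assume "s \<in> {0..T}" "t \<in> {0..T}" "s \<le> t"
  then show "cvar F s \<le> cvar F t"
    unfolding cvar_def
    using mono_onD[OF mono_on_variation[OF bounded_variation_Re_Im(1)[OF bv]], of s t]
      mono_onD[OF mono_on_variation[OF bounded_variation_Re_Im(2)[OF bv]], of s t]
    by linarith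
qed

lemma norm_increment_le_cvar:
  assumes bv: "bounded_variation F 0 T" and st: "0 \<le> s" "s \<le> t" "t \<le> T"
  shows "norm (F t - F s) \<le> cvar F t - cvar F s"
proof -
  have "norm (F t - F s) \<le> \<bar>Re (F t - F s)\<bar> + \<bar>Im (F t - F s)\<bar>" by (rule cmod_le)
  also have "\<dots> \<le> cvar F t - cvar F s"
    using norm_diff_le_variation[OF bounded_variation_Re_Im(1)[OF bv] st]
      norm_diff_le_variation[OF bounded_variation_Re_Im(2)[OF bv] st]
    by (simp add: cvar_def)
  finally show ?thesis .
qed

lemma continuous_on_cvar:
  assumes T: "0 \<le> T" and F: "continuous_on {0..T} F" and bv: "bounded_variation F 0 T"
  shows "continuous_on {0..T} (cvar F)"
proof -
  have "continuous_on {0..T} (Re \<circ> F)" "continuous_on {0..T} (Im \<circ> F)"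
    by (auto intro!: continuous_intros F simp: comp_def)
  then show ?thesis
    unfolding cvar_def
    using continuous_on_variation[OF bounded_variation_Re_Im(1)[OF bv] T]
      continuous_on_variation[OF bounded_variation_Re_Im(2)[OF bv] T]
    by (intro continuous_on_add)
qed

definition stieltjes_driver :: "real \<Rightarrow> (real \<Rightarrow> complex) \<Rightarrow> bool" where
  "stieltjes_driver T F \<longleftrightarrow> 0 \<le> T \<and> continuous_on {0..T} F \<and> bounded_variation F 0 T"

lemma cintegral_primitive:
  assumes F: "stieltjes_driver T F" and g: "continuous_on {0..T} g"
  shows "negligible T (\<lambda>s t. cintegral T F {0..t} g - cintegral T F {0..s} g - g s * (F t - F s))"
proof (rule negligibleI[of _ "cvar F"])
  have F': "0 \<le> T" "continuous_on {0..T} F" "bounded_variation F 0 T"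
    using F by (auto simp: stieltjes_driver_def)
  show "mono_on {0..T} (cvar F)" by (rule mono_on_cvar[OF F'(3)])
  fix e :: real assume "e > 0"
  from uniformly_small_increments[OF g this]
  obtain d where d: "d > 0" "\<And>s t. 0 \<le> s \<Longrightarrow> s \<le> t \<Longrightarrow> t \<le> T \<Longrightarrow> t - s < d \<Longrightarrow> norm (g t - g s) \<le> e"
    by blast
  then show "\<exists>d>0. \<forall>s t. 0 \<le> s \<longrightarrow> s \<le> t \<longrightarrow> t \<le> T \<longrightarrow> t - s < d \<longrightarrow>
      norm (cintegral T F {0..t} g - cintegral T F {0..s} g - g s * (F t - F s)) \<le> e * (cvar F t - cvar F s)"
    by (intro exI[of _ d] conjI allI impI cintegral_increment[OF F' g]) auto
qed

text \<open>
  Two primitives of \<open>g dF\<close> differ by a function with negligible increments, that is, by a constant.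
  Linearity in the integrand and in the driver follows from this rule.
\<close>

lemma cintegral_eqI:
  assumes F: "stieltjes_driver T F" and g: "continuous_on {0..T} g"
    and \<Phi>: "negligible T (\<lambda>s t. \<Phi> t - \<Phi> s - g s * (F t - F s))" and t: "t \<in> {0..T}"
  shows "cintegral T F {0..t} g = \<Phi> t - \<Phi> 0"
proof -
  define D where "D t = cintegral T F {0..t} g - \<Phi> t" for t
  have "negligible T (\<lambda>s t. D t - D s)"
    by (rule negligible_cong[OF negligible_diff[OF cintegral_primitive[OF F g] \<Phi>]]) (simp add: D_def)
  from negligible_increments_imp_constant[OF this t]
  show ?thesis using F by (simp add: D_def cintegral_at_0 stieltjes_driver_def algebra_simps)
qed

lemma cintegral_bound:
  assumes F: "stieltjes_driver T F" and g: "continuous_on {0..T} g" and t: "t \<in> {0..T}"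
    and B: "\<And>u. u \<in> {0..T} \<Longrightarrow> norm (g u) \<le> B"
  shows "norm (cintegral T F {0..t} g) \<le> B * cvar F T"
proof -
  have F': "0 \<le> T" "continuous_on {0..T} F" "bounded_variation F 0 T"
    using F by (auto simp: stieltjes_driver_def)
  have "norm (cintegral T F {0..t} g) \<le> B * cvar F t"
    using cintegral_increment[OF F' g, of 0 t 0 B] B t by (simp add: cintegral_at_0[OF F'] cvar_0)
  also have "\<dots> \<le> B * cvar F T"
    using t mono_onD[OF mono_on_cvar[OF F'(3)], of t T] order_trans[OF norm_ge_zero B[OF t]]
    by (intro mult_left_mono) auto
  finally show ?thesis .
qed

lemma continuous_on_cintegral:
  assumes F: "stieltjes_driver T F" and g: "continuous_on {0..T} g"
  shows "continuous_on {0..T} (\<lambda>t. cintegral T F {0..t} g)"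
proof -
  have F': "0 \<le> T" "continuous_on {0..T} F" "bounded_variation F 0 T"
    using F by (auto simp: stieltjes_driver_def)
  obtain B where B: "B > 0" "\<And>u. u \<in> {0..T} \<Longrightarrow> norm (g u) \<le> B"
    by (rule continuous_bounded_on_Icc[OF g]) blast
  have le: "norm (cintegral T F {0..t} g - cintegral T F {0..s} g) \<le> B * \<bar>cvar F t - cvar F s\<bar>"
    if "s \<in> {0..T}" "t \<in> {0..T}" "s \<le> t" for s t
  proof -
    have "norm (cintegral T F {0..t} g - cintegral T F {0..s} g) \<le> B * (cvar F t - cvar F s)"
      using cintegral_increment[OF F' g, of s t 0 B] B that by simp
    also have "\<dots> \<le> B * \<bar>cvar F t - cvar F s\<bar>" using B(1) by (intro mult_left_mono) auto
    finally show ?thesis .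
  qed
  have le': "norm (cintegral T F {0..t} g - cintegral T F {0..s} g) \<le> B * \<bar>cvar F t - cvar F s\<bar>"
    if "s \<in> {0..T}" "t \<in> {0..T}" for s t
    using le[of s t] le[of t s] that by (cases "s \<le> t") (auto simp: norm_minus_commute abs_minus_commute)
  show ?thesis
    unfolding continuous_on_iff
  proof (intro ballI allI impI)
    fix s e :: real assume s: "s \<in> {0..T}" and e: "0 < e"
    have "e / B > 0" using e B(1) by simp
    with continuous_on_cvar[OF F', unfolded continuous_on_iff] s
    have "\<exists>d>0. \<forall>t\<in>{0..T}. dist t s < d \<longrightarrow> dist (cvar F t) (cvar F s) < e / B" by blast
    then obtain d where d: "d > 0" "\<And>t. t \<in> {0..T} \<Longrightarrow> dist t s < d \<Longrightarrow> dist (cvar F t) (cvar F s) < e / B"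
      by blast
    have "dist (cintegral T F {0..t} g) (cintegral T F {0..s} g) < e" if "t \<in> {0..T}" "dist t s < d" for t
    proof -
      have "B * \<bar>cvar F t - cvar F s\<bar> < B * (e / B)"
        using d(2)[OF that] B(1) by (intro mult_strict_left_mono) (auto simp: dist_real_def)
      then show ?thesis using le'[OF s that(1)] B(1) by (simp add: dist_norm)
    qed
    then show "\<exists>d>0. \<forall>t\<in>{0..T}. dist t s < d \<longrightarrow> dist (cintegral T F {0..t} g) (cintegral T F {0..s} g) < e"
      using d(1) by blast
  qed
qed

section \<open>Variation, total variation, and series of drivers\<close>

lemma variation_leI:
  assumes "a \<le> b" "\<And>x. x \<in> partition_sums F a b \<Longrightarrow> x \<le> M"
  shows "bounded_variation F a b" "variation F a b \<le> M"
  using assms partition_sums_nonempty[OF assms(1), of F]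
  by (auto simp: bounded_variation_def variation_def intro: cSup_least bdd_aboveI[of _ M])

lemma partition_sumsE:
  assumes "x \<in> partition_sums F a b"
  obtains p n where "x = (\<Sum>k<n. norm (F (p (Suc k)) - F (p k)))" "p 0 = a" "p n = b"
    "\<And>k. k < n \<Longrightarrow> p k \<le> p (Suc k)" "\<And>k. k \<le> n \<Longrightarrow> p k \<in> {a..b}"
proof -
  from assms obtain p n where p: "x = (\<Sum>k<n. norm (F (p (Suc k)) - F (p k)))" "p 0 = a" "p n = b"
    "\<forall>k<n. p k \<le> p (Suc k)" unfolding partition_sums_def by blast
  have "p k \<in> {a..b}" if "k \<le> n" for k
    using partition_mono[OF p(4), of 0 k] partition_mono[OF p(4), of k n] p(2,3) that by simp
  moreover have "p k \<le> p (Suc k)" if "k < n" for k using p(4) that by blast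
  ultimately show ?thesis using that[OF p(1-3)] by blast
qed

lemma partition_sum_le_variation:
  assumes "bounded_variation F a b" "p 0 = a" "p n = b" "\<And>k. k < n \<Longrightarrow> p k \<le> p (Suc k)"
  shows "(\<Sum>k<n. norm (F (p (Suc k)) - F (p k))) \<le> variation F a b"
  by (rule variation_upper[OF assms(1)]) (use assms(2-4) in \<open>unfold partition_sums_def, blast\<close>)

lemma variation_dominated:
  assumes "a \<le> b" "bounded_variation F a b"
    and le: "\<And>s t. s \<in> {a..b} \<Longrightarrow> t \<in> {a..b} \<Longrightarrow> norm (G t - G s) \<le> c * norm (F t - F s)" and "c \<ge> 0"
  shows "bounded_variation G a b" "variation G a b \<le> c * variation F a b"
proof -
  have "x \<le> c * variation F a b" if "x \<in> partition_sums G a b" for x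
    using that
  proof (rule partition_sumsE)
    fix p n assume p: "x = (\<Sum>k<n. norm (G (p (Suc k)) - G (p k)))" "p 0 = a" "p n = b"
      "\<And>k. k < n \<Longrightarrow> p k \<le> p (Suc k)" "\<And>k. k \<le> n \<Longrightarrow> p k \<in> {a..b}"
    have "x \<le> (\<Sum>k<n. c * norm (F (p (Suc k)) - F (p k)))"
      unfolding p(1) by (intro sum_mono le p) auto
    also have "\<dots> = c * (\<Sum>k<n. norm (F (p (Suc k)) - F (p k)))" by (simp add: sum_distrib_left)
    also have "\<dots> \<le> c * variation F a b"
      by (intro mult_left_mono partition_sum_le_variation assms p)
    finally show ?thesis .
  qed
  then show "bounded_variation G a b" "variation G a b \<le> c * variation F a b"
    using variation_leI[OF \<open>a \<le> b\<close>, of G] by blast+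
qed

lemma stieltjes_driver_bv: "stieltjes_driver T F \<Longrightarrow> bounded_variation F 0 T"
  and stieltjes_driver_cont: "stieltjes_driver T F \<Longrightarrow> continuous_on {0..T} F"
  and stieltjes_driver_T: "stieltjes_driver T F \<Longrightarrow> 0 \<le> T"
  by (auto simp: stieltjes_driver_def)

lemma variation_nonneg:
  assumes "a \<le> b" "bounded_variation F a b"
  shows "0 \<le> variation F a b"
  by (rule order_trans[OF norm_ge_zero variation_upper[OF assms(2) norm_diff_in_partition_sums[OF assms(1)]]])

text \<open>
  The summability hypothesis on the driving functions concerns variations, whereas the integral is
  estimated by \<^const>\<open>cvar\<close>.
\<close>

lemma cvar_le_variation:
  assumes F: "stieltjes_driver T F"
  shows "cvar F T \<le> 2 * variation F 0 T"
proof -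
  have re: "norm ((Re \<circ> F) t - (Re \<circ> F) s) \<le> 1 * norm (F t - F s)" for s t
    using abs_Re_le_cmod[of "F t - F s"] by simp
  have im: "norm ((Im \<circ> F) t - (Im \<circ> F) s) \<le> 1 * norm (F t - F s)" for s t
    using abs_Im_le_cmod[of "F t - F s"] by simp
  have "variation (Re \<circ> F) 0 T \<le> 1 * variation F 0 T"
    by (rule variation_dominated(2)[OF stieltjes_driver_T[OF F] stieltjes_driver_bv[OF F] re]) simp
  moreover have "variation (Im \<circ> F) 0 T \<le> 1 * variation F 0 T"
    by (rule variation_dominated(2)[OF stieltjes_driver_T[OF F] stieltjes_driver_bv[OF F] im]) simp
  ultimately show ?thesis by (simp add: cvar_def)
qed

lemma cvar_nonneg:
  assumes "stieltjes_driver T F" "t \<in> {0..T}"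
  shows "0 \<le> cvar F t"
  using mono_onD[OF mono_on_cvar[OF stieltjes_driver_bv[OF assms(1)]], of 0 t] assms(2)
  by (simp add: cvar_0)

lemma stieltjes_driver_scale:
  assumes F: "stieltjes_driver T F"
  shows "stieltjes_driver T (\<lambda>t. c * F t)" "variation (\<lambda>t. c * F t) 0 T \<le> norm c * variation F 0 T"
proof -
  have *: "norm (c * F t - c * F s) \<le> norm c * norm (F t - F s)" for s t
    by (simp add: norm_mult flip: right_diff_distrib)
  note V = variation_dominated[OF stieltjes_driver_T[OF F] stieltjes_driver_bv[OF F] * norm_ge_zero]
  show "stieltjes_driver T (\<lambda>t. c * F t)"
    unfolding stieltjes_driver_def
    using stieltjes_driver_T[OF F] stieltjes_driver_cont[OF F] V(1) by (simp add: continuous_on_mult_left)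
  show "variation (\<lambda>t. c * F t) 0 T \<le> norm c * variation F 0 T"
    by (rule V(2))
qed

lemma norm_le_start_plus_variation:
  assumes F: "stieltjes_driver T F" and t: "t \<in> {0..T}"
  shows "norm (F t) \<le> norm (F 0) + variation F 0 T"
proof -
  have "norm (F t - F 0) \<le> variation F 0 t - variation F 0 0"
    using norm_diff_le_variation[OF stieltjes_driver_bv[OF F], of 0 t] t by simp
  also have "variation F 0 0 \<ge> 0"
    using t by (intro variation_nonneg bounded_variation_subinterval[OF stieltjes_driver_bv[OF F]]) auto
  then have "variation F 0 t - variation F 0 0 \<le> variation F 0 T"
    using mono_onD[OF mono_on_variation[OF stieltjes_driver_bv[OF F]], of t T] t by simp
  finally show ?thesis using norm_triangle_ineq2[of "F t" "F 0"] by linarith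
qed

text \<open>
  Applied to \<open>F\<^sub>n = z\<^sup>n x\<^sub>n\<close> this shows that \<open>\<xi>(x,z)\<close> is continuous and of bounded variation.
\<close>

lemma stieltjes_driver_suminf:
  assumes F: "\<And>n. stieltjes_driver T (F n)"
    and s0: "summable (\<lambda>n. norm (F n 0))" and sv: "summable (\<lambda>n. variation (F n) 0 T)"
  shows "t \<in> {0..T} \<Longrightarrow> summable (\<lambda>n. F n t)"
    and "stieltjes_driver T (\<lambda>t. \<Sum>n. F n t)"
proof -
  note T = stieltjes_driver_T[OF F]
  define M where "M n = norm (F n 0) + variation (F n) 0 T" for n
  have M: "summable M" unfolding M_def by (intro summable_add s0 sv)
  have le: "norm (F n t) \<le> M n" if "t \<in> {0..T}" for n t
    unfolding M_def by (rule norm_le_start_plus_variation[OF F that])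
  show sum: "summable (\<lambda>n. F n t)" if "t \<in> {0..T}" for t
    using le[OF that] M by (intro summable_comparison_test[of "\<lambda>n. F n t" M]) auto
  have "uniform_limit {0..T} (\<lambda>n t. \<Sum>i<n. F i t) (\<lambda>t. \<Sum>n. F n t) sequentially"
    by (rule Weierstrass_m_test[OF le M])
  then have cont: "continuous_on {0..T} (\<lambda>t. \<Sum>n. F n t)"
    by (rule uniform_limit_theorem[rotated])
      (simp_all add: always_eventually continuous_on_sum stieltjes_driver_cont[OF F])
  have "x \<le> (\<Sum>n. variation (F n) 0 T)" if "x \<in> partition_sums (\<lambda>t. \<Sum>n. F n t) 0 T" for x
    using that
  proof (rule partition_sumsE)
    fix p N assume p: "x = (\<Sum>k<N. norm ((\<Sum>n. F n (p (Suc k))) - (\<Sum>n. F n (p k))))" "p 0 = 0" "p N = T"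
      "\<And>k. k < N \<Longrightarrow> p k \<le> p (Suc k)" "\<And>k. k \<le> N \<Longrightarrow> p k \<in> {0..T}"
    have sn: "summable (\<lambda>n. norm (F n (p (Suc k)) - F n (p k)))" if "k < N" for k
    proof (rule summable_comparison_test[OF exI[of _ 0] summable_add[OF M M]], intro allI impI)
      fix n
      show "norm (norm (F n (p (Suc k)) - F n (p k))) \<le> M n + M n"
        using norm_triangle_ineq4[of "F n (p (Suc k))" "F n (p k)"] le[OF p(5), of k n] le[OF p(5), of "Suc k" n] that
        by simp
    qed
    have "x \<le> (\<Sum>k<N. \<Sum>n. norm (F n (p (Suc k)) - F n (p k)))"
      unfolding p(1)
    proof (rule sum_mono)
      fix k assume k: "k \<in> {..<N}"
      have "(\<Sum>n. F n (p (Suc k))) - (\<Sum>n. F n (p k)) = (\<Sum>n. F n (p (Suc k)) - F n (p k))"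
        using k by (intro suminf_diff sum p) auto
      then show "norm ((\<Sum>n. F n (p (Suc k))) - (\<Sum>n. F n (p k))) \<le> (\<Sum>n. norm (F n (p (Suc k)) - F n (p k)))"
        using summable_norm[OF sn[of k]] k by simp
    qed
    also have "\<dots> = (\<Sum>n. \<Sum>k<N. norm (F n (p (Suc k)) - F n (p k)))"
      by (rule suminf_sum[symmetric]) (use sn in auto)
    also have "\<dots> \<le> (\<Sum>n. variation (F n) 0 T)"
      by (intro suminf_le partition_sum_le_variation stieltjes_driver_bv F p sv summable_sum sn) auto
    finally show ?thesis .
  qed
  then have "bounded_variation (\<lambda>t. \<Sum>n. F n t) 0 T" by (rule variation_leI[OF T])
  with cont T show "stieltjes_driver T (\<lambda>t. \<Sum>n. F n t)" by (simp add: stieltjes_driver_def)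
qed

text \<open>
  The intervals between consecutive points of a partition are disjoint and carry the increments of
  \<open>F\<close>; together with their complement in \<open>[0,T]\<close> they are competitors in the supremum that defines
  the total variation.  That supremum is meaningful because it is bounded by the four Jordan masses.
\<close>

lemma variation_le_total_variation:
  assumes F: "stieltjes_driver T F"
  shows "variation F 0 T \<le> total_variation (cmeasure T F) {0..T}"
proof (rule variation_leI[OF stieltjes_driver_T[OF F]])
  have F': "0 \<le> T" "continuous_on {0..T} F" "bounded_variation F 0 T"
    using F by (auto simp: stieltjes_driver_def)
  have cont: "continuous_on {0..T} (Re \<circ> F)" "continuous_on {0..T} (Im \<circ> F)"
    by (auto intro!: continuous_intros F' simp: comp_def)
  note R = jordan_measures(1,2)[OF F'(1) cont(1) bounded_variation_Re_Im(1)[OF F'(3)]]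
  note I = jordan_measures(1,2)[OF F'(1) cont(2) bounded_variation_Re_Im(2)[OF F'(3)]]
  define S where "S = {(\<Sum>E\<in>P. norm (cmeasure T F E)) | P. finite P \<and> partition_on {0..T} P \<and> P \<subseteq> sets borel}"
  define m where "m M = measure M {0..T}" for M :: "real measure"
  have bdd: "v \<le> m (pos_meas T (Re \<circ> F)) + m (neg_meas T (Re \<circ> F)) + (m (pos_meas T (Im \<circ> F)) + m (neg_meas T (Im \<circ> F)))"
    if "v \<in> S" for v
  proof -
    from that obtain P where P: "v = (\<Sum>E\<in>P. norm (cmeasure T F E))" "finite P" "partition_on {0..T} P"
      "P \<subseteq> sets borel" unfolding S_def by blast
    have *: "(\<Sum>E\<in>P. measure M E) = m M" if "finite_measure M" "sets M = sets borel" for M :: "real measure"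
    proof -
      interpret finite_measure M by fact
      have "measure M (\<Union>E\<in>P. E) = (\<Sum>E\<in>P. measure M E)"
        using P partition_onD2[OF P(3)] that(2)
        by (intro finite_measure_finite_Union) (auto simp: disjoint_family_on_def disjoint_def)
      then show ?thesis using partition_onD1[OF P(3)] by (simp add: m_def)
    qed
    have "norm (cmeasure T F E) \<le> measure (pos_meas T (Re \<circ> F)) E + measure (neg_meas T (Re \<circ> F)) E
        + (measure (pos_meas T (Im \<circ> F)) E + measure (neg_meas T (Im \<circ> F)) E)" for E
    proof -
      have "norm (cmeasure T F E) \<le> \<bar>Re (cmeasure T F E)\<bar> + \<bar>Im (cmeasure T F E)\<bar>" by (rule cmod_le)
      then show ?thesis
        unfolding cmeasure_def complex.sel
        using measure_nonneg[of "pos_meas T (Re \<circ> F)" E] measure_nonneg[of "neg_meas T (Re \<circ> F)" E]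
          measure_nonneg[of "pos_meas T (Im \<circ> F)" E] measure_nonneg[of "neg_meas T (Im \<circ> F)" E]
        by linarith
    qed
    then have "v \<le> (\<Sum>E\<in>P. measure (pos_meas T (Re \<circ> F)) E + measure (neg_meas T (Re \<circ> F)) E
        + (measure (pos_meas T (Im \<circ> F)) E + measure (neg_meas T (Im \<circ> F)) E))"
      unfolding P(1) by (rule sum_mono)
    then show ?thesis
      unfolding sum.distrib using R I by (simp add: * pos_meas_def neg_meas_def)
  qed
  then have bS: "bdd_above S" by (rule bdd_aboveI)
  fix x assume "x \<in> partition_sums F 0 T"
  then show "x \<le> total_variation (cmeasure T F) {0..T}"
  proof (rule partition_sumsE)
    fix p n assume p: "x = (\<Sum>k<n. norm (F (p (Suc k)) - F (p k)))" "p 0 = 0" "p n = T"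
      "\<And>k. k < n \<Longrightarrow> p k \<le> p (Suc k)" "\<And>k. k \<le> n \<Longrightarrow> p k \<in> {0..T}"
    define K where "K = {k. k < n \<and> p k < p (Suc k)}"
    define J where "J k = {p k<..p (Suc k)}" for k
    \<comment> \<open>The part not covered by the intervals; it contains 0 and is therefore a legitimate block.\<close>
    define E0 where "E0 = {0..T} - (\<Union>k\<in>K. J k)"
    have JT: "J k \<subseteq> {0<..T}" if "k \<in> K" for k
      using that p(5)[of k] p(5)[of "Suc k"] by (auto simp: J_def K_def)
    have disj: "J i \<inter> J j = {}" if "i \<in> K" "j \<in> K" "i < j" for i j
      using partition_mono[of n p "Suc i" j] p(4) that by (auto simp: J_def K_def)
    then have disj': "J i \<inter> J j = {}" if "i \<in> K" "j \<in> K" "i \<noteq> j" for i j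
      using that by (metis inf_commute linorder_neqE_nat)
    have ne: "J k \<noteq> {}" if "k \<in> K" for k using that by (auto simp: J_def K_def)
    have inj: "inj_on J K"
      using disj' ne by (intro inj_onI) (metis inf.idem)
    have "0 \<in> E0" using JT F'(1) by (fastforce simp: E0_def)
    have part: "partition_on {0..T} (insert E0 (J ` K))"
    proof (rule partition_onI)
      show "\<Union> (insert E0 (J ` K)) = {0..T}"
        using JT by (fastforce simp: E0_def)
      show "disjnt A B" if "A \<in> insert E0 (J ` K)" "B \<in> insert E0 (J ` K)" "A \<noteq> B" for A B
        using that disj' by (auto simp: disjnt_def E0_def)
      show "{} \<notin> insert E0 (J ` K)"
        using ne \<open>0 \<in> E0\<close> by auto
    qed
    have fin: "finite K" by (auto simp: K_def)
    have "x = (\<Sum>k\<in>K. norm (F (p (Suc k)) - F (p k)))"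
      unfolding p(1)
      by (rule sum.mono_neutral_right) (use p(4) in \<open>force simp: K_def\<close>)+
    also have "\<dots> = (\<Sum>k\<in>K. norm (cmeasure T F (J k)))"
      unfolding J_def
      by (rule sum.cong) (use p(5) in \<open>auto simp: K_def cmeasure_Ioc[OF F']\<close>)
    also have "\<dots> = (\<Sum>E\<in>J ` K. norm (cmeasure T F E))"
      by (simp add: sum.reindex[OF inj])
    also have "\<dots> \<le> (\<Sum>E\<in>insert E0 (J ` K). norm (cmeasure T F E))"
      using fin by (intro sum_mono2) auto
    also have "\<dots> \<le> Sup S"
    proof (rule cSup_upper[OF _ bS])
      have "insert E0 (J ` K) \<subseteq> sets borel"
        using fin unfolding E0_def J_def by auto
      then show "(\<Sum>E\<in>insert E0 (J ` K). norm (cmeasure T F E)) \<in> S"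
        unfolding S_def using part fin by blast
    qed
    also have "\<dots> = total_variation (cmeasure T F) {0..T}"
      by (simp add: S_def total_variation_def)
    finally show "x \<le> total_variation (cmeasure T F) {0..T}" .
  qed
qed

section \<open>Linearity and series for the integral\<close>

lemma cintegral_0: "stieltjes_driver T F \<Longrightarrow> cintegral T F {0} g = 0"
  by (rule cintegral_at_0) (auto simp: stieltjes_driver_def)

lemma cintegral_mult:
  assumes F: "stieltjes_driver T F" and g: "continuous_on {0..T} g" and t: "t \<in> {0..T}"
  shows "cintegral T F {0..t} (\<lambda>s. c * g s) = c * cintegral T F {0..t} g"
proof -
  have "cintegral T F {0..t} (\<lambda>s. c * g s) = c * cintegral T F {0..t} g - c * cintegral T F {0..0} g"
    by (rule cintegral_eqI[OF F continuous_on_mult_left[OF g] _ t],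
        rule negligible_cong[OF negligible_cmult[OF cintegral_primitive[OF F g], of c]])
      (simp add: algebra_simps)
  then show ?thesis by (simp add: cintegral_0[OF F])
qed

lemma cintegral_scale_driver:
  assumes F: "stieltjes_driver T F" and g: "continuous_on {0..T} g" and t: "t \<in> {0..T}"
  shows "cintegral T (\<lambda>s. c * F s) {0..t} g = c * cintegral T F {0..t} g"
proof -
  have "cintegral T (\<lambda>s. c * F s) {0..t} g = c * cintegral T F {0..t} g - c * cintegral T F {0..0} g"
    by (rule cintegral_eqI[OF stieltjes_driver_scale(1)[OF F] g _ t],
        rule negligible_cong[OF negligible_cmult[OF cintegral_primitive[OF F g], of c]])
      (simp add: algebra_simps)
  then show ?thesis by (simp add: cintegral_0[OF F])
qed

lemma cintegral_sum:
  assumes F: "stieltjes_driver T F" and g: "\<And>k. k \<in> K \<Longrightarrow> continuous_on {0..T} (g k)" and t: "t \<in> {0..T}"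
  shows "cintegral T F {0..t} (\<lambda>s. \<Sum>k\<in>K. g k s) = (\<Sum>k\<in>K. cintegral T F {0..t} (g k))"
proof -
  have "cintegral T F {0..t} (\<lambda>s. \<Sum>k\<in>K. g k s)
      = (\<Sum>k\<in>K. cintegral T F {0..t} (g k)) - (\<Sum>k\<in>K. cintegral T F {0..0} (g k))"
    by (rule cintegral_eqI[OF F continuous_on_sum[OF g] _ t], assumption,
        rule negligible_cong[OF negligible_sum[OF cintegral_primitive[OF F g]]], assumption)
      (simp add: sum_subtractf sum_distrib_right)
  then show ?thesis by (simp add: cintegral_0[OF F])
qed

lemma cintegral_diff:
  assumes F: "stieltjes_driver T F" and g: "continuous_on {0..T} g" and h: "continuous_on {0..T} h"
    and t: "t \<in> {0..T}"
  shows "cintegral T F {0..t} (\<lambda>s. g s - h s) = cintegral T F {0..t} g - cintegral T F {0..t} h"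
proof -
  have "cintegral T F {0..t} (\<lambda>s. g s - h s) = (cintegral T F {0..t} g - cintegral T F {0..t} h)
     - (cintegral T F {0..0} g - cintegral T F {0..0} h)"
    by (rule cintegral_eqI[OF F continuous_on_diff[OF g h] _ t],
        rule negligible_cong[OF negligible_diff[OF cintegral_primitive[OF F g] cintegral_primitive[OF F h]]])
      (simp add: algebra_simps)
  then show ?thesis by (simp add: cintegral_0[OF F])
qed

text \<open>
  Partial sums converge uniformly, and the integral is continuous for the supremum norm.
\<close>

lemma cintegral_suminf:
  assumes F: "stieltjes_driver T F" and g: "\<And>k. continuous_on {0..T} (g k)" and t: "t \<in> {0..T}"
    and le: "\<And>k s. s \<in> {0..T} \<Longrightarrow> norm (g k s) \<le> M k" and M: "summable M"
  shows "continuous_on {0..T} (\<lambda>s. \<Sum>k. g k s)"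
    and "(\<lambda>k. cintegral T F {0..t} (g k)) sums cintegral T F {0..t} (\<lambda>s. \<Sum>k. g k s)"
proof -
  have ul: "uniform_limit {0..T} (\<lambda>n s. \<Sum>k<n. g k s) (\<lambda>s. \<Sum>k. g k s) sequentially"
    by (rule Weierstrass_m_test[OF le M])
  then show G: "continuous_on {0..T} (\<lambda>s. \<Sum>k. g k s)"
    by (rule uniform_limit_theorem[rotated]) (simp_all add: always_eventually continuous_on_sum g)
  define G where "G s = (\<Sum>k. g k s)" for s
  have gs: "continuous_on {0..T} (\<lambda>s. \<Sum>k<n. g k s)" for n by (intro continuous_on_sum g)
  define I where "I h = cintegral T F {0..t} h" for h
  have c: "0 \<le> cvar F T" using cvar_nonneg[OF F] stieltjes_driver_T[OF F] by simp
  have "(\<lambda>n. \<Sum>k<n. I (g k)) \<longlonglongrightarrow> I G"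
  proof (rule LIMSEQ_I)
    fix e :: real assume e: "e > 0"
    define d where "d = e / (cvar F T + 1)"
    have d: "d > 0" using e c by (simp add: d_def)
    have "\<forall>\<^sub>F n in sequentially. \<forall>s\<in>{0..T}. dist (\<Sum>k<n. g k s) (G s) < d"
      using uniform_limitD[OF ul d] by (simp add: G_def)
    then obtain N where N: "\<And>n s. n \<ge> N \<Longrightarrow> s \<in> {0..T} \<Longrightarrow> dist (\<Sum>k<n. g k s) (G s) < d"
      unfolding eventually_sequentially by blast
    have "norm ((\<Sum>k<n. I (g k)) - I G) < e" if "n \<ge> N" for n
    proof -
      have "(\<Sum>k<n. I (g k)) - I G = cintegral T F {0..t} (\<lambda>s. (\<Sum>k<n. g k s) - G s)"
        unfolding I_def using cintegral_diff[OF F gs G[folded G_def] t, of n]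
          cintegral_sum[OF F g t, where K = "{..<n}"] by simp
      also have "norm (cintegral T F {0..t} (\<lambda>s. (\<Sum>k<n. g k s) - G s)) \<le> d * cvar F T"
        using N[OF that]
        by (intro cintegral_bound F t continuous_on_diff continuous_on_sum g G[folded G_def])
          (auto simp: dist_norm intro!: less_imp_le)
      also have "d * cvar F T < e"
        using e c by (simp add: d_def field_simps)
      finally show ?thesis .
    qed
    then show "\<exists>no. \<forall>n\<ge>no. norm ((\<Sum>k<n. I (g k)) - I G) < e" by blast
  qed
  then show "(\<lambda>k. cintegral T F {0..t} (g k)) sums cintegral T F {0..t} (\<lambda>s. \<Sum>k. g k s)"
    by (simp add: sums_def I_def G_def[abs_def])
qed

text \<open>
  The errors made by freezing \<open>g\<close> are at most \<open>e\<close> times the increments of \<^const>\<open>cvar\<close> of the single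
  drivers.  Summed over \<open>n\<close>, they are controlled by the nondecreasing function
  \<open>V = \<Sum>\<^sub>n cvar F\<^sub>n\<close>, so the sum of the integrals is a primitive of \<open>g d(\<Sum>\<^sub>n F\<^sub>n)\<close>.
\<close>

lemma cintegral_suminf_driver:
  assumes F: "\<And>n. stieltjes_driver T (F n)"
    and s0: "summable (\<lambda>n. norm (F n 0))" and sv: "summable (\<lambda>n. variation (F n) 0 T)"
    and g: "continuous_on {0..T} g" and t: "t \<in> {0..T}"
  shows "(\<lambda>n. cintegral T (F n) {0..t} g) sums cintegral T (\<lambda>s. \<Sum>n. F n s) {0..t} g"
proof -
  note D = stieltjes_driver_suminf[OF F s0 sv]
  note T = stieltjes_driver_T[OF F]
  obtain B where B: "B > 0" "\<And>u. u \<in> {0..T} \<Longrightarrow> norm (g u) \<le> B"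
    by (rule continuous_bounded_on_Icc[OF g]) blast
  have cm: "cvar (F n) t \<le> 2 * variation (F n) 0 T" if "t \<in> {0..T}" for n t
    using mono_onD[OF mono_on_cvar[OF stieltjes_driver_bv[OF F[of n]]], of t T] cvar_le_variation[OF F[of n]] that
    by simp
  have cs: "summable (\<lambda>n. cvar (F n) t)" if "t \<in> {0..T}" for t
    by (rule summable_comparison_test[OF exI[of _ 0] summable_mult[OF sv, of 2]])
      (use cm[OF that] cvar_nonneg[OF F that] in auto)
  have ints: "summable (\<lambda>n. cintegral T (F n) {0..t} g)" if "t \<in> {0..T}" for t
  proof (rule summable_comparison_test[OF exI[of _ 0] summable_mult[OF cs[of T], of B]], intro allI impI)
    show "norm (cintegral T (F n) {0..t} g) \<le> B * cvar (F n) T" for n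
      by (rule cintegral_bound[OF F g that B(2)])
  qed (use T in auto)
  define \<Phi> where "\<Phi> t = (\<Sum>n. cintegral T (F n) {0..t} g)" for t
  define V where "V t = (\<Sum>n. cvar (F n) t)" for t
  have "cintegral T (\<lambda>s. \<Sum>n. F n s) {0..t} g = \<Phi> t - \<Phi> 0"
  proof (rule cintegral_eqI[OF D(2) g _ t], rule negligibleI[of _ V])
    show "mono_on {0..T} V"
      unfolding V_def
      by (intro mono_onI suminf_le cs mono_onD[OF mono_on_cvar[OF stieltjes_driver_bv[OF F]]]) auto
    fix e :: real assume "e > 0"
    from uniformly_small_increments[OF g this]
    obtain d where d: "d > 0" "\<And>s t. 0 \<le> s \<Longrightarrow> s \<le> t \<Longrightarrow> t \<le> T \<Longrightarrow> t - s < d \<Longrightarrow> norm (g t - g s) \<le> e"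
      by blast
    have "norm (\<Phi> t - \<Phi> s - g s * ((\<Sum>n. F n t) - (\<Sum>n. F n s))) \<le> e * (V t - V s)"
      if st: "0 \<le> s" "s \<le> t" "t \<le> T" "t - s < d" for s t
    proof -
      have st': "s \<in> {0..T}" "t \<in> {0..T}" using st by auto
      define h where "h n = cintegral T (F n) {0..t} g - cintegral T (F n) {0..s} g - g s * (F n t - F n s)" for n
      have "\<Phi> t - \<Phi> s - g s * ((\<Sum>n. F n t) - (\<Sum>n. F n s)) = (\<Sum>n. h n)"
      proof -
        have "(\<Sum>n. g s * (F n t - F n s)) = g s * ((\<Sum>n. F n t) - (\<Sum>n. F n s))"
          unfolding suminf_diff[OF D(1)[OF st'(2)] D(1)[OF st'(1)]]
          by (rule suminf_mult[OF summable_diff[OF D(1)[OF st'(2)] D(1)[OF st'(1)]]])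
        moreover have "(\<Sum>n. h n) = (\<Sum>n. cintegral T (F n) {0..t} g - cintegral T (F n) {0..s} g)
            - (\<Sum>n. g s * (F n t - F n s))"
          unfolding h_def by (intro suminf_diff[symmetric] summable_diff summable_mult ints D(1) st')
        ultimately show ?thesis
          unfolding \<Phi>_def suminf_diff[OF ints[OF st'(2)] ints[OF st'(1)]] by simp
      qed
      also have "norm (\<Sum>n. h n) \<le> (\<Sum>n. e * (cvar (F n) t - cvar (F n) s))"
      proof (rule norm_suminf_le)
        show "summable (\<lambda>n. e * (cvar (F n) t - cvar (F n) s))"
          by (intro summable_mult summable_diff cs st')
        show "norm (h n) \<le> e * (cvar (F n) t - cvar (F n) s)" for n
          unfolding h_def
          by (rule cintegral_increment[OF T stieltjes_driver_cont[OF F] stieltjes_driver_bv[OF F] g st(1-3)])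
            (use d(2) st in auto)
      qed
      also have "\<dots> = e * (V t - V s)"
        unfolding V_def suminf_diff[OF cs[OF st'(2)] cs[OF st'(1)]]
        by (rule suminf_mult[OF summable_diff[OF cs[OF st'(2)] cs[OF st'(1)]]])
      finally show ?thesis .
    qed
    then show "\<exists>d>0. \<forall>s t. 0 \<le> s \<longrightarrow> s \<le> t \<longrightarrow> t \<le> T \<longrightarrow> t - s < d \<longrightarrow>
        norm (\<Phi> t - \<Phi> s - g s * ((\<Sum>n. F n t) - (\<Sum>n. F n s))) \<le> e * (V t - V s)"
      using d(1) by blast
  qed
  also have "\<Phi> 0 = 0" by (simp add: \<Phi>_def cintegral_0[OF F])
  finally show ?thesis using ints[OF t] by (simp add: \<Phi>_def summable_sums)
qed

section \<open>Power series\<close>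

text \<open>
  A Cauchy product for double series that are dominated by a product but are not products
  themselves.
\<close>

lemma sums_antidiagonals:
  fixes b :: "nat \<Rightarrow> nat \<Rightarrow> complex"
  assumes A: "summable A" and B: "summable B"
    and le: "\<And>n k. norm (b n k) \<le> A n * B k" and A0: "\<And>n. 0 \<le> A n" and B0: "\<And>k. 0 \<le> B k"
    and row: "\<And>n. b n sums r n" and S: "r sums S"
  shows "(\<lambda>m. \<Sum>k\<le>m. b (m - k) k) sums S"
proof -
  have hsB: "(B has_sum suminf B) UNIV" and hsA: "(A has_sum suminf A) UNIV"
    using A B A0 B0 by (auto intro!: norm_summable_imp_has_sum summable_sums)
  have sAB: "(\<lambda>(n, k). A n * B k) summable_on (UNIV \<times> UNIV)"
  proof (rule summable_on_SigmaI)
    show "((\<lambda>k. case (n, k) of (n, k) \<Rightarrow> A n * B k) has_sum A n * suminf B) UNIV" for n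
      using has_sum_cmult_right[OF hsB, of "A n"] by simp
    show "(\<lambda>n. A n * suminf B) summable_on UNIV"
      by (rule summable_on_cmult_left) (use hsA in \<open>auto simp: summable_on_def\<close>)
  qed (auto simp: A0 B0)
  have abs: "(\<lambda>p. norm (case p of (n, k) \<Rightarrow> b n k)) summable_on (UNIV \<times> UNIV)"
    by (rule summable_on_comparison_test[OF sAB]) (auto simp: le)
  have rowS: "summable (\<lambda>k. norm (b n k))" for n
    by (rule summable_comparison_test[OF exI[of _ 0] summable_mult[OF B, of "A n"]]) (auto simp: le)
  have r_le: "norm (r n) \<le> A n * suminf B" for n
  proof -
    have "norm (r n) \<le> (\<Sum>k. norm (b n k))"
      using summable_norm[OF rowS[of n]] row[of n] by (simp add: sums_iff)
    also have "\<dots> \<le> (\<Sum>k. A n * B k)" by (intro suminf_le le rowS summable_mult B)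
    finally show ?thesis by (simp add: suminf_mult B)
  qed
  have "summable (\<lambda>n. norm (r n))"
    by (rule summable_comparison_test[OF exI[of _ 0] summable_mult2[OF A, of "suminf B"]]) (auto simp: r_le)
  then have rS: "(r has_sum S) UNIV" using S by (rule norm_summable_imp_has_sum)
  have "((\<lambda>(n, k). b n k) has_sum S) (UNIV \<times> UNIV)"
  proof (rule has_sum_SigmaI[OF _ rS])
    show "((\<lambda>k. case (n, k) of (n, k) \<Rightarrow> b n k) has_sum r n) UNIV" for n
      using norm_summable_imp_has_sum[OF rowS row] by simp
    show "(\<lambda>(n, k). b n k) summable_on UNIV \<times> UNIV" by (rule abs_summable_summable[OF abs])
  qed
  also have "((\<lambda>(n, k). b n k) has_sum S) (UNIV \<times> UNIV)
      \<longleftrightarrow> ((\<lambda>(m, k). b (m - k) k) has_sum S) (SIGMA m:UNIV. {..m})"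
    by (rule has_sum_reindex_bij_witness[of _ "\<lambda>(m, k). (m - k, k)" "\<lambda>(n, k). (n + k, k)"]) auto
  finally have "((\<lambda>m. \<Sum>k\<le>m. b (m - k) k) has_sum S) UNIV"
    by (rule has_sum_SigmaD) (auto intro!: has_sum_finiteI)
  then show ?thesis by (rule has_sum_imp_sums)
qed

lemma power_series_zero_coeffs:
  fixes d :: "nat \<Rightarrow> complex"
  assumes "\<And>z. z \<in> ball 0 1 \<Longrightarrow> (\<lambda>n. d n * z ^ n) sums 0"
  shows "d n = 0"
proof -
  have "(\<lambda>n. d n * (1 / 2) ^ n) sums 0" by (rule assms) simp
  then have "conv_radius d \<ge> ereal (norm (1 / 2 :: complex))"
    by (intro conv_radius_geI) (rule sums_summable)
  then have "conv_radius d > 0" by (rule less_le_trans[rotated]) (simp add: zero_ereal_def)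
  moreover have "eventually (\<lambda>z::complex. eval_fps (Abs_fps d) z = eval_fps 0 z) (nhds 0)"
    by (rule eventually_mono[OF eventually_nhds_in_open[of "ball 0 1"]])
      (use assms in \<open>auto simp: eval_fps_def sums_iff\<close>)
  ultimately have "Abs_fps d = 0"
    by (intro eval_fps_eqD) (auto simp: fps_conv_radius_def)
  then show ?thesis by (metis fps_nth_Abs_fps fps_zero_nth)
qed

lemma power_series_mult_deriv:
  fixes c :: "nat \<Rightarrow> complex"
  assumes f: "\<And>z. z \<in> ball 0 1 \<Longrightarrow> (\<lambda>n. c n * z ^ n) sums f z" and z: "z \<in> ball 0 1"
  shows "f holomorphic_on ball 0 1" "(\<lambda>n. of_nat n * c n * z ^ n) sums (z * deriv f z)"
proof -
  show hol: "f holomorphic_on ball 0 1"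
    by (rule power_series_holomorphic[of 0 1 c]) (use f in simp)
  have "(f has_field_derivative deriv f z) (at z)"
    using holomorphic_derivI[OF hol _ z] by simp
  then have "(\<lambda>n. diffs c n * z ^ n) sums deriv f z"
    by (rule termdiffs_sums_strong[of 1 c f, rotated]) (use f z in auto)
  then have "(\<lambda>n. z * (diffs c n * z ^ n)) sums (z * deriv f z)" by (rule sums_mult)
  then have "(\<lambda>n. of_nat (Suc n) * c (Suc n) * z ^ Suc n) sums (z * deriv f z)"
    by (simp add: diffs_def mult_ac)
  then show "(\<lambda>n. of_nat n * c n * z ^ n) sums (z * deriv f z)"
    by (subst (asm) sums_Suc_iff) simp
qed

lemma summable_of_nat_mult_power:
  fixes q :: real
  assumes "0 \<le> q" "q < 1"
  shows "summable (\<lambda>n. real n * q ^ n)"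
proof -
  have "summable (\<lambda>n. real (Suc n) * q ^ n)"
    using geometric_deriv_sums[of q] assms by (intro sums_summable) auto
  then have "summable (\<lambda>n. q * (real (Suc n) * q ^ n))" by (rule summable_mult)
  then have "summable (\<lambda>n. real (Suc n) * q ^ Suc n)" by (simp add: mult_ac)
  then show ?thesis by (subst (asm) summable_Suc_iff)
qed

section \<open>The system of coefficient equations\<close>

text \<open>
  The slot \<open>0\<close> is filled with \<open>x0\<close>, so that
  \<open>dx\<^sub>0 + d\<xi>(x,z) = \<Sum>\<^sub>n z\<^sup>n d(driver n)\<close> is a single power series.
\<close>

definition driver :: "(real \<Rightarrow> real) \<Rightarrow> (nat \<Rightarrow> real \<Rightarrow> complex) \<Rightarrow> nat \<Rightarrow> real \<Rightarrow> complex" where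
  "driver x0 x n = (if n = 0 then (\<lambda>s. of_real (x0 s)) else x n)"

lemma stieltjes_driver_of_driver:
  assumes "0 \<le> T" "driving_functions T x0 x"
  shows "stieltjes_driver T (driver x0 x n)"
proof (cases "n = 0")
  case True
  have d: "continuous_on {0..T} x0" "bounded_variation x0 0 T"
    using assms by (auto simp: driving_functions_def)
  have *: "norm (complex_of_real (x0 t) - complex_of_real (x0 s)) \<le> 1 * norm (x0 t - x0 s)" for s t
    by (simp add: norm_of_real flip: of_real_diff)
  have "bounded_variation (\<lambda>s. complex_of_real (x0 s)) 0 T"
    by (rule variation_dominated(1)[OF assms(1) d(2) *]) simp
  then show ?thesis
    using True assms(1) d(1) by (simp add: stieltjes_driver_def driver_def continuous_on_of_real)
next
  case False
  then show ?thesis using assms by (simp add: stieltjes_driver_def driver_def driving_functions_def)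
qed

lemma driver_summable:
  assumes T: "0 \<le> T" and x: "driving_functions T x0 x" and z: "z \<in> ball 0 1"
  shows "summable (\<lambda>n. norm (z ^ n * driver x0 x n 0))"
    and "summable (\<lambda>n. norm z ^ n * variation (driver x0 x n) 0 T)"
proof -
  have rad: "1 \<le> conv_radius (\<lambda>n. if n = 0 then 0 else x n 0)" and "x0 0 = 0"
    using x by (auto simp: driving_functions_def)
  have "ereal (norm z) < 1" using z by (simp add: one_ereal_def)
  from this rad have "ereal (norm z) < conv_radius (\<lambda>n. if n = 0 then 0 else x n 0)"
    by (rule less_le_trans)
  from abs_summable_in_conv_radius[OF this]
  show "summable (\<lambda>n. norm (z ^ n * driver x0 x n 0))"
    using \<open>x0 0 = 0\<close> by (simp add: driver_def mult.commute if_distrib[of "\<lambda>f. f 0"] cong: if_cong)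
  define r where "r = (norm z + 1) / 2"
  have r: "norm z \<le> r" "r \<in> {0<..<1}" using z by (auto simp: r_def add_pos_pos add_nonneg_pos)
  have s: "summable (\<lambda>n. total_variation (cmeasure T (x (Suc n))) {0..T} * r ^ Suc n)"
    using x r(2) by (auto simp: driving_functions_def)
  have "summable (\<lambda>n. norm z ^ Suc n * variation (driver x0 x (Suc n)) 0 T)"
  proof (rule summable_comparison_test[OF exI[of _ 0] s], intro allI impI)
    fix n
    have D: "stieltjes_driver T (driver x0 x (Suc n))" by (rule stieltjes_driver_of_driver[OF T x])
    have "norm z ^ Suc n * variation (driver x0 x (Suc n)) 0 T
        \<le> r ^ Suc n * total_variation (cmeasure T (driver x0 x (Suc n))) {0..T}"
      using r by (intro mult_mono power_mono variation_le_total_variation D variation_nonneg T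
          stieltjes_driver_bv[OF D]) auto
    then show "norm (norm z ^ Suc n * variation (driver x0 x (Suc n)) 0 T)
        \<le> total_variation (cmeasure T (x (Suc n))) {0..T} * r ^ Suc n"
      using variation_nonneg[OF T stieltjes_driver_bv[OF D]]
      by (simp add: driver_def mult.commute)
  qed
  then show "summable (\<lambda>n. norm z ^ n * variation (driver x0 x n) 0 T)"
    by (subst (asm) summable_Suc_iff)
qed

lemma cintegral_driver_sums:
  assumes T: "0 \<le> T" and x: "driving_functions T x0 x" and z: "z \<in> ball 0 1"
    and g: "continuous_on {0..T} g" and t: "t \<in> {0..T}"
  shows "(\<lambda>n. z ^ n * cintegral T (driver x0 x n) {0..t} g) sums
           (cintegral T (\<lambda>s. of_real (x0 s)) {0..t} g + cintegral T (\<xi> x z) {0..t} g)"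
proof -
  define F where "F n = (\<lambda>s. z ^ Suc n * driver x0 x (Suc n) s)" for n
  have D: "stieltjes_driver T (driver x0 x n)" for n by (rule stieltjes_driver_of_driver[OF T x])
  have F: "stieltjes_driver T (F n)" for n unfolding F_def by (rule stieltjes_driver_scale(1)[OF D])
  have s0: "summable (\<lambda>n. norm (F n 0))"
    unfolding F_def using driver_summable(1)[OF T x z] by (subst summable_Suc_iff)
  have "summable (\<lambda>n. norm z ^ Suc n * variation (driver x0 x (Suc n)) 0 T)"
    using driver_summable(2)[OF T x z] by (subst summable_Suc_iff)
  then have sv: "summable (\<lambda>n. variation (F n) 0 T)"
  proof (rule summable_comparison_test[rotated], intro exI[of _ 0] allI impI)
    fix n
    show "norm (variation (F n) 0 T) \<le> norm z ^ Suc n * variation (driver x0 x (Suc n)) 0 T"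
      using stieltjes_driver_scale(2)[OF D, of "z ^ Suc n" "Suc n"] variation_nonneg[OF T stieltjes_driver_bv[OF F]]
      unfolding F_def[of n, symmetric] norm_power[of z] by simp
  qed
  have xi: "(\<lambda>s. \<Sum>n. F n s) = \<xi> x z"
    by (simp add: fun_eq_iff \<xi>_def F_def driver_def mult.commute)
  have "(\<lambda>n. cintegral T (F n) {0..t} g) sums cintegral T (\<xi> x z) {0..t} g"
    using cintegral_suminf_driver[OF F s0 sv g t] unfolding xi .
  then have "(\<lambda>n. z ^ Suc n * cintegral T (driver x0 x (Suc n)) {0..t} g) sums cintegral T (\<xi> x z) {0..t} g"
    unfolding F_def cintegral_scale_driver[OF D g t] .
  from sums_Suc[OF this]
  show ?thesis by (simp add: driver_def add.commute)
qed

text \<open>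
  What the Taylor coefficients of a time-continuous family on the disc satisfy: continuity in time and
  Cauchy estimates that are uniform in time.
\<close>

definition coefficient_family :: "real \<Rightarrow> (nat \<Rightarrow> real \<Rightarrow> complex) \<Rightarrow> bool" where
  "coefficient_family T c \<longleftrightarrow> (\<forall>k. continuous_on {0..T} (c k)) \<and>
     (\<forall>r\<in>{0<..<1}. \<exists>M. \<forall>k. \<forall>s\<in>{0..T}. norm (c k s) * r ^ k \<le> M)"

text \<open>
  Expand the integrand \<open>z f\<^sub>s'(z) = \<Sum>\<^sub>k k c\<^sub>k(s) z\<^sup>k\<close> and the driver \<open>\<Sum>\<^sub>n z\<^sup>n y\<^sub>n\<close>, integrate term by term, and
  collect the terms with \<open>n + k = m\<close>.  The double series is dominated by the product of
  \<open>2 |z|\<^sup>n Var(y\<^sub>n)\<close> and \<open>M k q\<^sup>k\<close> with \<open>q = |z|/r\<close> and \<open>|z| < r < 1\<close>.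
\<close>

lemma LK_integral_power_series:
  assumes T: "0 \<le> T" and x: "driving_functions T x0 x" and c: "coefficient_family T c"
    and f: "\<And>s z. s \<in> {0..T} \<Longrightarrow> z \<in> ball 0 1 \<Longrightarrow> (\<lambda>k. c k s * z ^ k) sums f s z"
    and t: "t \<in> {0..T}" and z: "z \<in> ball 0 1"
  shows "(\<lambda>m. (\<Sum>k\<le>m. of_nat k * cintegral T (driver x0 x (m - k)) {0..t} (c k)) * z ^ m) sums
           (cintegral T (\<lambda>s. of_real (x0 s)) {0..t} (\<lambda>s. z * deriv (f s) z)
          + cintegral T (\<xi> x z) {0..t} (\<lambda>s. z * deriv (f s) z))"
proof -
  note D = stieltjes_driver_of_driver[OF T x]
  have cc: "continuous_on {0..T} (c k)" for k using c by (simp add: coefficient_family_def)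
  define r where "r = (norm z + 1) / 2"
  have r: "norm z < r" "r \<in> {0<..<1}" using z by (auto simp: r_def add_pos_pos add_nonneg_pos)
  then obtain M where M: "\<And>k s. s \<in> {0..T} \<Longrightarrow> norm (c k s) * r ^ k \<le> M"
    using c unfolding coefficient_family_def by blast
  have M0: "0 \<le> M" using order_trans[OF _ M[of 0 0]] T by simp
  define q where "q = norm z / r"
  have q: "0 \<le> q" "q < 1" using r by (auto simp: q_def)
  define B where "B k = M * (real k * q ^ k)" for k
  have B: "summable B" unfolding B_def by (intro summable_mult summable_of_nat_mult_power q)
  have B0: "0 \<le> B k" for k using M0 q by (simp add: B_def)
  define g where "g k s = of_nat k * z ^ k * c k s" for k s
  have g_cont: "continuous_on {0..T} (g k)" for k
    unfolding g_def by (intro continuous_intros cc)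
  have g_le: "norm (g k s) \<le> B k" if "s \<in> {0..T}" for k s
  proof -
    have "norm (c k s) * norm z ^ k = (norm (c k s) * r ^ k) * q ^ k"
      using r by (simp add: q_def power_divide)
    also have "\<dots> \<le> M * q ^ k" using q M[OF that] by (intro mult_right_mono) auto
    finally have "real k * (norm (c k s) * norm z ^ k) \<le> real k * (M * q ^ k)"
      by (rule mult_left_mono) simp
    then show ?thesis by (simp add: g_def B_def norm_mult norm_power mult_ac)
  qed
  define G where "G s = (\<Sum>k. g k s)" for s
  have G: "continuous_on {0..T} G"
    unfolding G_def by (rule cintegral_suminf(1)[OF D g_cont t g_le B])
  have zf: "z * deriv (f s) z = G s" if "s \<in> {0..T}" for s
    using power_series_mult_deriv(2)[OF f[OF that] z] unfolding G_def g_def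
    by (intro sums_unique) (simp add: mult_ac)
  define b where "b n k = z ^ n * cintegral T (driver x0 x n) {0..t} (g k)" for n k
  define A where "A n = 2 * (norm z ^ n * variation (driver x0 x n) 0 T)" for n
  have "(\<lambda>m. \<Sum>k\<le>m. b (m - k) k) sums
      (cintegral T (\<lambda>s. of_real (x0 s)) {0..t} G + cintegral T (\<xi> x z) {0..t} G)"
  proof (rule sums_antidiagonals[of A B])
    show "summable A" unfolding A_def by (intro summable_mult driver_summable(2)[OF T x z])
    show "summable B" by (rule B)
    show "0 \<le> A n" for n
      unfolding A_def by (intro mult_nonneg_nonneg variation_nonneg T stieltjes_driver_bv[OF D]) auto
    show "0 \<le> B k" for k by (rule B0)
    show "norm (b n k) \<le> A n * B k" for n k
    proof -
      have "norm (cintegral T (driver x0 x n) {0..t} (g k)) \<le> B k * cvar (driver x0 x n) T"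
        by (rule cintegral_bound[OF D g_cont t g_le])
      also have "\<dots> \<le> B k * (2 * variation (driver x0 x n) 0 T)"
        by (intro mult_left_mono cvar_le_variation[OF D] B0)
      finally have "norm z ^ n * norm (cintegral T (driver x0 x n) {0..t} (g k))
          \<le> norm z ^ n * (B k * (2 * variation (driver x0 x n) 0 T))"
        by (rule mult_left_mono) simp
      then show ?thesis by (simp add: b_def A_def norm_mult norm_power mult_ac)
    qed
    show "b n sums (z ^ n * cintegral T (driver x0 x n) {0..t} G)" for n
      unfolding b_def G_def by (intro sums_mult cintegral_suminf(2)[OF D g_cont t g_le B])
    show "(\<lambda>n. z ^ n * cintegral T (driver x0 x n) {0..t} G) sums
        (cintegral T (\<lambda>s. of_real (x0 s)) {0..t} G + cintegral T (\<xi> x z) {0..t} G)"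
      by (rule cintegral_driver_sums[OF T x z G t])
  qed
  moreover have "(\<Sum>k\<le>m. b (m - k) k)
      = (\<Sum>k\<le>m. of_nat k * cintegral T (driver x0 x (m - k)) {0..t} (c k)) * z ^ m" for m
    unfolding sum_distrib_right
  proof (rule sum.cong[OF refl])
    fix k assume "k \<in> {..m}"
    then have "z ^ m = z ^ (m - k) * z ^ k" by (simp flip: power_add)
    then show "b (m - k) k = of_nat k * cintegral T (driver x0 x (m - k)) {0..t} (c k) * z ^ m"
      unfolding b_def g_def by (simp add: cintegral_mult[OF D cc t])
  qed
  moreover have "cintegral T F {0..t} (\<lambda>s. z * deriv (f s) z) = cintegral T F {0..t} G" for F
    by (rule cintegral_cong) (use zf t in auto)
  ultimately show ?thesis by simp
qed

text \<open>
  The coefficient of \<open>z\<^sup>m\<close> in the Loewner--Kufarev equation.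
\<close>

definition coefficient_equation ::
  "real \<Rightarrow> (real \<Rightarrow> real) \<Rightarrow> (nat \<Rightarrow> real \<Rightarrow> complex) \<Rightarrow> (nat \<Rightarrow> real \<Rightarrow> complex) \<Rightarrow> bool" where
  "coefficient_equation T x0 x c \<longleftrightarrow> (\<forall>t\<in>{0..T}. \<forall>m.
     c m t = of_bool (m = 1) + (\<Sum>k\<le>m. of_nat k * cintegral T (driver x0 x (m - k)) {0..t} (c k)))"

lemma LK_equation_iff_coefficient_equation:
  assumes T: "0 \<le> T" and x: "driving_functions T x0 x" and c: "coefficient_family T c"
    and f: "\<And>s z. s \<in> {0..T} \<Longrightarrow> z \<in> ball 0 1 \<Longrightarrow> (\<lambda>k. c k s * z ^ k) sums f s z"
  shows "(\<forall>t\<in>{0..T}. \<forall>z\<in>ball 0 1.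
        f t z - z = cintegral T (\<lambda>s. of_real (x0 s)) {0..t} (\<lambda>s. z * deriv (f s) z)
                  + cintegral T (\<xi> x z) {0..t} (\<lambda>s. z * deriv (f s) z))
    \<longleftrightarrow> coefficient_equation T x0 x c"
proof -
  define R where "R m t = (\<Sum>k\<le>m. of_nat k * cintegral T (driver x0 x (m - k)) {0..t} (c k))" for m t
  define S where "S t z = cintegral T (\<lambda>s. of_real (x0 s)) {0..t} (\<lambda>s. z * deriv (f s) z)
                  + cintegral T (\<xi> x z) {0..t} (\<lambda>s. z * deriv (f s) z)" for t z
  have R: "(\<lambda>m. R m t * z ^ m) sums S t z" if "t \<in> {0..T}" "z \<in> ball 0 1" for t z
    unfolding R_def S_def by (rule LK_integral_power_series[OF T x c f that])
  have id: "(\<lambda>m. of_bool (m = 1) * z ^ m) sums z" for z :: complex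
    using sums_single[of 1 "\<lambda>m. z ^ m"] by (simp add: of_bool_def if_distrib[of "\<lambda>c. c * _"] cong: if_cong)
  have diff: "(\<lambda>m. (c m t - of_bool (m = 1) - R m t) * z ^ m) sums (f t z - z - S t z)"
    if "t \<in> {0..T}" "z \<in> ball 0 1" for t z
    unfolding left_diff_distrib by (intro sums_diff f R that id)
  have "(\<forall>z\<in>ball 0 1. f t z - z = S t z) \<longleftrightarrow> (\<forall>m. c m t - of_bool (m = 1) - R m t = 0)"
    if t: "t \<in> {0..T}" for t
  proof
    assume "\<forall>z\<in>ball 0 1. f t z - z = S t z"
    then show "\<forall>m. c m t - of_bool (m = 1) - R m t = 0"
      using power_series_zero_coeffs[of "\<lambda>m. c m t - of_bool (m = 1) - R m t"] diff[OF t] by simp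
  next
    assume "\<forall>m. c m t - of_bool (m = 1) - R m t = 0"
    then have "(\<lambda>m. 0) sums (f t z - z - S t z)" if "z \<in> ball 0 1" for z
      using diff[OF t that] by simp
    then have "f t z - z - S t z = 0" if "z \<in> ball 0 1" for z
      using that sums_unique2 sums_zero by blast
    then show "\<forall>z\<in>ball 0 1. f t z - z = S t z" by simp
  qed
  then show ?thesis
    unfolding coefficient_equation_def S_def[symmetric] R_def[symmetric] by (simp add: algebra_simps)
qed

section \<open>Integrating factors and uniqueness of the coefficients\<close>

text \<open>
  Both bounds say that the convex function \<open>exp\<close> lies above its tangents, at \<open>a\<close> and at \<open>b\<close>.
\<close>

lemma exp_increment_bounds:
  fixes a b :: real
  shows "0 \<le> exp b - exp a - exp a * (b - a)" "exp b - exp a - exp a * (b - a) \<le> (exp b - exp a) * (b - a)"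
proof -
  have 1: "exp u * (v - u) \<le> exp v - exp u" for u v :: real
  proof -
    have "exp u * (1 + (v - u)) \<le> exp u * exp (v - u)"
      by (intro mult_left_mono exp_ge_add_one_self) auto
    then show ?thesis by (simp add: exp_diff algebra_simps)
  qed
  show "0 \<le> exp b - exp a - exp a * (b - a)" using 1[of a b] by simp
  show "exp b - exp a - exp a * (b - a) \<le> (exp b - exp a) * (b - a)"
    using 1[of b a] by (simp add: algebra_simps)
qed

text \<open>
  The chain rule \<open>dE = \<kappa> E dx\<^sub>0\<close> for \<open>E = exp(\<kappa> x\<^sub>0)\<close>: by convexity the error is at most
  \<open>|\<kappa> (x\<^sub>0(t) - x\<^sub>0(s))| |E(t) - E(s)|\<close>, a second-order term.
\<close>

lemma negligible_exp_chain_rule: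
  fixes x0 :: "real \<Rightarrow> real" and \<kappa> :: real
  assumes y: "stieltjes_driver T (\<lambda>s. of_real (x0 s))"
  defines "E \<equiv> \<lambda>t. complex_of_real (exp (\<kappa> * x0 t))"
  shows "continuous_on {0..T} E"
    and "negligible T (\<lambda>s t. E t - E s - of_real \<kappa> * E s * (of_real (x0 t) - of_real (x0 s)))"
    and "continuous_on {0..T} \<Phi> \<Longrightarrow> negligible T (\<lambda>s t. (E t - E s) * (\<Phi> t - \<Phi> s))"
proof -
  define Y where "Y s = complex_of_real (x0 s)" for s
  have Y: "stieltjes_driver T Y" unfolding Y_def by (rule y)
  have "continuous_on {0..T} (\<lambda>s. Re (Y s))"
    by (intro continuous_intros stieltjes_driver_cont[OF Y])
  then have x0: "continuous_on {0..T} x0" by (simp add: Y_def)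
  then show E: "continuous_on {0..T} E" unfolding E_def by (intro continuous_intros)
  define V where "V s = \<bar>\<kappa>\<bar> * cvar Y s" for s
  have V: "mono_on {0..T} V"
    unfolding V_def
    by (intro mono_onI mult_left_mono mono_onD[OF mono_on_cvar[OF stieltjes_driver_bv[OF Y]]]) auto
  have dY: "\<bar>\<kappa> * x0 t - \<kappa> * x0 s\<bar> \<le> V t - V s" if "0 \<le> s" "s \<le> t" "t \<le> T" for s t
  proof -
    have "\<bar>x0 t - x0 s\<bar> \<le> cvar Y t - cvar Y s"
      using norm_increment_le_cvar[OF stieltjes_driver_bv[OF Y] that]
      by (simp add: Y_def norm_of_real flip: of_real_diff)
    then have "\<bar>\<kappa>\<bar> * \<bar>x0 t - x0 s\<bar> \<le> \<bar>\<kappa>\<bar> * (cvar Y t - cvar Y s)"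
      by (intro mult_left_mono) auto
    then show ?thesis by (simp add: V_def right_diff_distrib flip: abs_mult)
  qed
  have "negligible T (\<lambda>s t. of_real (\<kappa> * x0 t - \<kappa> * x0 s) * (E t - E s))"
    by (rule negligible_product[OF V _ E]) (use dY in \<open>simp only: norm_of_real\<close>)
  then show "negligible T (\<lambda>s t. E t - E s - of_real \<kappa> * E s * (of_real (x0 t) - of_real (x0 s)))"
  proof (rule negligible_dominated)
    fix s t
    have "norm (E t - E s - of_real \<kappa> * E s * (of_real (x0 t) - of_real (x0 s)))
        = norm (complex_of_real (exp (\<kappa> * x0 t) - exp (\<kappa> * x0 s) - exp (\<kappa> * x0 s) * (\<kappa> * x0 t - \<kappa> * x0 s)))"
      unfolding E_def by (rule arg_cong[of _ _ norm]) (simp add: algebra_simps)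
    also have "\<dots> \<le> \<bar>(exp (\<kappa> * x0 t) - exp (\<kappa> * x0 s)) * (\<kappa> * x0 t - \<kappa> * x0 s)\<bar>"
      using exp_increment_bounds[of "\<kappa> * x0 t" "\<kappa> * x0 s"] unfolding norm_of_real by linarith
    also have "\<dots> = norm (of_real (\<kappa> * x0 t - \<kappa> * x0 s) * (E t - E s))"
      unfolding E_def norm_mult of_real_diff[symmetric] norm_of_real abs_mult by (rule mult.commute)
    finally show "norm (E t - E s - of_real \<kappa> * E s * (of_real (x0 t) - of_real (x0 s)))
        \<le> norm (of_real (\<kappa> * x0 t - \<kappa> * x0 s) * (E t - E s))" .
  qed
  assume \<Phi>: "continuous_on {0..T} \<Phi>"
  obtain C where C: "C > 0" "\<And>u. u \<in> {0..T} \<Longrightarrow> norm (E u) \<le> C"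
    by (rule continuous_bounded_on_Icc[OF E]) blast
  show "negligible T (\<lambda>s t. (E t - E s) * (\<Phi> t - \<Phi> s))"
  proof (rule negligible_product[OF _ _ \<Phi>, of "\<lambda>s. C * V s"])
    show "mono_on {0..T} (\<lambda>s. C * V s)"
      using C(1) by (intro mono_onI mult_left_mono mono_onD[OF V]) auto
    fix s t assume st: "0 \<le> s" "s \<le> t" "t \<le> T"
    define u v where "u = \<kappa> * x0 s" and "v = \<kappa> * x0 t"
    have e: "exp u \<le> C" "exp v \<le> C" using C(2)[of s] C(2)[of t] st by (auto simp: E_def u_def v_def)
    have "\<bar>exp v - exp u\<bar> \<le> C * \<bar>v - u\<bar>"
    proof (cases "u \<le> v")
      case True
      then have "\<bar>exp v - exp u\<bar> \<le> exp v * (v - u)"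
        using exp_increment_bounds[of v u] by (simp add: algebra_simps)
      also have "\<dots> \<le> C * \<bar>v - u\<bar>" using True e C(1) by (intro mult_mono) auto
      finally show ?thesis .
    next
      case False
      then have "\<bar>exp v - exp u\<bar> \<le> exp u * (u - v)"
        using exp_increment_bounds[of u v] by (simp add: algebra_simps)
      also have "\<dots> \<le> C * \<bar>v - u\<bar>" using False e C(1) by (intro mult_mono) auto
      finally show ?thesis .
    qed
    also have "\<dots> \<le> C * (V t - V s)"
      unfolding u_def v_def using C(1) by (intro mult_left_mono dY st) auto
    finally show "norm (E t - E s) \<le> C * V t - C * V s"
      unfolding E_def of_real_diff[symmetric] norm_of_real by (simp add: u_def v_def right_diff_distrib)
  qed
qed

text \<open>
  The product rule: if \<open>d\<Phi> = B\<close>, then \<open>d(E \<Phi>) = \<kappa> E \<Phi> dx\<^sub>0 + E B\<close>.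
\<close>

lemma negligible_integrating_factor:
  fixes x0 :: "real \<Rightarrow> real" and \<kappa> :: real
  assumes y: "stieltjes_driver T (\<lambda>s. of_real (x0 s))" and \<Phi>: "continuous_on {0..T} \<Phi>"
    and B: "negligible T (\<lambda>s t. \<Phi> t - \<Phi> s - B s t)"
  defines "E \<equiv> \<lambda>t. complex_of_real (exp (\<kappa> * x0 t))"
  shows "negligible T (\<lambda>s t. E t * \<Phi> t - E s * \<Phi> s
           - (of_real \<kappa> * (E s * \<Phi> s) * (of_real (x0 t) - of_real (x0 s)) + E s * B s t))"
proof -
  note C = negligible_exp_chain_rule[OF y, where \<kappa> = \<kappa>]
  show ?thesis
    unfolding E_def
    by (rule negligible_cong[OF negligible_add[OF negligible_add[OF negligible_mult[OF B C(1)]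
          negligible_mult[OF C(2) \<Phi>]] C(3)[OF \<Phi>]]])
      (simp add: algebra_simps)
qed

text \<open>
  The integral equations are equivalent to initial values and increments, which is the form to
  which integrating factors apply.
\<close>

lemma coefficient_equation_germ:
  assumes T: "0 \<le> T" and x: "driving_functions T x0 x" and c: "\<And>k. continuous_on {0..T} (c k)"
  defines "y \<equiv> driver x0 x"
  shows "coefficient_equation T x0 x c \<longleftrightarrow>
    (\<forall>m. c m 0 = of_bool (m = 1) \<and>
       negligible T (\<lambda>s t. c m t - c m s - (\<Sum>k\<le>m. of_nat k * c k s * (y (m - k) t - y (m - k) s))))"
proof -
  have D: "stieltjes_driver T (y n)" for n unfolding y_def by (rule stieltjes_driver_of_driver[OF T x])
  define R where "R m t = (\<Sum>k\<le>m. of_nat k * cintegral T (y (m - k)) {0..t} (c k))" for m t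
  have R0: "R m 0 = 0" for m by (simp add: R_def cintegral_0[OF D])
  have R: "negligible T (\<lambda>s t. R m t - R m s - (\<Sum>k\<le>m. of_nat k * c k s * (y (m - k) t - y (m - k) s)))" for m
  proof (rule negligible_cong)
    show "negligible T (\<lambda>s t. \<Sum>k\<le>m. of_nat k * (cintegral T (y (m - k)) {0..t} (c k)
        - cintegral T (y (m - k)) {0..s} (c k) - c k s * (y (m - k) t - y (m - k) s)))"
      by (intro negligible_sum negligible_cmult cintegral_primitive D c)
  qed (simp add: R_def sum_subtractf right_diff_distrib mult.assoc)
  show ?thesis
  proof (intro iffI allI conjI)
    fix m assume eq: "coefficient_equation T x0 x c"
    then have eq': "c m t = of_bool (m = 1) + R m t" if "t \<in> {0..T}" for t
      using that by (simp only: coefficient_equation_def R_def y_def)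
    show "c m 0 = of_bool (m = 1)" using eq'[of 0] T by (simp add: R0)
    show "negligible T (\<lambda>s t. c m t - c m s - (\<Sum>k\<le>m. of_nat k * c k s * (y (m - k) t - y (m - k) s)))"
      by (rule negligible_cong[OF R]) (simp add: eq')
  next
    assume N: "\<forall>m. c m 0 = of_bool (m = 1) \<and>
       negligible T (\<lambda>s t. c m t - c m s - (\<Sum>k\<le>m. of_nat k * c k s * (y (m - k) t - y (m - k) s)))"
    have "c m t = of_bool (m = 1) + R m t" if t: "t \<in> {0..T}" for m t
    proof -
      have "negligible T (\<lambda>s t. (c m t - R m t) - (c m s - R m s))"
        by (rule negligible_cong[OF negligible_diff[OF conjunct2[OF spec[OF N, of m]] R[of m]]]) simp
      from negligible_increments_imp_constant[OF this t] N show ?thesis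
        by (simp add: R0 algebra_simps)
    qed
    then show "coefficient_equation T x0 x c"
      by (simp add: coefficient_equation_def R_def y_def)
  qed
qed

text \<open>
  Once the lower coefficients agree, the difference \<open>h\<close> of the \<open>m\<close>-th ones satisfies
  \<open>dh = m h dx\<^sub>0\<close> with \<open>h(0) = 0\<close>; hence \<open>exp(- m x\<^sub>0) h\<close> is constant.
\<close>

lemma coefficient_equation_unique:
  assumes T: "0 \<le> T" and x: "driving_functions T x0 x"
    and c: "\<And>k. continuous_on {0..T} (c k)" "coefficient_equation T x0 x c"
    and d: "\<And>k. continuous_on {0..T} (d k)" "coefficient_equation T x0 x d"
    and t: "t \<in> {0..T}"
  shows "c m t = d m t"
  using t
proof (induction m arbitrary: t rule: less_induct)
  case (less m)
  define y where "y = driver x0 x"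
  have y0: "y 0 = (\<lambda>s. of_real (x0 s))" by (simp add: y_def driver_def)
  have D: "stieltjes_driver T (\<lambda>s. of_real (x0 s))"
    using stieltjes_driver_of_driver[OF T x, of 0] by (simp add: driver_def)
  note C = spec[OF iffD1[OF coefficient_equation_germ[OF T x c(1)] c(2)], of m, folded y_def]
  note C' = spec[OF iffD1[OF coefficient_equation_germ[OF T x d(1)] d(2)], of m, folded y_def]
  define h where "h t = c m t - d m t" for t
  have h: "continuous_on {0..T} h" unfolding h_def by (intro continuous_intros c d)
  have "negligible T (\<lambda>s t. h t - h s - of_nat m * h s * (of_real (x0 t) - of_real (x0 s)))"
  proof (rule negligible_cong[OF negligible_diff[OF conjunct2[OF C] conjunct2[OF C']]])
    fix s t assume st: "0 \<le> s" "s \<le> t" "t \<le> T"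
    have sm: "(\<Sum>k\<le>m. u k) = (\<Sum>k<m. u k) + u m" for u :: "nat \<Rightarrow> complex"
      by (simp flip: lessThan_Suc_atMost)
    have "(\<Sum>k<m. of_nat k * c k s * (y (m - k) t - y (m - k) s))
        = (\<Sum>k<m. of_nat k * d k s * (y (m - k) t - y (m - k) s))"
      using st by (intro sum.cong) (auto simp: less.IH)
    then show "c m t - c m s - (\<Sum>k\<le>m. of_nat k * c k s * (y (m - k) t - y (m - k) s))
        - (d m t - d m s - (\<Sum>k\<le>m. of_nat k * d k s * (y (m - k) t - y (m - k) s)))
      = h t - h s - of_nat m * h s * (of_real (x0 t) - of_real (x0 s))"
      by (simp add: sm h_def y0 algebra_simps)
  qed
  from negligible_integrating_factor[OF D h this, where \<kappa> = "- real m"]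
  have "negligible T (\<lambda>s t. of_real (exp (- real m * x0 t)) * h t - of_real (exp (- real m * x0 s)) * h s)"
    by (rule negligible_cong) (simp add: algebra_simps)
  from negligible_increments_imp_constant[OF this less.prems] C C'
  show ?case by (simp add: h_def)
qed

section \<open>Sums over compositions and existence of the coefficients\<close>

definition compositions :: "nat \<Rightarrow> nat list set" where
  "compositions m = {l. sum_list l = m \<and> (\<forall>i\<in>set l. 1 \<le> i)}"

text \<open>
  For the list \<open>[i\<^sub>p, \<dots>, i\<^sub>1]\<close> this is \<open>\<Prod>\<^sub>j (1 + i\<^sub>1 + \<dots> + i\<^sub>j\<^sub>-\<^sub>1)\<close>: the operator \<open>z d/dz\<close> contributes
  the current exponent each time a driver raises it by \<open>i\<^sub>j\<close>, starting from the exponent 1 of \<open>z\<close>.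
\<close>

primrec weight :: "nat list \<Rightarrow> nat" where
  "weight [] = 1"
| "weight (i # l) = Suc (sum_list l) * weight l"

lemma compositions_0: "compositions 0 = {[]}"
proof -
  have "l = []" if "sum_list l = 0" "\<forall>i\<in>set l. 1 \<le> i" for l :: "nat list"
    using that by (cases l) auto
  then show ?thesis by (auto simp: compositions_def)
qed

text \<open>
  The head of a composition of \<open>m\<close> is determined by the sum \<open>k\<close> of its tail.
\<close>

lemma compositions_rec:
  assumes "m > 0"
  shows "compositions m = (\<Union>k<m. (\<lambda>l. (m - k) # l) ` compositions k)"
proof (intro equalityI subsetI)
  fix l assume l: "l \<in> compositions m"
  with assms obtain i l' where "l = i # l'" by (cases l) (auto simp: compositions_def)
  with l have "l = (m - sum_list l') # l'" "l' \<in> compositions (sum_list l')" "sum_list l' < m"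
    by (auto simp: compositions_def)
  then show "l \<in> (\<Union>k<m. (\<lambda>l. (m - k) # l) ` compositions k)" by blast
qed (auto simp: compositions_def)

lemma finite_compositions: "finite (compositions m)"
proof (induction m rule: less_induct)
  case (less m)
  then show ?case by (cases "m = 0") (auto simp: compositions_0 compositions_rec)
qed

lemma sum_compositions_rec:
  fixes \<phi> :: "nat list \<Rightarrow> 'a::comm_monoid_add"
  assumes "m > 0"
  shows "(\<Sum>l\<in>compositions m. \<phi> l) = (\<Sum>k<m. \<Sum>l\<in>compositions k. \<phi> ((m - k) # l))"
proof -
  have "(\<Sum>l\<in>compositions m. \<phi> l) = (\<Sum>k<m. \<Sum>l\<in>(\<lambda>l. (m - k) # l) ` compositions k. \<phi> l)"
    unfolding compositions_rec[OF assms]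
    by (rule sum.UNION_disjoint) (auto simp: finite_compositions)
  also have "\<dots> = (\<Sum>k<m. \<Sum>l\<in>compositions k. \<phi> ((m - k) # l))"
    by (simp add: sum.reindex)
  finally show ?thesis .
qed

lemma sum_weight_rec:
  "m > 0 \<Longrightarrow> (\<Sum>l\<in>compositions m. weight l) = (\<Sum>k<m. Suc k * (\<Sum>l\<in>compositions k. weight l))"
  unfolding sum_compositions_rec sum_distrib_left
  by (intro sum.cong refl) (auto simp: compositions_def)

text \<open>
  By the recursion for \<open>W\<^sub>m\<close>, \<open>W\<^sub>m\<^sub>+\<^sub>1 = W\<^sub>m + (m+1) W\<^sub>m = (m+2) W\<^sub>m\<close> for \<open>m \<ge> 1\<close>, and \<open>W\<^sub>1 = 1\<close>.
\<close>

lemma sum_weight: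
  assumes "m > 0"
  shows "2 * (\<Sum>l\<in>compositions m. weight l) = fact (Suc m)"
  using assms
proof (induction m rule: nat_induct_non_zero)
  case 1
  show ?case by (simp add: sum_weight_rec compositions_0)
next
  case (Suc m)
  have "2 * (\<Sum>l\<in>compositions (Suc m). weight l) = Suc (Suc m) * (2 * (\<Sum>l\<in>compositions m. weight l))"
    using Suc.hyps by (simp add: sum_weight_rec[of "Suc m"] sum_weight_rec[of m])
  then show ?case using Suc.IH by simp
qed

text \<open>
  One induction provides continuity, the passage from \<open>[0,t)\<close> to \<open>[0,t]\<close>, and the increments
  \<open>dS\<^sub>i\<^sub>#\<^sub>l = S\<^sub>l exp(- i x\<^sub>0) dx\<^sub>i\<close>; each step integrates the continuous function obtained in the previous
  one.
\<close>

lemma simplex_integral_properties: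
  assumes T: "0 \<le> T" and x: "driving_functions T x0 x" and l: "\<forall>i\<in>set l. 1 \<le> i"
  defines "S \<equiv> \<lambda>l t. simplex_integral T x0 x l {0..t}"
  shows "continuous_on {0..T} (S l) \<and>
    (\<forall>t\<in>{0..T}. simplex_integral T x0 x l {0..<t} = S l t) \<and>
    (\<forall>i l'. l = i # l' \<longrightarrow>
       negligible T (\<lambda>s t. S l t - S l s - S l' s * of_real (exp (- real i * x0 s)) * (x i t - x i s)))"
  using l
proof (induction l)
  case (Cons j l)
  let ?g = "\<lambda>u. S l u * complex_of_real (exp (- real j * x0 u))"
  have IH: "continuous_on {0..T} (S l)" "\<And>t. t \<in> {0..T} \<Longrightarrow> simplex_integral T x0 x l {0..<t} = S l t"
    using Cons by auto
  have x0: "continuous_on {0..T} x0" using x by (simp add: driving_functions_def)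
  have g: "continuous_on {0..T} ?g" by (intro continuous_intros x0 IH(1))
  have D: "stieltjes_driver T (x j)"
    using stieltjes_driver_of_driver[OF T x, of j] Cons.prems by (auto simp: driver_def split: if_splits)
  have eq: "S (j # l) t = cintegral T (x j) {0..t} ?g" if "t \<in> {0..T}" for t
    unfolding S_def simplex_integral.simps
    by (rule cintegral_cong) (use that IH(2) in \<open>auto simp: S_def\<close>)
  have "continuous_on {0..T} (S (j # l))"
    by (rule continuous_on_eq[OF continuous_on_cintegral[OF D g]]) (simp only: eq)
  moreover have "simplex_integral T x0 x (j # l) {0..<t} = S (j # l) t" if "t \<in> {0..T}" for t
    unfolding S_def simplex_integral.simps
    by (rule cintegral_atomless[of _ _ _ _ t]) (use D that in \<open>auto simp: stieltjes_driver_def\<close>)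
  moreover have "negligible T (\<lambda>s t. S (j # l) t - S (j # l) s
      - S l s * of_real (exp (- real j * x0 s)) * (x j t - x j s))"
    by (rule negligible_cong[OF cintegral_primitive[OF D g]]) (simp add: eq)
  ultimately show ?case by blast
qed (simp add: S_def)

text \<open>
  The solution of the coefficient equations by iterated integration; for the index \<open>m + 1\<close> the
  compositions of \<open>m\<close> record how the drivers raise the exponent from 1 to \<open>m + 1\<close>.
\<close>

definition LK_coefficient ::
  "real \<Rightarrow> (real \<Rightarrow> real) \<Rightarrow> (nat \<Rightarrow> real \<Rightarrow> complex) \<Rightarrow> nat \<Rightarrow> real \<Rightarrow> complex" where
  "LK_coefficient T x0 x k t = (case k of 0 \<Rightarrow> 0 | Suc m \<Rightarrow>
     of_real (exp (real (Suc m) * x0 t)) *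
       (\<Sum>l\<in>compositions m. of_nat (weight l) * simplex_integral T x0 x l {0..t}))"

lemma LK_coefficient_continuous:
  assumes T: "0 \<le> T" and x: "driving_functions T x0 x"
  shows "continuous_on {0..T} (LK_coefficient T x0 x k)"
proof (cases k)
  case (Suc m)
  have x0: "continuous_on {0..T} x0" using x by (simp add: driving_functions_def)
  have "continuous_on {0..T} (\<lambda>t. simplex_integral T x0 x l {0..t})" if "l \<in> compositions m" for l
    using that simplex_integral_properties[OF T x, of l] by (auto simp: compositions_def)
  then show ?thesis
    unfolding Suc LK_coefficient_def[abs_def] nat.case by (intro continuous_intros x0)
qed (simp add: LK_coefficient_def[abs_def])

text \<open>
  Without the exponential factor, the sums \<open>a\<^sub>m\<close> over compositions satisfy
  \<open>da\<^sub>m = \<Sum>\<^sub>k\<^sub><\<^sub>m (k+1) a\<^sub>k exp(- (m-k) x\<^sub>0) dx\<^sub>m\<^sub>-\<^sub>k\<close>, since a composition of \<open>m\<close> with tail \<open>l\<close> of sum \<open>k\<close> has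
  weight \<open>(k+1) w(l)\<close>.  The integrating factor \<open>exp((m+1) x\<^sub>0)\<close> turns this into the
  coefficient equation with index \<open>m + 1\<close> and supplies its diagonal term.
\<close>

lemma LK_coefficient_equation:
  assumes T: "0 \<le> T" and x: "driving_functions T x0 x"
  shows "coefficient_equation T x0 x (LK_coefficient T x0 x)"
  unfolding coefficient_equation_germ[OF T x LK_coefficient_continuous[OF T x]]
proof (intro allI conjI)
  fix k
  define S where "S l t = simplex_integral T x0 x l {0..t}" for l t
  define a where "a m t = (\<Sum>l\<in>compositions m. of_nat (weight l) * S l t)" for m t
  define y where "y = driver x0 x"
  have x00: "x0 0 = 0" using x by (simp add: driving_functions_def)
  have D: "stieltjes_driver T (y n)" for n unfolding y_def by (rule stieltjes_driver_of_driver[OF T x])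
  have D0: "stieltjes_driver T (\<lambda>s. of_real (x0 s))" using D[of 0] by (simp add: y_def driver_def)
  have pos: "\<forall>i\<in>set l. 1 \<le> i" if "l \<in> compositions m" for l m using that by (simp add: compositions_def)
  have c0: "LK_coefficient T x0 x 0 = (\<lambda>t. 0)"
    and cS: "LK_coefficient T x0 x (Suc m) = (\<lambda>t. of_real (exp (real (Suc m) * x0 t)) * a m t)" for m
    by (simp_all add: fun_eq_iff LK_coefficient_def a_def S_def)
  have S0: "S (i # l) 0 = 0" if "1 \<le> i" for i l
    using D[of i] that by (simp add: S_def y_def driver_def cintegral_0)
  have a0: "a 0 = (\<lambda>t. 1)" by (simp add: a_def fun_eq_iff compositions_0 S_def)
  have am0: "a m 0 = 0" if "m > 0" for m
    unfolding a_def sum_compositions_rec[OF that] by (simp add: S0)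
  show "LK_coefficient T x0 x k 0 = of_bool (k = 1)"
    by (cases k) (auto simp: c0 cS x00 a0 am0)
  have a: "continuous_on {0..T} (a m)" for m
    unfolding a_def S_def
    by (intro continuous_intros conjunct1[OF simplex_integral_properties[OF T x pos]])
  have da: "negligible T (\<lambda>s t. a m t - a m s - (\<Sum>k<m. of_nat (Suc k) * a k s * of_real (exp (- real (m - k) * x0 s))
      * (y (m - k) t - y (m - k) s)))" for m
  proof (cases "m = 0")
    case True
    then show ?thesis by (simp add: a0 negligible_0)
  next
    case False
    define N where "N k l s t = S ((m - k) # l) t - S ((m - k) # l) s
      - S l s * of_real (exp (- real (m - k) * x0 s)) * (y (m - k) t - y (m - k) s)" for k l s t
    have N: "negligible T (N k l)" if "k < m" "l \<in> compositions k" for k l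
    proof -
      have "\<forall>i\<in>set ((m - k) # l). 1 \<le> i" using that by (auto simp: compositions_def)
      with simplex_integral_properties[OF T x, of "(m - k) # l"]
      have "negligible T (\<lambda>s t. simplex_integral T x0 x ((m - k) # l) {0..t} - simplex_integral T x0 x ((m - k) # l) {0..s}
          - simplex_integral T x0 x l {0..s} * of_real (exp (- real (m - k) * x0 s)) * (x (m - k) t - x (m - k) s))"
        by blast
      then show ?thesis
        using that(1) by (simp only: N_def[abs_def] S_def y_def driver_def) simp
    qed
    have "negligible T (\<lambda>s t. \<Sum>k<m. \<Sum>l\<in>compositions k. of_nat (weight ((m - k) # l)) * N k l s t)"
      by (intro negligible_sum negligible_cmult N) auto
    then show ?thesis
    proof (rule negligible_cong)
      fix s t
      have "(\<Sum>l\<in>compositions k. of_nat (weight ((m - k) # l)) * N k l s t)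
          = (\<Sum>l\<in>compositions k. of_nat (weight ((m - k) # l)) * S ((m - k) # l) t)
            - (\<Sum>l\<in>compositions k. of_nat (weight ((m - k) # l)) * S ((m - k) # l) s)
            - of_nat (Suc k) * a k s * of_real (exp (- real (m - k) * x0 s)) * (y (m - k) t - y (m - k) s)" for k
      proof -
        have "of_nat (Suc k) * a k s * of_real (exp (- real (m - k) * x0 s)) * (y (m - k) t - y (m - k) s)
          = (\<Sum>l\<in>compositions k. of_nat (weight ((m - k) # l)) *
              (S l s * of_real (exp (- real (m - k) * x0 s)) * (y (m - k) t - y (m - k) s)))"
          unfolding a_def sum_distrib_left sum_distrib_right
          by (rule sum.cong) (auto simp: compositions_def distrib_right)
        then show ?thesis
          unfolding N_def right_diff_distrib sum_subtractf by (simp only:)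
      qed
      then show "(\<Sum>k<m. \<Sum>l\<in>compositions k. of_nat (weight ((m - k) # l)) * N k l s t)
          = a m t - a m s - (\<Sum>k<m. of_nat (Suc k) * a k s * of_real (exp (- real (m - k) * x0 s))
      * (y (m - k) t - y (m - k) s))"
        using False by (simp only: sum_subtractf a_def[of m] sum_compositions_rec neq0_conv)
    qed
  qed
  show "negligible T (\<lambda>s t. LK_coefficient T x0 x k t - LK_coefficient T x0 x k s
      - (\<Sum>i\<le>k. of_nat i * LK_coefficient T x0 x i s * (driver x0 x (k - i) t - driver x0 x (k - i) s)))"
  proof (cases k)
    case 0
    then show ?thesis by (simp add: c0 negligible_0)
  next
    case (Suc m)
    let ?E = "\<lambda>t. complex_of_real (exp (real (Suc m) * x0 t))"
    have E: "?E s * of_real (exp (- real (m - j) * x0 s)) = of_real (exp (real (Suc j) * x0 s))" if "j < m" for j s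
      using that by (simp add: of_nat_diff algebra_simps flip: of_real_mult exp_add)
    show ?thesis
    proof (rule negligible_cong[OF negligible_integrating_factor[OF D0 a da, where \<kappa> = "real (Suc m)"]])
      fix s t
      have "(\<Sum>i\<le>k. of_nat i * LK_coefficient T x0 x i s * (y (k - i) t - y (k - i) s))
          = (\<Sum>j\<le>m. of_nat (Suc j) * LK_coefficient T x0 x (Suc j) s * (y (m - j) t - y (m - j) s))"
        unfolding Suc sum.atMost_Suc_shift by simp
      also have "\<dots> = (\<Sum>j<m. of_nat (Suc j) * LK_coefficient T x0 x (Suc j) s * (y (m - j) t - y (m - j) s))
          + of_nat (Suc m) * (?E s * a m s) * (of_real (x0 t) - of_real (x0 s))"
        unfolding lessThan_Suc_atMost[symmetric] sum.lessThan_Suc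
        by (simp add: cS y_def driver_def)
      also have "(\<Sum>j<m. of_nat (Suc j) * LK_coefficient T x0 x (Suc j) s * (y (m - j) t - y (m - j) s))
          = ?E s * (\<Sum>j<m. of_nat (Suc j) * a j s * of_real (exp (- real (m - j) * x0 s)) * (y (m - j) t - y (m - j) s))"
        unfolding sum_distrib_left
      proof (rule sum.cong[OF refl])
        fix j assume "j \<in> {..<m}"
        then have "j < m" by simp
        have "of_nat (Suc j) * LK_coefficient T x0 x (Suc j) s * (y (m - j) t - y (m - j) s)
            = of_nat (Suc j) * ((?E s * of_real (exp (- real (m - j) * x0 s))) * a j s) * (y (m - j) t - y (m - j) s)"
          unfolding E[OF \<open>j < m\<close>] cS ..
        then show "of_nat (Suc j) * LK_coefficient T x0 x (Suc j) s * (y (m - j) t - y (m - j) s)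
            = ?E s * (of_nat (Suc j) * a j s * of_real (exp (- real (m - j) * x0 s)) * (y (m - j) t - y (m - j) s))"
          by (simp only: mult_ac)
      qed
      finally show "?E t * a m t - ?E s * a m s - (of_real (real (Suc m)) * (?E s * a m s) * (of_real (x0 t) - of_real (x0 s))
            + ?E s * (\<Sum>j<m. of_nat (Suc j) * a j s * of_real (exp (- real (m - j) * x0 s)) * (y (m - j) t - y (m - j) s)))
          = LK_coefficient T x0 x k t - LK_coefficient T x0 x k s
            - (\<Sum>i\<le>k. of_nat i * LK_coefficient T x0 x i s * (driver x0 x (k - i) t - driver x0 x (k - i) s))"
        unfolding y_def Suc cS by (simp add: algebra_simps)
    qed
  qed
qed

section \<open>Taylor coefficients of a solution\<close>

text \<open>
  Local uniform continuity in time makes \<open>(s,z) \<mapsto> f\<^sub>s(z)\<close> jointly continuous, and \<open>[0,T]\<close> times a closed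
  disc is compact.
\<close>

lemma LK_solution_jointly_bounded:
  assumes f: "LK_solution T x0 x f" and r: "r \<in> {0<..<1}"
  shows "\<exists>M. \<forall>s\<in>{0..T}. \<forall>z\<in>cball 0 r. norm (f s z) \<le> M"
proof -
  have hol: "f s holomorphic_on ball 0 1" if "s \<in> {0..T}" for s using f that by (simp add: LK_solution_def)
  have K: "compact (cball 0 r :: complex set)" "(cball 0 r :: complex set) \<subseteq> ball 0 1" using r by auto
  have "continuous_on ({0..T} \<times> cball 0 r) (\<lambda>(s, z). f s z)"
    unfolding continuous_on_iff
  proof (intro ballI allI impI)
    fix p :: "real \<times> complex" and e :: real assume p: "p \<in> {0..T} \<times> cball 0 r" and e: "e > 0"
    obtain t z where tz: "p = (t, z)" "t \<in> {0..T}" "z \<in> cball 0 r" using p by blast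
    have "uniform_limit (cball 0 r) f (f t) (at t within {0..T})"
      using f K tz(2) unfolding LK_solution_def by blast
    from uniform_limitD[OF this, of "e / 2"] e
    have "\<forall>\<^sub>F s in at t within {0..T}. \<forall>w\<in>cball 0 r. dist (f s w) (f t w) < e / 2" by simp
    then obtain d1 where d1: "d1 > 0" "\<And>s. s \<in> {0..T} \<Longrightarrow> s \<noteq> t \<Longrightarrow> dist s t < d1 \<Longrightarrow>
        \<forall>w\<in>cball 0 r. dist (f s w) (f t w) < e / 2"
      unfolding eventually_at by auto
    have d1': "dist (f s w) (f t w) < e / 2" if "s \<in> {0..T}" "dist s t < d1" "w \<in> cball 0 r" for s w
      using d1(2)[of s] that e by (cases "s = t") auto
    have "continuous_on (cball 0 r) (f t)"
      using hol[OF tz(2)] K(2) by (meson continuous_on_subset holomorphic_on_imp_continuous_on)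
    then obtain d2 where d2: "d2 > 0" "\<And>w. w \<in> cball 0 r \<Longrightarrow> dist w z < d2 \<Longrightarrow> dist (f t w) (f t z) < e / 2"
      using tz(3) e unfolding continuous_on_iff by (metis half_gt_zero)
    have "dist (f s w) (f t z) < e" if "s \<in> {0..T}" "w \<in> cball 0 r" "dist (s, w) (t, z) < min d1 d2" for s w
    proof -
      have "dist s t \<le> dist (s, w) (t, z)" "dist w z \<le> dist (s, w) (t, z)"
        by (simp_all add: dist_Pair_Pair)
      then show ?thesis
        using d1'[OF that(1) _ that(2)] d2(2)[OF that(2)] that(3) dist_triangle[of "f s w" "f t z" "f t w"]
        by simp
    qed
    then show "\<exists>d>0. \<forall>q\<in>{0..T} \<times> cball 0 r. dist q p < d \<longrightarrow>
        dist (case q of (s, z) \<Rightarrow> f s z) (case p of (s, z) \<Rightarrow> f s z) < e"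
      using d1(1) d2(1) tz(1) by (intro exI[of _ "min d1 d2"]) auto
  qed
  then have "bounded ((\<lambda>(s, z). f s z) ` ({0..T} \<times> cball 0 r))"
    by (intro compact_imp_bounded compact_continuous_image compact_Times) auto
  then obtain M where "\<forall>v\<in>(\<lambda>(s, z). f s z) ` ({0..T} \<times> cball 0 r). norm v \<le> M"
    unfolding bounded_iff by blast
  then show ?thesis by (intro exI[of _ M]) auto
qed

text \<open>
  Cauchy's inequality gives the time-uniform estimates and, applied to \<open>f\<^sub>s - f\<^sub>t\<close>, the continuity
  of each coefficient.
\<close>

lemma LK_solution_taylor:
  assumes T: "0 \<le> T" and x: "driving_functions T x0 x" and f: "LK_solution T x0 x f"
  defines "c \<equiv> \<lambda>k t. (deriv ^^ k) (f t) 0 / fact k"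
  shows "coefficient_family T c" "coefficient_equation T x0 x c"
    and "s \<in> {0..T} \<Longrightarrow> z \<in> ball 0 1 \<Longrightarrow> (\<lambda>k. c k s * z ^ k) sums f s z"
proof -
  have hol: "f s holomorphic_on ball 0 1" if "s \<in> {0..T}" for s using f that by (simp add: LK_solution_def)
  show sums: "(\<lambda>k. c k s * z ^ k) sums f s z" if "s \<in> {0..T}" "z \<in> ball 0 1" for s z
    using holomorphic_power_series[OF hol[OF that(1)] that(2)] by (simp add: c_def)
  have bound: "norm ((deriv ^^ k) h 0 / fact k) * r ^ k \<le> M"
    if h: "h holomorphic_on ball 0 1" and r: "r \<in> {0<..<1}" and M: "\<And>z. z \<in> cball 0 r \<Longrightarrow> norm (h z) \<le> M"
    for h k r M
  proof -
    have sub: "ball 0 r \<subseteq> ball 0 (1::real)" "cball 0 r \<subseteq> ball (0::complex) 1" using r by auto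
    have "norm ((deriv ^^ k) h 0) \<le> fact k * M / r ^ k"
    proof (rule Cauchy_inequality)
      show "h holomorphic_on ball 0 r" using r by (intro holomorphic_on_subset[OF h]) auto
      show "continuous_on (cball 0 r) h"
        using holomorphic_on_imp_continuous_on[OF h] sub(2) by (rule continuous_on_subset)
      show "norm (h z) \<le> M" if "norm (0 - z) = r" for z using that by (intro M) simp
    qed (use r in auto)
    then show ?thesis using r by (simp add: norm_divide field_simps)
  qed
  have cont: "continuous_on {0..T} (c k)" for k
    unfolding continuous_on_def
  proof
    fix t assume t: "t \<in> {0..T}"
    show "(c k \<longlongrightarrow> c k t) (at t within {0..T})"
    proof (rule tendstoI)
      fix e :: real assume e: "e > 0"
      \<comment> \<open>Cauchy's inequality on the circle of radius \<open>1/2\<close> costs the factor \<open>2\<^sup>k\<close>.\<close>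
      define d where "d = e / 2 * (1 / 2) ^ k"
      have d: "d > 0" using e by (simp add: d_def)
      have "compact (cball 0 (1/2) :: complex set) \<and> (cball 0 (1/2) :: complex set) \<subseteq> ball 0 1" by auto
      then have "uniform_limit (cball 0 (1/2)) f (f t) (at t within {0..T})"
        using f t unfolding LK_solution_def by blast
      from uniform_limitD[OF this d]
      have "\<forall>\<^sub>F s in at t within {0..T}. \<forall>w\<in>cball 0 (1/2). dist (f s w) (f t w) < d" .
      moreover have "eventually (\<lambda>s. s \<in> {0..T}) (at t within {0..T})"
        by (simp add: eventually_at_filter)
      ultimately show "\<forall>\<^sub>F s in at t within {0..T}. dist (c k s) (c k t) < e"
      proof eventually_elim
        case (elim s)
        have "(deriv ^^ k) (\<lambda>w. f s w - f t w) 0 = (deriv ^^ k) (f s) 0 - (deriv ^^ k) (f t) 0"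
          by (rule higher_deriv_diff[OF hol[OF elim(2)] hol[OF t]]) auto
        then have "norm (c k s - c k t) * (1 / 2) ^ k \<le> d"
          using bound[of "\<lambda>w. f s w - f t w" "1 / 2" d k] elim(1) hol[OF elim(2)] hol[OF t]
          by (simp add: c_def dist_norm less_imp_le holomorphic_on_diff flip: diff_divide_distrib)
        then have "norm (c k s - c k t) \<le> e / 2" by (simp add: d_def)
        then show ?case using e by (simp add: dist_norm)
      qed
    qed
  qed
  have "\<exists>M. \<forall>k. \<forall>s\<in>{0..T}. norm (c k s) * r ^ k \<le> M" if r: "r \<in> {0<..<1}" for r
  proof -
    obtain M where "\<And>s z. s \<in> {0..T} \<Longrightarrow> z \<in> cball 0 r \<Longrightarrow> norm (f s z) \<le> M"
      using LK_solution_jointly_bounded[OF f r] by blast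
    then show ?thesis
      unfolding c_def by (intro exI[of _ M] allI ballI bound hol r) auto
  qed
  with cont show fam: "coefficient_family T c" by (simp add: coefficient_family_def)
  show "coefficient_equation T x0 x c"
    using LK_equation_iff_coefficient_equation[OF T x fam sums] f unfolding LK_solution_def by blast
qed

section \<open>A coefficient condition for starlikeness\<close>

text \<open>
  A perturbation \<open>g\<close> of the identity with Lipschitz constant \<open>\<kappa> < 1\<close> gives an injective map.  To hit
  \<open>l f(z)\<close>, one solves \<open>v = l (z + g(z)) - g(v)\<close> by Banach's fixed point theorem near \<open>l z\<close>: the
  radial hypothesis says how far the right-hand side moves the centre \<open>l z\<close>, and the remaining room
  \<open>\<kappa> (1-l)|z|\<close> is what the Lipschitz bound requires.
\<close>

lemma starlike_perturbation:
  fixes g :: "complex \<Rightarrow> complex"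
  assumes f: "\<And>z. z \<in> ball 0 1 \<Longrightarrow> f z = c * (z + g z)" and "c \<noteq> 0"
    and \<kappa>: "0 \<le> \<kappa>" "\<kappa> < 1"
    and lip: "\<And>z w. z \<in> ball 0 1 \<Longrightarrow> w \<in> ball 0 1 \<Longrightarrow> norm (g z - g w) \<le> \<kappa> * norm (z - w)"
    and radial: "\<And>z l. z \<in> ball 0 1 \<Longrightarrow> l \<in> {0..1::real} \<Longrightarrow>
        norm (of_real l * g z - g (of_real l * z)) \<le> (1 - \<kappa>) * ((1 - l) * norm z)"
  shows "inj_on f (ball 0 1)"
    and "w \<in> f ` ball 0 1 \<Longrightarrow> l \<in> {0..1} \<Longrightarrow> of_real l * w \<in> f ` ball 0 1"
proof -
  show "inj_on f (ball 0 1)"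
  proof (rule inj_onI)
    fix z w :: complex assume zw: "z \<in> ball 0 1" "w \<in> ball 0 1" "f z = f w"
    then have "c * (z + g z) = c * (w + g w)" by (simp add: f)
    then have "z + g z = w + g w" using \<open>c \<noteq> 0\<close> by simp
    then have "z - w = g w - g z" by (simp add: algebra_simps)
    then have "norm (z - w) = norm (g w - g z)" by (simp only:)
    also have "\<dots> \<le> \<kappa> * norm (z - w)"
      using lip[OF zw(2,1)] by (simp only: norm_minus_commute)
    finally have "norm (z - w) \<le> \<kappa> * norm (z - w)" .
    then have "(1 - \<kappa>) * norm (z - w) \<le> 0" by (simp add: algebra_simps)
    then show "z = w" using \<kappa> by (simp add: mult_le_0_iff)
  qed
  assume w: "w \<in> f ` ball 0 1" and l: "l \<in> {0..1}"
  then obtain z where z: "z \<in> ball 0 1" "w = f z" by blast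
  \<comment> \<open>This disc lies in the disc of radius \<open>|z|\<close> around the origin, hence in the unit disc.\<close>
  define S where "S = cball (of_real l * z) ((1 - l) * norm z)"
  have S_le: "norm v \<le> norm z" if "v \<in> S" for v
  proof -
    have "norm v \<le> norm (of_real l * z) + norm (v - of_real l * z)"
      using norm_triangle_ineq[of "of_real l * z" "v - of_real l * z"] by simp
    also have "\<dots> \<le> l * norm z + (1 - l) * norm z"
      using that l by (intro add_mono) (auto simp: S_def norm_mult dist_norm norm_minus_commute)
    finally show ?thesis by (simp add: algebra_simps)
  qed
  then have S: "v \<in> ball 0 1" if "v \<in> S" for v using S_le[OF that] z by simp
  define h where "h v = of_real l * (z + g z) - g v" for v
  have lz: "of_real l * z \<in> S" using l by (simp add: S_def)
  have "\<exists>!v\<in>S. h v = v"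
  proof (rule Banach_fix)
    show "complete S" "S \<noteq> {}" using lz by (auto simp: S_def complete_eq_closed)
    show "0 \<le> \<kappa>" "\<kappa> < 1" by fact+
    show "dist (h u) (h v) \<le> \<kappa> * dist u v" if "u \<in> S" "v \<in> S" for u v
      using lip[OF S[OF that(2)] S[OF that(1)]] by (simp add: h_def dist_norm norm_minus_commute)
    show "h ` S \<subseteq> S"
    proof
      fix y assume "y \<in> h ` S"
      then obtain v where v: "v \<in> S" "y = h v" by blast
      have "y - of_real l * z = (of_real l * g z - g (of_real l * z)) + (g (of_real l * z) - g v)"
        by (simp add: v h_def algebra_simps)
      then have "norm (y - of_real l * z) \<le> (1 - \<kappa>) * ((1 - l) * norm z) + \<kappa> * norm (of_real l * z - v)"
        using norm_triangle_le[OF add_mono[OF radial[OF z(1) l] lip[OF S[OF lz] S[OF v(1)]]]] by simp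
      also have "\<dots> \<le> (1 - \<kappa>) * ((1 - l) * norm z) + \<kappa> * ((1 - l) * norm z)"
        using v(1) \<kappa>(1) by (intro add_left_mono mult_left_mono) (auto simp: S_def dist_norm)
      finally show "y \<in> S" by (simp add: S_def dist_norm norm_minus_commute algebra_simps)
    qed
  qed
  then obtain v where v: "v \<in> S" "h v = v" by blast
  have "v + g v = of_real l * (z + g z)" using v(2) by (simp add: h_def algebra_simps)
  then have "f v = of_real l * w" using S[OF v(1)] z by (simp add: f)
  then show "of_real l * w \<in> f ` ball 0 1" using S[OF v(1)] by (metis imageI)
qed

text \<open>
  Bernoulli's inequality.
\<close>

lemma power_radial_defect:
  assumes "l \<in> {0..1::real}"
  shows "0 \<le> l - l ^ (n + 1)" "l - l ^ (n + 1) \<le> real n * (1 - l)"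
proof -
  have p: "l ^ (n + 1) \<le> l" using assms power_le_one[of l n] by (simp add: mult_left_le)
  then show "0 \<le> l - l ^ (n + 1)" by simp
  have "1 - real n * (1 - l) \<le> l ^ n"
    using Bernoulli_inequality[of "l - 1" n] assms by (simp add: algebra_simps)
  then have *: "1 - l ^ n \<le> real n * (1 - l)" by simp
  have "l - l ^ (n + 1) = l * (1 - l ^ n)" by (simp add: algebra_simps)
  also have "\<dots> \<le> 1 * (1 - l ^ n)"
    using assms power_le_one[of l n] by (intro mult_right_mono) auto
  also have "\<dots> \<le> real n * (1 - l)" using * by simp
  finally show "l - l ^ (n + 1) \<le> real n * (1 - l)" .
qed

text \<open>
  For \<open>g = \<Sum>\<^sub>n a\<^sub>n z\<^sup>n\<^sup>+\<^sup>2\<close> the Lipschitz constant is \<open>\<kappa> = \<Sum>\<^sub>n (n+2)|a\<^sub>n|\<close>, and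
  \<open>l z\<^sup>n\<^sup>+\<^sup>2 - (l z)\<^sup>n\<^sup>+\<^sup>2\<close> is at most \<open>(n+1)(1-l)|z|\<close> in modulus.  The hypothesis on
  \<open>2n + 3 = (n+2) + (n+1)\<close> is exactly what \<open>starlike_perturbation\<close> asks for, and it forces
  \<open>\<kappa> \<le> 2/3\<close>.
\<close>

lemma starlike_power_series:
  fixes a :: "nat \<Rightarrow> complex"
  assumes c: "c \<noteq> 0"
    and s: "summable (\<lambda>n. (2 * real n + 3) * norm (a n))" and le: "(\<Sum>n. (2 * real n + 3) * norm (a n)) \<le> 1"
    and f: "\<And>z. z \<in> ball 0 1 \<Longrightarrow> f z = c * (z + (\<Sum>n. a n * z ^ (n + 2)))"
  shows "inj_on f (ball 0 1)"
    and "w \<in> f ` ball 0 1 \<Longrightarrow> l \<in> {0..1} \<Longrightarrow> of_real l * w \<in> f ` ball 0 1"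
proof -
  define g where "g z = (\<Sum>n. a n * z ^ (n + 2))" for z :: complex
  have s1: "summable (\<lambda>n. (real n + 2) * norm (a n))" and s2: "summable (\<lambda>n. (real n + 1) * norm (a n))"
    by (rule summable_comparison_test[OF exI[of _ 0] s]; auto intro!: mult_right_mono)+
  define \<kappa> where "\<kappa> = (\<Sum>n. (real n + 2) * norm (a n))"
  have "0 \<le> \<kappa>" unfolding \<kappa>_def by (intro suminf_nonneg s1) auto
  have "\<kappa> \<le> (\<Sum>n. 2 / 3 * ((2 * real n + 3) * norm (a n)))"
    unfolding \<kappa>_def
    by (intro suminf_le s1 summable_mult s) (auto simp: algebra_simps mult_right_mono)
  also have "\<dots> = 2 / 3 * (\<Sum>n. (2 * real n + 3) * norm (a n))" by (rule suminf_mult[OF s])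
  also have "\<dots> \<le> 2 / 3" using le by simp
  finally have "\<kappa> < 1" by simp
  have "(\<Sum>n. (real n + 1) * norm (a n)) = (\<Sum>n. (2 * real n + 3) * norm (a n)) - \<kappa>"
    unfolding \<kappa>_def suminf_diff[OF s s1] by (simp add: algebra_simps)
  then have \<kappa>': "(\<Sum>n. (real n + 1) * norm (a n)) \<le> 1 - \<kappa>" using le by simp
  have sg: "summable (\<lambda>n. a n * z ^ (n + 2))" if "z \<in> ball 0 1" for z :: complex
  proof (rule summable_comparison_test[OF exI[of _ 0] s1], intro allI impI)
    fix n
    have "norm z ^ (n + 2) \<le> 1" using that by (intro power_le_one) auto
    then have "norm (a n) * norm z ^ (n + 2) \<le> norm (a n) * (real n + 2)"
      by (intro mult_left_mono) auto
    then show "norm (a n * z ^ (n + 2)) \<le> (real n + 2) * norm (a n)"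
      by (simp add: norm_mult norm_power mult.commute)
  qed
  have lip: "norm (g z - g w) \<le> \<kappa> * norm (z - w)" if "z \<in> ball 0 1" "w \<in> ball 0 1" for z w
  proof -
    have "g z - g w = (\<Sum>n. a n * z ^ (n + 2) - a n * w ^ (n + 2))"
      unfolding g_def by (rule suminf_diff[OF sg[OF that(1)] sg[OF that(2)]])
    also have "norm \<dots> \<le> (\<Sum>n. (real n + 2) * norm (a n) * norm (z - w))"
    proof (rule norm_suminf_le)
      fix n
      have "norm (z ^ (n + 2) - w ^ (n + 2)) \<le> real (n + 2) * norm (z - w)"
        using that by (intro norm_power_diff) auto
      from mult_left_mono[OF this norm_ge_zero[of "a n"]]
      have "norm (a n * (z ^ (n + 2) - w ^ (n + 2))) \<le> (real n + 2) * norm (a n) * norm (z - w)"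
        unfolding norm_mult by (simp only: of_nat_add of_nat_numeral mult_ac)
      then show "norm (a n * z ^ (n + 2) - a n * w ^ (n + 2)) \<le> (real n + 2) * norm (a n) * norm (z - w)"
        by (simp only: right_diff_distrib)
    qed (intro summable_mult2 s1)
    also have "\<dots> = \<kappa> * norm (z - w)" unfolding \<kappa>_def by (rule suminf_mult2[OF s1, symmetric])
    finally show ?thesis .
  qed
  have radial: "norm (of_real l * g z - g (of_real l * z)) \<le> (1 - \<kappa>) * ((1 - l) * norm z)"
    if z: "z \<in> ball 0 1" and l: "l \<in> {0..1::real}" for z l
  proof -
    have lz: "of_real l * z \<in> ball 0 1"
      using z l mult_left_le_one_le[of "norm z" l] by (auto simp: norm_mult)
    have "of_real l * g z - g (of_real l * z)
        = (\<Sum>n. of_real l * (a n * z ^ (n + 2)) - a n * (of_real l * z) ^ (n + 2))"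
      unfolding g_def suminf_mult[OF sg[OF z], symmetric]
      by (rule suminf_diff[OF summable_mult[OF sg[OF z]] sg[OF lz]])
    also have "norm \<dots> \<le> (\<Sum>n. (real n + 1) * norm (a n) * ((1 - l) * norm z))"
    proof (rule norm_suminf_le)
      fix n
      have d: "0 \<le> l - l ^ (n + 2)" "l - l ^ (n + 2) \<le> (real n + 1) * (1 - l)"
        using power_radial_defect[OF l, of "n + 1"] by (auto simp: add.commute)
      have "of_real l * (a n * z ^ (n + 2)) - a n * (of_real l * z) ^ (n + 2)
          = of_real (l - l ^ (n + 2)) * (a n * z ^ (n + 2))"
        by (simp add: power_mult_distrib algebra_simps)
      then have "norm (of_real l * (a n * z ^ (n + 2)) - a n * (of_real l * z) ^ (n + 2))
          = (l - l ^ (n + 2)) * (norm (a n) * norm z ^ (n + 2))"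
        using d(1) by (simp add: norm_mult norm_power del: of_real_diff)
      also have "\<dots> \<le> ((real n + 1) * (1 - l)) * (norm (a n) * norm z)"
      proof (intro mult_mono d)
        show "norm z ^ (n + 2) \<le> norm z" using z power_decreasing[of 1 "n + 2" "norm z"] by simp
      qed (use l d in auto)
      finally show "norm (of_real l * (a n * z ^ (n + 2)) - a n * (of_real l * z) ^ (n + 2))
          \<le> (real n + 1) * norm (a n) * ((1 - l) * norm z)" by (simp add: algebra_simps)
    qed (intro summable_mult2 s2)
    also have "\<dots> = (\<Sum>n. (real n + 1) * norm (a n)) * ((1 - l) * norm z)"
      by (rule suminf_mult2[OF s2, symmetric])
    also have "\<dots> \<le> (1 - \<kappa>) * ((1 - l) * norm z)"
      using l by (intro mult_right_mono \<kappa>') auto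
    finally show ?thesis .
  qed
  note P = starlike_perturbation[OF f[folded g_def] c \<open>0 \<le> \<kappa>\<close> \<open>\<kappa> < 1\<close> lip radial]
  show "inj_on f (ball 0 1)" by (rule P(1))
  show "w \<in> f ` ball 0 1 \<Longrightarrow> l \<in> {0..1} \<Longrightarrow> of_real l * w \<in> f ` ball 0 1" by (rule P(2))
qed

section \<open>The size of the coefficients\<close>

text \<open>
  The quartic is at least 2 on the negative axis, and it changes sign between \<open>0\<close> and \<open>3/10\<close>.
\<close>

lemma quartic_root_bounds:
  fixes \<alpha> :: real
  assumes "2 * \<alpha> ^ 4 - 8 * \<alpha> ^ 3 + 11 * \<alpha> ^ 2 - 10 * \<alpha> + 2 = 0"
    and "\<And>y::real. 2 * y ^ 4 - 8 * y ^ 3 + 11 * y ^ 2 - 10 * y + 2 = 0 \<Longrightarrow> \<alpha> \<le> y"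
  shows "0 < \<alpha>" "\<alpha> \<le> 3 / 10"
proof -
  define p :: "real \<Rightarrow> real" where "p y = 2 * y ^ 4 - 8 * y ^ 3 + 11 * y ^ 2 - 10 * y + 2" for y
  show "0 < \<alpha>"
  proof (rule ccontr)
    assume "\<not> 0 < \<alpha>"
    then have "0 \<le> 2 * \<alpha> ^ 4" "0 \<le> - 8 * \<alpha> ^ 3" "0 \<le> 11 * \<alpha> ^ 2" "0 \<le> - 10 * \<alpha>"
      by (auto simp: power_le_zero_eq)
    then show False using assms(1) by linarith
  qed
  have "\<exists>y. 0 \<le> y \<and> y \<le> 3 / 10 \<and> p y = 0"
    by (rule IVT2') (auto simp: p_def power_numeral_reduce intro!: continuous_intros)
  then show "\<alpha> \<le> 3 / 10" using assms(2) unfolding p_def by force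
qed

text \<open>
  Every iterated integral in the sum is at most \<open>\<omega>(0,T)\<^sup>m / m!\<close> after multiplication by \<open>exp(m x\<^sub>0)\<close>, where
  \<open>m = n + 1\<close>, and the weights add up to \<open>(m+1)!/2\<close>.
\<close>

lemma LK_coefficient_bound:
  assumes T: "0 \<le> T" and \<omega>: "control_function T \<omega>" and x: "controlled_by T x0 x \<omega>" and t: "t \<in> {0..T}"
  shows "norm (LK_coefficient T x0 x (n + 2) t) \<le> exp (x0 t) * ((real n + 2) / 2 * \<omega> 0 T ^ (n + 1))"
proof -
  define m where "m = n + 1"
  have "0 \<le> \<omega> 0 t" "0 \<le> \<omega> t T" "\<omega> 0 t + \<omega> t T \<le> \<omega> 0 T"
    using \<omega> t unfolding control_function_def by auto
  then have pow: "\<omega> 0 t ^ m \<le> \<omega> 0 T ^ m" by (intro power_mono) auto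
  have I: "exp (real m * x0 t) * norm (simplex_integral T x0 x l {0..t}) \<le> \<omega> 0 T ^ m / fact m"
    if l: "l \<in> compositions m" for l
  proof -
    have "rev l \<noteq> []" "\<forall>i\<in>set (rev l). 1 \<le> i" "sum_list (rev l) = m"
      using l by (auto simp: compositions_def m_def sum_list_rev)
    then have "norm (iterated_I T x0 x (rev l) t) \<le> \<omega> 0 t ^ m / fact m"
      using x[unfolded controlled_by_def, THEN spec, of m, THEN spec, of "rev l", THEN spec, of t, THEN spec, of t] t
      by simp
    also have "\<dots> \<le> \<omega> 0 T ^ m / fact m" using pow by (intro divide_right_mono) auto
    finally show ?thesis
      using \<open>sum_list (rev l) = m\<close> by (simp add: iterated_I_def norm_mult)
  qed
  have "real (2 * (\<Sum>l\<in>compositions m. weight l)) = real (fact (Suc m))"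
    by (subst sum_weight) (simp_all add: m_def)
  then have W: "(\<Sum>l\<in>compositions m. real (weight l)) = fact (Suc m) / 2"
    by (simp only: of_nat_mult of_nat_sum of_nat_fact of_nat_numeral)
  have e: "exp (real (Suc m) * x0 t) = exp (x0 t) * exp (real m * x0 t)"
    by (simp only: of_nat_Suc distrib_right mult_1 exp_add)
  have "n + 2 = Suc m" by (simp add: m_def)
  then have "norm (LK_coefficient T x0 x (n + 2) t)
      = exp (x0 t) * (exp (real m * x0 t) * norm (\<Sum>l\<in>compositions m. of_nat (weight l) * simplex_integral T x0 x l {0..t}))"
    by (simp only: LK_coefficient_def nat.case norm_mult norm_of_real abs_mult abs_exp_cancel e mult.assoc)
  also have "\<dots> \<le> exp (x0 t) * (exp (real m * x0 t) * (\<Sum>l\<in>compositions m. real (weight l) * norm (simplex_integral T x0 x l {0..t})))"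
    by (intro mult_left_mono sum_norm_le) (auto simp: norm_mult)
  also have "\<dots> = exp (x0 t) * (\<Sum>l\<in>compositions m. real (weight l) * (exp (real m * x0 t) * norm (simplex_integral T x0 x l {0..t})))"
    unfolding sum_distrib_left by (simp only: mult_ac)
  also have "\<dots> \<le> exp (x0 t) * (\<Sum>l\<in>compositions m. real (weight l) * (\<omega> 0 T ^ m / fact m))"
    by (intro mult_left_mono sum_mono I) auto
  also have "\<dots> = exp (x0 t) * ((real n + 2) / 2 * \<omega> 0 T ^ (n + 1))"
    unfolding sum_distrib_right[symmetric] W by (simp add: m_def)
  finally show ?thesis .
qed

text \<open>
  The quotient of consecutive terms on the left is decreasing in \<open>n\<close> and equals \<open>3/8\<close> at \<open>n = 0\<close>, where
  the term itself is \<open>9/20\<close>.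
\<close>

lemma weighted_coefficient_bound:
  "(2 * real n + 3) * ((real n + 2) / 2 * (3 / 20) ^ (n + 1)) \<le> 9 / 20 * (3 / 8) ^ n"
proof (induction n)
  case (Suc n)
  have "(2 * real (Suc n) + 3) * ((real (Suc n) + 2) / 2 * (3 / 20 * P))
      = (3 / 20 * (2 * real n + 5) * (real n + 3)) * (P / 2)" for P :: real
    by (simp add: field_simps)
  then have "(2 * real (Suc n) + 3) * ((real (Suc n) + 2) / 2 * (3 / 20) ^ (Suc n + 1))
      = (3 / 20 * (2 * real n + 5) * (real n + 3)) * ((3 / 20) ^ (n + 1) / 2)"
    by (simp only: add_Suc power_Suc)
  also have "\<dots> \<le> (3 / 8 * (2 * real n + 3) * (real n + 2)) * ((3 / 20) ^ (n + 1) / 2)"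
  proof (rule mult_right_mono)
    have "0 \<le> real n * real n" "0 \<le> real n" by simp_all
    then show "3 / 20 * (2 * real n + 5) * (real n + 3) \<le> 3 / 8 * (2 * real n + 3) * (real n + 2)"
      unfolding ring_distribs by linarith
  qed simp
  also have "\<dots> = 3 / 8 * ((2 * real n + 3) * ((real n + 2) / 2 * (3 / 20) ^ (n + 1)))"
    by simp
  also have "\<dots> \<le> 3 / 8 * (9 / 20 * (3 / 8) ^ n)" by (intro mult_left_mono Suc.IH) auto
  finally show ?case by simp
qed simp

lemma LK_coefficient_0: "LK_coefficient T x0 x 0 t = 0"
  and LK_coefficient_1: "LK_coefficient T x0 x (Suc 0) t = of_real (exp (x0 t))"
  by (simp_all add: LK_coefficient_def compositions_0)

lemma LK_coefficient_weighted_bound: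
  assumes T: "0 \<le> T" and \<omega>: "control_function T \<omega>" "\<omega> 0 T \<le> 3 / 20"
    and x: "controlled_by T x0 x \<omega>" and t: "t \<in> {0..T}"
  shows "(2 * real n + 3) * norm (LK_coefficient T x0 x (n + 2) t) \<le> exp (x0 t) * (9 / 20 * (3 / 8) ^ n)"
proof -
  have "0 \<le> \<omega> 0 T" using \<omega>(1) T by (simp add: control_function_def)
  then have pow: "\<omega> 0 T ^ (n + 1) \<le> (3 / 20) ^ (n + 1)" using \<omega>(2) by (intro power_mono)
  have "norm (LK_coefficient T x0 x (n + 2) t) \<le> exp (x0 t) * ((real n + 2) / 2 * \<omega> 0 T ^ (n + 1))"
    by (rule LK_coefficient_bound[OF T \<omega>(1) x t])
  also have "\<dots> \<le> exp (x0 t) * ((real n + 2) / 2 * (3 / 20) ^ (n + 1))"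
    by (intro mult_left_mono pow) auto
  finally have "(2 * real n + 3) * norm (LK_coefficient T x0 x (n + 2) t)
      \<le> (2 * real n + 3) * (exp (x0 t) * ((real n + 2) / 2 * (3 / 20) ^ (n + 1)))"
    by (rule mult_left_mono) simp
  also have "\<dots> = exp (x0 t) * ((2 * real n + 3) * ((real n + 2) / 2 * (3 / 20) ^ (n + 1)))"
    by (simp only: mult_ac)
  also have "\<dots> \<le> exp (x0 t) * (9 / 20 * (3 / 8) ^ n)"
    by (intro mult_left_mono weighted_coefficient_bound) auto
  finally show ?thesis .
qed

text \<open>
  A cruder bound that holds for all indices; its ratio \<open>3/8\<close> leaves a disc of radius \<open>8/3 > 2\<close> of
  convergence.
\<close>

lemma LK_coefficient_geometric_bound:
  assumes T: "0 \<le> T" and \<omega>: "control_function T \<omega>" "\<omega> 0 T \<le> 3 / 20"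
    and x: "controlled_by T x0 x \<omega>" and t: "t \<in> {0..T}"
  shows "norm (LK_coefficient T x0 x k t) \<le> 3 * exp (x0 t) * (3 / 8) ^ k"
proof -
  consider "k = 0" | "k = Suc 0" | n where "k = n + 2"
    by (metis One_nat_def add_2_eq_Suc' not0_implies_Suc)
  then show ?thesis
  proof cases
    case (3 n)
    have "3 * norm (LK_coefficient T x0 x (n + 2) t) \<le> (2 * real n + 3) * norm (LK_coefficient T x0 x (n + 2) t)"
      by (rule mult_right_mono) auto
    also have "\<dots> \<le> exp (x0 t) * (9 / 20 * (3 / 8) ^ n)"
      by (rule LK_coefficient_weighted_bound[OF T \<omega> x t])
    also have "\<dots> = 16 / 15 * (3 * exp (x0 t) * (3 / 8) ^ k)" by (simp add: 3 power_add power2_eq_square)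
    also have "\<dots> \<le> 3 * (3 * exp (x0 t) * (3 / 8) ^ k)" by (rule mult_right_mono) auto
    finally show ?thesis by (simp add: 3)
  qed (auto simp: LK_coefficient_0 LK_coefficient_1)
qed

lemma geometric_power_series_sums:
  fixes a :: "nat \<Rightarrow> complex"
  assumes a: "\<And>k. norm (a k) \<le> B * \<rho> ^ k" and "0 \<le> \<rho>" "\<rho> * norm z < 1"
  shows "(\<lambda>k. a k * z ^ k) sums (\<Sum>k. a k * z ^ k)"
proof (rule summable_sums, rule summable_comparison_test[OF exI[of _ 0]], intro allI impI)
  show "norm (a k * z ^ k) \<le> B * (\<rho> * norm z) ^ k" for k
    using mult_right_mono[OF a[of k], of "norm z ^ k"]
    by (simp add: norm_mult norm_power power_mult_distrib mult.assoc)
  show "summable (\<lambda>k. B * (\<rho> * norm z) ^ k)"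
    using assms by (intro summable_mult summable_geometric) auto
qed

text \<open>
  The geometric bounds on \<open>(2n+3)|a\<^sub>n|\<close> add up to \<open>(9/20) / (1 - 3/8) = 18/25 \<le> 1\<close>.
\<close>

lemma LK_series_starlike:
  assumes T: "0 \<le> T" and \<omega>: "control_function T \<omega>" "\<omega> 0 T \<le> 3 / 20"
    and x: "controlled_by T x0 x \<omega>" and t: "t \<in> {0..T}"
    and f: "\<And>z. z \<in> ball 0 1 \<Longrightarrow> (\<lambda>k. LK_coefficient T x0 x k t * z ^ k) sums f z"
  shows "univalent_on_disc f" "starlike_on_disc f"
proof -
  define c where "c k = LK_coefficient T x0 x k t" for k
  define a where "a n = c (n + 2) / of_real (exp (x0 t))" for n
  have wb: "(2 * real n + 3) * norm (a n) \<le> 9 / 20 * (3 / 8) ^ n" for n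
    using LK_coefficient_weighted_bound[OF T \<omega> x t, of n]
    by (simp add: a_def c_def norm_divide divide_le_eq mult.commute)
  have geo: "(\<lambda>n. 9 / 20 * (3 / 8) ^ n) sums (9 / 20 * (1 / (1 - 3 / 8 :: real)))"
    by (intro sums_mult geometric_sums) simp
  have s: "summable (\<lambda>n. (2 * real n + 3) * norm (a n))"
    by (rule summable_comparison_test[OF exI[of _ 0] sums_summable[OF geo]])
      (use wb in \<open>auto simp: abs_mult\<close>)
  have "(\<Sum>n. (2 * real n + 3) * norm (a n)) \<le> (\<Sum>n. 9 / 20 * (3 / 8) ^ n)"
    by (intro suminf_le wb s sums_summable[OF geo])
  also have "\<dots> \<le> 1" using geo by (simp add: sums_iff)
  finally have le: "(\<Sum>n. (2 * real n + 3) * norm (a n)) \<le> 1" .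
  have fz: "f z = of_real (exp (x0 t)) * (z + (\<Sum>n. a n * z ^ (n + 2)))" if z: "z \<in> ball 0 1" for z
  proof -
    have "(\<lambda>n. c (n + 2) * z ^ (n + 2)) sums (f z - (\<Sum>k<2. c k * z ^ k))"
      using f[OF z] unfolding c_def by (rule sums_split_initial_segment)
    then have "(\<lambda>n. of_real (exp (x0 t)) * (a n * z ^ (n + 2))) sums (f z - of_real (exp (x0 t)) * z)"
      by (simp add: a_def c_def LK_coefficient_0 LK_coefficient_1 numeral_2_eq_2)
    from sums_divide[OF this, of "of_real (exp (x0 t))"]
    have "(\<lambda>n. a n * z ^ (n + 2)) sums ((f z - of_real (exp (x0 t)) * z) / of_real (exp (x0 t)))"
      by simp
    then show ?thesis by (simp add: sums_iff field_simps)
  qed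
  note S = starlike_power_series[OF _ s le fz]
  have hol: "f holomorphic_on ball 0 1"
    by (rule power_series_holomorphic[of 0 1 "\<lambda>k. LK_coefficient T x0 x k t"]) (use f in simp)
  with S(1) show u: "univalent_on_disc f" by (simp add: univalent_on_disc_def)
  have "f 0 = 0" by (simp add: fz)
  with u S(2) show "starlike_on_disc f" by (simp add: starlike_on_disc_def)
qed

section \<open>Existence, uniqueness and starlikeness\<close>

text \<open>
  On the unit disc \<open>|f\<^sub>s - f\<^sub>t|\<close> is at most \<open>h(s) = \<Sum>\<^sub>k |c\<^sub>k(s) - c\<^sub>k(t)|\<close>, which is continuous in \<open>s\<close> by
  uniform convergence and vanishes at \<open>t\<close>.
\<close>

lemma uniform_limit_power_series_family:
  assumes c: "\<And>k. continuous_on {0..T} (c k)" and \<rho>: "0 \<le> \<rho>" "\<rho> < 1"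
    and le: "\<And>k s. s \<in> {0..T} \<Longrightarrow> norm (c k s) \<le> B * \<rho> ^ k"
    and f: "\<And>s z. s \<in> {0..T} \<Longrightarrow> z \<in> ball 0 1 \<Longrightarrow> (\<lambda>k. c k s * z ^ k :: complex) sums f s z"
    and K: "K \<subseteq> ball 0 1" and t: "t \<in> {0..T}"
  shows "uniform_limit K f (f t) (at t within {0..T})"
proof -
  define h where "h s = (\<Sum>k. norm (c k s - c k t))" for s
  have le2: "norm (norm (c k s - c k t)) \<le> 2 * (B * \<rho> ^ k)" if "s \<in> {0..T}" for k s
    using norm_triangle_ineq4[of "c k s" "c k t"] le[OF that, of k] le[OF t, of k] by simp
  have sB: "summable (\<lambda>k. 2 * (B * \<rho> ^ k))" using \<rho> by (intro summable_mult summable_geometric) auto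
  have "uniform_limit {0..T} (\<lambda>n s. \<Sum>k<n. norm (c k s - c k t)) h sequentially"
    unfolding h_def by (rule Weierstrass_m_test[OF le2 sB])
  then have "continuous_on {0..T} h"
    by (rule uniform_limit_theorem[rotated])
      (auto intro!: always_eventually continuous_on_sum continuous_on_norm continuous_on_diff c)
  then have "(h \<longlongrightarrow> h t) (at t within {0..T})" using t by (simp add: continuous_on_def)
  moreover have "h t = 0" by (simp add: h_def)
  ultimately have lim: "(h \<longlongrightarrow> 0) (at t within {0..T})" by simp
  have fh: "dist (f s z) (f t z) \<le> h s" if s: "s \<in> {0..T}" and z: "z \<in> K" for s z
  proof -
    have z1: "norm z < 1" using z K by auto
    have sums: "(\<lambda>k. c k s * z ^ k - c k t * z ^ k) sums (f s z - f t z)"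
      using f[OF s] f[OF t] z K by (intro sums_diff) auto
    have smb: "summable (\<lambda>k. norm (c k s - c k t))"
      by (rule summable_comparison_test[OF exI[of _ 0] sB]) (use le2[OF s] in auto)
    have "norm (\<Sum>k. c k s * z ^ k - c k t * z ^ k) \<le> (\<Sum>k. norm (c k s - c k t))"
    proof (rule norm_suminf_le[OF _ smb])
      fix k
      have "norm (c k s - c k t) * norm z ^ k \<le> norm (c k s - c k t) * 1"
        using z1 by (intro mult_left_mono power_le_one) auto
      then show "norm (c k s * z ^ k - c k t * z ^ k) \<le> norm (c k s - c k t)"
        by (simp add: norm_mult norm_power flip: left_diff_distrib)
    qed
    then show ?thesis using sums by (simp add: h_def dist_norm sums_iff)
  qed
  show ?thesis
  proof (rule uniform_limitI)
    fix e :: real assume "e > 0"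
    then have "eventually (\<lambda>s. h s < e) (at t within {0..T})" by (rule order_tendstoD(2)[OF lim])
    moreover have "eventually (\<lambda>s. s \<in> {0..T}) (at t within {0..T})"
      by (simp add: eventually_at_filter)
    ultimately show "\<forall>\<^sub>F s in at t within {0..T}. \<forall>z\<in>K. dist (f s z) (f t z) < e"
      by eventually_elim (use fh in \<open>blast intro: le_less_trans\<close>)
  qed
qed

theorem theorem1p1:
  fixes T :: real
    and \<omega> :: "real \<Rightarrow> real \<Rightarrow> real"
    and x0 :: "real \<Rightarrow> real"
    and x :: "nat \<Rightarrow> real \<Rightarrow> complex"
    and \<alpha> :: real
  assumes "T > 0"
    and "control_function T \<omega>"
    and "driving_functions T x0 x"
    and "controlled_by T x0 x \<omega>"
    and "2 * \<alpha> ^ 4 - 8 * \<alpha> ^ 3 + 11 * \<alpha> ^ 2 - 10 * \<alpha> + 2 = 0"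
    and "\<And>y::real. 2 * y ^ 4 - 8 * y ^ 3 + 11 * y ^ 2 - 10 * y + 2 = 0 \<Longrightarrow> \<alpha> \<le> y"
    and "\<omega> 0 T < \<alpha> / 2"
  shows "\<alpha> > 0 \<and>
    (\<exists>f. LK_solution T x0 x f \<and>
      (\<forall>g. LK_solution T x0 x g \<longrightarrow> (\<forall>t\<in>{0..T}. \<forall>z\<in>ball 0 1. g t z = f t z)) \<and>
      (\<forall>t\<in>{0..T}. univalent_on_disc (f t) \<and> starlike_on_disc (f t) \<and>
        extends_past_closed_disc (f t)))"
proof -
  note \<alpha> = quartic_root_bounds[OF assms(5,6)]
  have T: "0 \<le> T" and \<omega>: "\<omega> 0 T \<le> 3 / 20" using assms(1,7) \<alpha>(2) by auto
  note x = assms(3)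
  define c where "c = LK_coefficient T x0 x"
  define f where "f t z = (\<Sum>k. c k t * z ^ k)" for t z
  have cont: "continuous_on {0..T} (c k)" for k
    unfolding c_def by (rule LK_coefficient_continuous[OF T x])
  have le: "norm (c k t) \<le> 3 * exp (x0 t) * (3 / 8) ^ k" if "t \<in> {0..T}" for k t
    unfolding c_def by (rule LK_coefficient_geometric_bound[OF T assms(2) \<omega> assms(4) that])
  have sums2: "(\<lambda>k. c k t * z ^ k) sums f t z" if "t \<in> {0..T}" "z \<in> ball 0 2" for t z
    unfolding f_def by (rule geometric_power_series_sums[OF le]) (use that in auto)
  then have sums: "(\<lambda>k. c k t * z ^ k) sums f t z" if "t \<in> {0..T}" "z \<in> ball 0 1" for t z
    using that by auto
  have "continuous_on {0..T} x0" using x by (simp add: driving_functions_def)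
  then have "continuous_on {0..T} (\<lambda>t. complex_of_real (3 * exp (x0 t)))" by (intro continuous_intros)
  then obtain B where B: "B > 0" "\<And>t. t \<in> {0..T} \<Longrightarrow> norm (complex_of_real (3 * exp (x0 t))) \<le> B"
    by (rule continuous_bounded_on_Icc) blast
  have leB: "norm (c k t) \<le> B * (3 / 8) ^ k" if "t \<in> {0..T}" for k t
    using B(2)[OF that] by (intro order_trans[OF le[OF that]] mult_right_mono) (auto simp: norm_mult)
  have fam: "coefficient_family T c"
    unfolding coefficient_family_def
  proof (intro conjI allI ballI cont)
    fix r :: real assume r: "r \<in> {0<..<1}"
    have "norm (c k s) * r ^ k \<le> B" if "s \<in> {0..T}" for k s
    proof -
      have "norm (c k s) * r ^ k \<le> (B * (3 / 8) ^ k) * 1"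
        using r B(1) by (intro mult_mono leB that power_le_one) auto
      also have "\<dots> \<le> B * 1" using B(1) by (simp add: mult_left_le power_le_one)
      finally show ?thesis by simp
    qed
    then show "\<exists>M. \<forall>k. \<forall>s\<in>{0..T}. norm (c k s) * r ^ k \<le> M" by blast
  qed
  have hol: "f t holomorphic_on ball 0 2" if "t \<in> {0..T}" for t
    by (rule power_series_holomorphic[of 0 2 "\<lambda>k. c k t"]) (use sums2[OF that] in simp)
  have ceq: "coefficient_equation T x0 x c"
    unfolding c_def by (rule LK_coefficient_equation[OF T x])
  have sol: "LK_solution T x0 x f"
    unfolding LK_solution_def
  proof (intro conjI allI ballI impI)
    show "f t holomorphic_on ball 0 1" if "t \<in> {0..T}" for t
      by (rule holomorphic_on_subset[OF hol[OF that]]) auto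
    show "uniform_limit K f (f t) (at t within {0..T})"
      if "compact K \<and> K \<subseteq> ball 0 1" "t \<in> {0..T}" for K t
      by (rule uniform_limit_power_series_family[OF cont _ _ leB sums]) (use that in auto)
    show "f t z - z = cintegral T (\<lambda>s. of_real (x0 s)) {0..t} (\<lambda>s. z * deriv (f s) z)
                  + cintegral T (\<xi> x z) {0..t} (\<lambda>s. z * deriv (f s) z)"
      if "t \<in> {0..T}" "z \<in> ball 0 1" for t z
      using LK_equation_iff_coefficient_equation[OF T x fam sums] ceq that by blast
  qed
  have uniq: "g t z = f t z" if g: "LK_solution T x0 x g" and t: "t \<in> {0..T}" and z: "z \<in> ball 0 1" for g t z
  proof -
    define d where "d k s = (deriv ^^ k) (g s) 0 / fact k" for k s
    note G = LK_solution_taylor[OF T x g, folded d_def]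
    have "d k t = c k t" for k
      using G(1,2) cont ceq t by (intro coefficient_equation_unique[OF T x]) (auto simp: coefficient_family_def)
    then show ?thesis using G(3)[OF t z] sums[OF t z] sums_unique2 by simp
  qed
  have "univalent_on_disc (f t) \<and> starlike_on_disc (f t) \<and> extends_past_closed_disc (f t)"
    if t: "t \<in> {0..T}" for t
  proof (intro conjI)
    note S = LK_series_starlike[OF T assms(2) \<omega> assms(4) t sums[OF t, unfolded c_def]]
    show "univalent_on_disc (f t)" by (rule S(1))
    show "starlike_on_disc (f t)" by (rule S(2))
    show "extends_past_closed_disc (f t)"
      unfolding extends_past_closed_disc_def
      by (intro exI[of _ "ball 0 2"] exI[of _ "f t"] conjI hol t) auto
  qed
  then show ?thesis using \<alpha>(1) sol uniq by blast
qed

end
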